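(* Let $\Sigma_n(P_1,P_0,\mathcal H,\widetilde W_B,\widetilde W_C)$ be a hyperbolic boundary control system satisfying the standing assumptions (1)–(5) and such that there exist $K,M\in\mathbb K^{n\times n}$ with $K$ invertible and $$\widetilde W_B=K\begin{pmatrix}Q_+-MQ_-&Q_--MQ_+\end{pmatrix}.$$ Let $\alpha\in\mathbb R$ be such that $\mathbb C_\alpha\subset\rho(\widetilde A)$. Then for $s\in\rho(A)\cap\mathbb C_\alpha$ the transfer function is given by $$\mathbf G(s)=\mathbf Z(s)\left(\mathbb 1_n-M\mathbf U(s)\right)^{-1}K^{-1},\qquad\text{where}\quad \mathbf Z(s)=\widetilde W_C\begin{bmatrix}\Psi_b^s\\\mathbb 1_n\end{bmatrix}\mathbf V(s)^{-1}.$$ This holds in particular on $\mathbb C_{\widetilde\alpha}\subset\rho(A)\cap\mathbb C_\alpha$ for some $\widetilde\alpha\ge\alpha$.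
   Context: Let $\mathbb K\in\{\mathbb R,\mathbb C\}$, $a<b$, $n\ge1$, $\mathbb 1_n$ the $n\times n$ identity matrix, and $\mathbb C_\alpha=\{z\in\mathbb C:\mathrm{Re}\,z>\alpha\}$. **hBCS.** $\Sigma_n(P_1,P_0,\mathcal H,\widetilde W_B,\widetilde W_C)$ denotes the system on $[a,b]\times[0,\infty)$ with state $x(\xi,t)\in\mathbb K^n$, input $u(t)\in\mathbb K^n$, output $y(t)\in\mathbb K^n$: $$\tfrac{\partial x}{\partial t}(\xi,t)=P_1\tfrac{\partial}{\partial\xi}(\mathcal H(\xi)x(\xi,t))+P_0(\xi)\mathcal H(\xi)x(\xi,t),\quad x(\xi,0)=x_0(\xi),$$ $$u(t)=\widetilde W_B\begin{bmatrix}(\mathcal Hx)(b,t)\\(\mathcal Hx)(a,t)\end{bmatrix},\qquad y(t)=\widetilde W_C\begin{bmatrix}(\mathcal Hx)(b,t)\\(\mathcal Hx)(a,t)\end{bmatrix}.$$ **Standing assumptions.** (1) $P_1\in\mathbb K^{n\times n}$ is invertible and self-adjoint. (2) $P_0\in L^\infty([a,b],\mathbb K^{n\times n})$. (3) $\mathcal H\in L^\infty([a,b],\mathbb K^{n\times n})$, $\mathcal H(\xi)$ is self-adjoint and $m_0\mathbb 1_n\le\mathcal H(\xi)\le M_0\mathbb 1_n$ for a.e. $\xi$, for some constants $m_0,M_0>0$. (4) $\widetilde W_B\in\mathbb K^{n\times2n}$ and $\begin{bmatrix}\widetilde W_B\\\widetilde W_C\end{bmatrix}\in\mathbb K^{2n\times2n}$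 have full rank. (5) The operator $Ax_0=P_1\frac{\partial}{\partial\xi}(\mathcal Hx_0)+P_0\mathcal Hx_0$ with domain $\{x_0\in X:\mathcal Hx_0\in H^1([a,b],\mathbb K^n),\ \widetilde W_B\begin{bmatrix}(\mathcal Hx_0)(b)\\(\mathcal Hx_0)(a)\end{bmatrix}=0\}$ generates a $C_0$-semigroup on $X=L^2([a,b],\mathbb K^n)$ with inner product $\langle f,g\rangle_X=\frac12\int_a^bg^*\mathcal Hf\,d\xi$. Resolvent sets $\rho(\cdot)$ are taken for the complexification if $\mathbb K=\mathbb R$. **Transfer function.** For $s\in\rho(A)$, $\mathbf G(s)$ is the unique $n\times n$ matrix such that for every $u_0$ the (unique) $x_0$ with $\mathcal Hx_0\in H^1$ satisfying $$sx_0(\xi)=P_1\tfrac{d}{d\xi}(\mathcal H(\xi)x_0(\xi))+P_0(\xi)\mathcal H(\xi)x_0(\xi),\qquad u_0=\widetilde W_B\begin{bmatrix}(\mathcal Hx_0)(b)\\(\mathcal Hx_0)(a)\end{bmatrix}$$ satisfies $\mathbf G(s)u_0=\widetilde W_C\begin{bmatrix}(\mathcal Hx_0)(b)\\(\mathcal Hx_0)(a)\end{bmatrix}$. **Fundamental solution.** For $s\in\mathbb C$, $\zeta\mapsto\Psi_\zeta^s$ is the continuous $n\times n$-matrix-valued fundamental solution on $[a,b]$ of $v'(\zeta)=-P_1^{-1}\left(P_0(\zeta)-s\mathcal H^{-1}(\zeta)\right)v(\zeta)$ with $\Psi_a^s=\mathbb 1_n$. **$Q_\pm$.** Let $E_+$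 (resp. $E_-$) be the span of the eigenvectors of $P_1$ to positive (resp. negative) eigenvalues, so $\mathbb K^n=E_+\oplus E_-$, and $\iota_\pm:E_\pm\to\mathbb K^n$ the canonical embeddings. Put $P_1^\pm=\iota_\pm^*(\pm P_1)\iota_\pm:E_\pm\to E_\pm$ (strictly positive self-adjoint) and $Q_\pm=\iota_\pm(P_1^\pm)^{1/2}\iota_\pm^*\in\mathbb K^{n\times n}$. **$\widetilde A$, $\mathbf V$, $\mathbf U$.** $\widetilde A$ is the operator given by the same expression as $A$ but with $\widetilde W_B$ replaced by $\begin{bmatrix}Q_+&Q_-\end{bmatrix}$ in its domain; it generates a $C_0$-semigroup on $X$, so some $\mathbb C_\alpha$ is contained in $\rho(\widetilde A)$, and $Q_-+Q_+\Psi_b^s$ is invertible for $s\in\rho(\widetilde A)$. For $s\in\mathbb C_\alpha$ define $\mathbf V(s)=Q_-+Q_+\Psi_b^s$ and $\mathbf U(s)=(Q_++Q_-\Psi_b^s)\mathbf V(s)^{-1}$. *)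

theory Defs
  imports "HOL-Analysis.Analysis"
begin

text \<open>
  The scalar field is a set \<open>F\<close> of complex numbers, either \<open>\<real>\<close> or \<open>UNIV\<close>. Vectors and matrices over it
  are complex vectors and matrices whose entries lie in \<open>F\<close>. An index of type \<open>'n + 'n\<close> runs over
  \<open>2n\<close> positions, first the \<open>Inl\<close> block and then the \<open>Inr\<close> block.
\<close>

definition Fvec :: "complex set \<Rightarrow> (complex^'n) set" where
  "Fvec F = {v. \<forall>i. v $ i \<in> F}"

definition Fmat :: "complex set \<Rightarrow> (complex^'n^'m) set" where
  "Fmat F = {A. \<forall>i j. A $ i $ j \<in> F}"

definition vstack :: "'a^'n \<Rightarrow> 'a^'m \<Rightarrow> 'a^('n + 'm)" where
  "vstack u v = (\<chi> i. case i of Inl k \<Rightarrow> u $ k | Inr k \<Rightarrow> v $ k)"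

definition hblock :: "'a^'n^'k \<Rightarrow> 'a^'m^'k \<Rightarrow> 'a^('n + 'm)^'k" where
  "hblock A B = (\<chi> i. vstack (A $ i) (B $ i))"

definition vblock :: "'a^'k^'n \<Rightarrow> 'a^'k^'m \<Rightarrow> 'a^'k^('n + 'm)" where
  "vblock A B = vstack A B"

definition cinner :: "complex^'n \<Rightarrow> complex^'n \<Rightarrow> complex" where
  "cinner v w = (\<Sum>i\<in>UNIV. cnj (w $ i) * v $ i)"

definition self_adjoint :: "complex^'n^'n \<Rightarrow> bool" where
  "self_adjoint A \<longleftrightarrow> (\<chi> i j. cnj (A $ j $ i)) = A"

definition loewner_le :: "complex set \<Rightarrow> complex^'n^'n \<Rightarrow> complex^'n^'n \<Rightarrow> bool" where
  "loewner_le F A B \<longleftrightarrow> (\<forall>v \<in> Fvec F. 0 \<le> Re (cinner ((B - A) *v v) v))"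

definition right_half_plane :: "real \<Rightarrow> complex set" where
  "right_half_plane \<alpha> = {z. Re z > \<alpha>}"


text \<open>
  Elements of \<open>L\<^sup>2\<close> and \<open>L\<^sup>\<infinity>\<close> are represented by functions; two functions stand for the same element iff they
  agree almost everywhere on \<open>{a..b}\<close>. All notions below are invariant under this identification.
\<close>

type_synonym 'n state = "real \<Rightarrow> complex^'n"

definition L2 :: "complex set \<Rightarrow> real \<Rightarrow> real \<Rightarrow> ('n::finite) state set" where
  "L2 F a b = {f. f \<in> borel_measurable (lebesgue_on {a..b}) \<and>
                  integrable (lebesgue_on {a..b}) (\<lambda>\<xi>. (norm (f \<xi>))\<^sup>2) \<and>
                  (AE \<xi> in lebesgue_on {a..b}. f \<xi> \<in> Fvec F)}"

definition Linf_mat :: "complex set \<Rightarrow> real \<Rightarrow> real \<Rightarrow> (real \<Rightarrow> complex^'n^'n::finite) set" where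
  "Linf_mat F a b = {P. P \<in> borel_measurable (lebesgue_on {a..b}) \<and>
                  (\<exists>C. AE \<xi> in lebesgue_on {a..b}. norm (P \<xi>) \<le> C) \<and>
                  (AE \<xi> in lebesgue_on {a..b}. P \<xi> \<in> Fmat F)}"

text \<open>
  \<open>H1 F a b w w'\<close>: the function \<open>w\<close> is absolutely continuous on \<open>{a..b}\<close> with derivative
  \<open>w'\<close> in \<open>L\<^sup>2\<close>, that is, \<open>w\<close> is the continuous representative of an element of \<open>H\<^sup>1\<close>. Boundary values
  of elements of \<open>H\<^sup>1\<close> are those of this representative.
\<close>

definition H1 :: "complex set \<Rightarrow> real \<Rightarrow> real \<Rightarrow> ('n::finite) state \<Rightarrow> 'n state \<Rightarrow> bool" where
  "H1 F a b w w' \<longleftrightarrow> w' \<in> L2 F a b \<and> w a \<in> Fvec F \<and>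
     (\<forall>\<xi>\<in>{a..b}. w \<xi> = w a + (LINT \<tau>|lebesgue_on {a..\<xi>}. w' \<tau>))"

definition X_inner ::
  "real \<Rightarrow> real \<Rightarrow> (real \<Rightarrow> complex^'n^'n) \<Rightarrow> 'n state \<Rightarrow> ('n::finite) state \<Rightarrow> complex" where
  "X_inner a b H f g = 1/2 * (LINT \<xi>|lebesgue_on {a..b}. cinner (H \<xi> *v f \<xi>) (g \<xi>))"

definition X_norm :: "real \<Rightarrow> real \<Rightarrow> (real \<Rightarrow> complex^'n^'n) \<Rightarrow> ('n::finite) state \<Rightarrow> real" where
  "X_norm a b H f = sqrt (Re (X_inner a b H f f))"


text \<open>
  Operators are graphs. A space is a carrier \<open>X\<close> with a seminorm \<open>nrm\<close>, and equality of elements is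
  \<open>nrm (f - g) = 0\<close>; since \<open>T t\<close> is linear and bounded, it respects this equality.
\<close>

definition C0_semigroup ::
  "complex set \<Rightarrow> 'n state set \<Rightarrow> ('n state \<Rightarrow> real) \<Rightarrow> (real \<Rightarrow> 'n state \<Rightarrow> ('n::finite) state) \<Rightarrow> bool"
  where
  "C0_semigroup F X nrm T \<longleftrightarrow>
     (\<forall>t\<ge>0. \<forall>f\<in>X. T t f \<in> X) \<and>
     (\<forall>t\<ge>0. \<forall>f\<in>X. \<forall>g\<in>X. \<forall>c\<in>F. \<forall>d\<in>F.
        nrm (\<lambda>\<xi>. T t (\<lambda>\<eta>. c *s f \<eta> + d *s g \<eta>) \<xi> - (c *s T t f \<xi> + d *s T t g \<xi>)) = 0) \<and>
     (\<forall>t\<ge>0. \<exists>C. \<forall>f\<in>X. nrm (T t f) \<le> C * nrm f) \<and>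
     (\<forall>f\<in>X. nrm (\<lambda>\<xi>. T 0 f \<xi> - f \<xi>) = 0) \<and>
     (\<forall>t\<ge>0. \<forall>r\<ge>0. \<forall>f\<in>X. nrm (\<lambda>\<xi>. T (t + r) f \<xi> - T t (T r f) \<xi>) = 0) \<and>
     (\<forall>f\<in>X. ((\<lambda>t. nrm (\<lambda>\<xi>. T t f \<xi> - f \<xi>)) \<longlongrightarrow> 0) (at_right 0))"

definition generator ::
  "'n state set \<Rightarrow> ('n state \<Rightarrow> real) \<Rightarrow> (real \<Rightarrow> 'n state \<Rightarrow> 'n state) \<Rightarrow> ('n state \<times> ('n::finite) state) set"
  where
  "generator X nrm T = {(f, g). f \<in> X \<and> g \<in> X \<and>
     ((\<lambda>t. nrm (\<lambda>\<xi>. (1/t) *\<^sub>R (T t f \<xi> - f \<xi>) - g \<xi>)) \<longlongrightarrow> 0) (at_right 0)}"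

definition generates_C0_semigroup ::
  "complex set \<Rightarrow> 'n state set \<Rightarrow> ('n state \<Rightarrow> real) \<Rightarrow> ('n state \<times> ('n::finite) state) set \<Rightarrow> bool" where
  "generates_C0_semigroup F X nrm A \<longleftrightarrow> (\<exists>T. C0_semigroup F X nrm T \<and> generator X nrm T = A)"

definition complexification ::
  "complex set \<Rightarrow> ('n state \<times> 'n state) set \<Rightarrow> ('n state \<times> ('n::finite) state) set" where
  "complexification F A = (if F = \<real>
     then {(\<lambda>\<xi>. f1 \<xi> + \<i> *s f2 \<xi>, \<lambda>\<xi>. g1 \<xi> + \<i> *s g2 \<xi>) | f1 f2 g1 g2. (f1, g1) \<in> A \<and> (f2, g2) \<in> A}
     else A)"

text \<open>
  Surjectivity of \<open>s - A\<close>, and injectivity together with boundedness of the inverse.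
\<close>

definition resolvent_set ::
  "'n state set \<Rightarrow> ('n state \<Rightarrow> real) \<Rightarrow> ('n state \<times> ('n::finite) state) set \<Rightarrow> complex set" where
  "resolvent_set X nrm A = {s.
     (\<forall>g\<in>X. \<exists>(f, h)\<in>A. nrm (\<lambda>\<xi>. (s *s f \<xi> - h \<xi>) - g \<xi>) = 0) \<and>
     (\<exists>C. \<forall>(f, h)\<in>A. nrm f \<le> C * nrm (\<lambda>\<xi>. s *s f \<xi> - h \<xi>))}"


definition hbcs_operator ::
  "complex set \<Rightarrow> real \<Rightarrow> real \<Rightarrow> complex^'n^'n \<Rightarrow> (real \<Rightarrow> complex^'n^'n) \<Rightarrow> (real \<Rightarrow> complex^'n^'n) \<Rightarrow>
   complex^('n + 'n)^'n \<Rightarrow> ('n state \<times> ('n::finite) state) set" where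
  "hbcs_operator F a b P1 P0 H W = {(f, g). f \<in> L2 F a b \<and> g \<in> L2 F a b \<and>
     (\<exists>w w'. H1 F a b w w' \<and>
        (AE \<xi> in lebesgue_on {a..b}. H \<xi> *v f \<xi> = w \<xi>) \<and>
        W *v vstack (w b) (w a) = 0 \<and>
        (AE \<xi> in lebesgue_on {a..b}. g \<xi> = P1 *v w' \<xi> + P0 \<xi> *v (H \<xi> *v f \<xi>)))}"

definition hbcs_resolvent_set ::
  "complex set \<Rightarrow> real \<Rightarrow> real \<Rightarrow> complex^'n^'n \<Rightarrow> (real \<Rightarrow> complex^'n^'n) \<Rightarrow> (real \<Rightarrow> complex^'n^'n) \<Rightarrow>
   complex^('n + 'n)^('n::finite) \<Rightarrow> complex set" where
  "hbcs_resolvent_set F a b P1 P0 H W =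
     resolvent_set (L2 UNIV a b) (X_norm a b H) (complexification F (hbcs_operator F a b P1 P0 H W))"

locale hbcs =
  fixes F :: "complex set" and a b :: real
    and P1 :: "complex^'n^('n::finite)"
    and P0 H :: "real \<Rightarrow> complex^'n^'n"
    and WB WC :: "complex^('n + 'n)^'n"
  assumes field: "F = \<real> \<or> F = UNIV"
    and interval: "a < b"
    and P1_mat: "P1 \<in> Fmat F"
    and P1_invertible: "invertible P1"
    and P1_self_adjoint: "self_adjoint P1"
    and P0_Linf: "P0 \<in> Linf_mat F a b"
    and H_Linf: "H \<in> Linf_mat F a b"
    and H_self_adjoint: "AE \<xi> in lebesgue_on {a..b}. self_adjoint (H \<xi>)"
    and H_bounds: "\<exists>m0>0. \<exists>M0>0. AE \<xi> in lebesgue_on {a..b}.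
          loewner_le F (mat (complex_of_real m0)) (H \<xi>) \<and> loewner_le F (H \<xi>) (mat (complex_of_real M0))"
    and WB_mat: "WB \<in> Fmat F"
    and WC_mat: "WC \<in> Fmat F"
    and WB_full_rank: "rank WB = CARD('n)"
    and WB_WC_full_rank: "rank (vblock WB WC) = 2 * CARD('n)"
    and generates: "generates_C0_semigroup F (L2 F a b) (X_norm a b H) (hbcs_operator F a b P1 P0 H WB)"


text \<open>
  \<open>bvp_solution a b P1 P0 H WB s u0 f w\<close>: the function \<open>f\<close> is a complex solution \<open>x\<^sub>0\<close> of the boundary
  value problem defining the transfer function, and \<open>w\<close> is the continuous representative of \<open>\<H> x\<^sub>0\<close>.
\<close>

definition bvp_solution ::
  "real \<Rightarrow> real \<Rightarrow> complex^'n^'n \<Rightarrow> (real \<Rightarrow> complex^'n^'n) \<Rightarrow> (real \<Rightarrow> complex^'n^'n) \<Rightarrow>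
   complex^('n + 'n)^'n \<Rightarrow> complex \<Rightarrow> complex^'n \<Rightarrow> 'n state \<Rightarrow> ('n::finite) state \<Rightarrow> bool" where
  "bvp_solution a b P1 P0 H WB s u0 f w \<longleftrightarrow> f \<in> L2 UNIV a b \<and>
     (\<exists>w'. H1 UNIV a b w w' \<and>
        (AE \<xi> in lebesgue_on {a..b}. H \<xi> *v f \<xi> = w \<xi>) \<and>
        (AE \<xi> in lebesgue_on {a..b}. s *s f \<xi> = P1 *v w' \<xi> + P0 \<xi> *v (H \<xi> *v f \<xi>)) \<and>
        u0 = WB *v vstack (w b) (w a))"

definition transfer_function ::
  "real \<Rightarrow> real \<Rightarrow> complex^'n^'n \<Rightarrow> (real \<Rightarrow> complex^'n^'n) \<Rightarrow> (real \<Rightarrow> complex^'n^'n) \<Rightarrow>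
   complex^('n + 'n)^'n \<Rightarrow> complex^('n + 'n)^('n::finite) \<Rightarrow> complex \<Rightarrow> complex^'n^'n" where
  "transfer_function a b P1 P0 H WB WC s = (THE G. \<forall>u0. \<exists>f w.
     bvp_solution a b P1 P0 H WB s u0 f w \<and>
     (\<forall>f' w'. bvp_solution a b P1 P0 H WB s u0 f' w' \<longrightarrow> (AE \<xi> in lebesgue_on {a..b}. f' \<xi> = f \<xi>)) \<and>
     G *v u0 = WC *v vstack (w b) (w a))"

text \<open>
  The coefficients are only essentially bounded, so the differential equation is understood almost everywhere
  for absolutely continuous functions, i.e. as an integral equation. This determines the solution on
  \<open>{a..b}\<close>; values elsewhere are irrelevant.
\<close>

definition is_fundamental_solution ::
  "real \<Rightarrow> real \<Rightarrow> complex^'n^'n \<Rightarrow> (real \<Rightarrow> complex^'n^'n) \<Rightarrow> (real \<Rightarrow> complex^'n^'n) \<Rightarrow>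
   complex \<Rightarrow> (real \<Rightarrow> complex^'n^('n::finite)) \<Rightarrow> bool" where
  "is_fundamental_solution a b P1 P0 H s \<Phi> \<longleftrightarrow> continuous_on {a..b} \<Phi> \<and>
     (\<forall>\<zeta>\<in>{a..b}. \<Phi> \<zeta> = mat 1 +
        (LINT \<tau>|lebesgue_on {a..\<zeta>}. - (matrix_inv P1 ** (P0 \<tau> - mat s ** matrix_inv (H \<tau>)) ** \<Phi> \<tau>)))"

definition fundamental_solution ::
  "real \<Rightarrow> real \<Rightarrow> complex^'n^'n \<Rightarrow> (real \<Rightarrow> complex^'n^'n) \<Rightarrow> (real \<Rightarrow> complex^'n^'n) \<Rightarrow>
   complex \<Rightarrow> real \<Rightarrow> complex^'n^('n::finite)" where
  "fundamental_solution a b P1 P0 H s = (SOME \<Phi>. is_fundamental_solution a b P1 P0 H s \<Phi>)"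


text \<open>
  \<open>Q_mat F P1 \<sigma>\<close> is \<open>Q\<^sub>+\<close> for \<open>\<sigma> = 1\<close> and \<open>Q\<^sub>-\<close> for \<open>\<sigma> = -1\<close>; \<open>embed_adj E\<close> is the adjoint of
  the embedding of the subspace \<open>E\<close>, i.e. the orthogonal projection onto \<open>E\<close>.
\<close>

definition Fspan :: "complex set \<Rightarrow> (complex^'n) set \<Rightarrow> (complex^'n) set" where
  "Fspan F B = {\<Sum>v\<in>t. c v *s v | t c. finite t \<and> t \<subseteq> B \<and> (\<forall>v\<in>t. c v \<in> F)}"

definition E_space :: "complex set \<Rightarrow> complex^'n^'n \<Rightarrow> real \<Rightarrow> (complex^'n) set" where
  "E_space F P1 \<sigma> =
     Fspan F {v \<in> Fvec F. v \<noteq> 0 \<and> (\<exists>\<mu>::real. \<sigma> * \<mu> > 0 \<and> P1 *v v = complex_of_real \<mu> *s v)}"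

definition embed_adj :: "(complex^'n) set \<Rightarrow> complex^'n \<Rightarrow> complex^'n" where
  "embed_adj E v = (THE p. p \<in> E \<and> (\<forall>e\<in>E. cinner p e = cinner v e))"

definition is_pos_sqrt_on ::
  "complex set \<Rightarrow> (complex^'n) set \<Rightarrow> (complex^'n \<Rightarrow> complex^'n) \<Rightarrow> (complex^'n \<Rightarrow> complex^'n) \<Rightarrow> bool" where
  "is_pos_sqrt_on F E T S \<longleftrightarrow>
     (\<forall>x\<in>E. S x \<in> E) \<and>
     (\<forall>x\<in>E. \<forall>y\<in>E. \<forall>c\<in>F. \<forall>d\<in>F. S (c *s x + d *s y) = c *s S x + d *s S y) \<and>
     (\<forall>x\<in>E. \<forall>y\<in>E. cinner (S x) y = cinner x (S y)) \<and>
     (\<forall>x\<in>E. 0 \<le> Re (cinner (S x) x)) \<and>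
     (\<forall>x\<in>E. S (S x) = T x)"

definition Q_mat :: "complex set \<Rightarrow> complex^'n^'n \<Rightarrow> real \<Rightarrow> complex^'n^'n" where
  "Q_mat F P1 \<sigma> = (let E = E_space F P1 \<sigma>; P1\<sigma> = (\<lambda>x. embed_adj E (\<sigma> *\<^sub>R (P1 *v x))) in
     THE Q. Q \<in> Fmat F \<and>
       (\<exists>S. is_pos_sqrt_on F E P1\<sigma> S \<and> (\<forall>v\<in>Fvec F. Q *v v = S (embed_adj E v))))"

abbreviation Q_plus :: "complex set \<Rightarrow> complex^'n^'n \<Rightarrow> complex^'n^'n" where
  "Q_plus F P1 \<equiv> Q_mat F P1 1"

abbreviation Q_minus :: "complex set \<Rightarrow> complex^'n^'n \<Rightarrow> complex^'n^'n" where
  "Q_minus F P1 \<equiv> Q_mat F P1 (- 1)"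

definition V_fun ::
  "complex set \<Rightarrow> real \<Rightarrow> real \<Rightarrow> complex^'n^'n \<Rightarrow> (real \<Rightarrow> complex^'n^'n) \<Rightarrow> (real \<Rightarrow> complex^'n^'n) \<Rightarrow>
   complex \<Rightarrow> complex^'n^('n::finite)" where
  "V_fun F a b P1 P0 H s = Q_minus F P1 + Q_plus F P1 ** fundamental_solution a b P1 P0 H s b"

definition U_fun ::
  "complex set \<Rightarrow> real \<Rightarrow> real \<Rightarrow> complex^'n^'n \<Rightarrow> (real \<Rightarrow> complex^'n^'n) \<Rightarrow> (real \<Rightarrow> complex^'n^'n) \<Rightarrow>
   complex \<Rightarrow> complex^'n^('n::finite)" where
  "U_fun F a b P1 P0 H s =
     (Q_plus F P1 + Q_minus F P1 ** fundamental_solution a b P1 P0 H s b) ** matrix_inv (V_fun F a b P1 P0 H s)"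

definition Z_fun ::
  "complex set \<Rightarrow> real \<Rightarrow> real \<Rightarrow> complex^'n^'n \<Rightarrow> (real \<Rightarrow> complex^'n^'n) \<Rightarrow> (real \<Rightarrow> complex^'n^'n) \<Rightarrow>
   complex^('n + 'n)^'n \<Rightarrow> complex \<Rightarrow> complex^'n^('n::finite)" where
  "Z_fun F a b P1 P0 H WC s =
     WC ** vblock (fundamental_solution a b P1 P0 H s b) (mat 1) ** matrix_inv (V_fun F a b P1 P0 H s)"

end

theory Submission
  imports Defs
begin

text \<open>
  Write \<open>\<Psi>\<close> for the fundamental solution. Every solution \<open>w = \<H> x\<^sub>0\<close> of the homogeneous equation is
  \<open>\<Psi> v\<close> with \<open>v = w a\<close>, so a boundary operator \<open>W\<close> acts on solutions through the matrix
  \<open>N\<^sub>W s = W [\<Psi>\<^sub>b; 1]\<close>. By variation of constants, \<open>s\<close> lies in the resolvent set of the operator with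
  boundary condition \<open>W\<close> iff \<open>N\<^sub>W s\<close> is invertible, and then the transfer function is
  \<open>W\<^sub>C [\<Psi>\<^sub>b; 1] (N\<^sub>W s)\<^sup>-\<^sup>1\<close>. For \<open>[Q\<^sub>+ Q\<^sub>-]\<close> this matrix is \<open>V\<close>, for \<open>W\<^sub>B\<close> it is
  \<open>K (1 - M U) V\<close>, which gives the formula.

  That some right half plane lies in the resolvent set then only requires that \<open>A\<close> has no eigenvalues of large
  real part. The eigenspace of \<open>s\<close> is finite-dimensional and invariant under the semigroup \<open>T\<close>, hence
  \<open>\<parallel>T h f - f - h s f\<parallel> \<le> h \<parallel>f\<parallel>\<close> on it for all small \<open>h\<close>. Iterating with \<open>h = 1/n\<close>,
  \<open>\<parallel>T 1 f\<parallel> \<ge> (1 + (Re s - 1)/n)\<^sup>n \<parallel>f\<parallel> \<ge> Re s \<parallel>f\<parallel>\<close>, so \<open>Re s\<close> is at most the norm of \<open>T 1\<close>.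
  In the real case the semigroup and the operator are complexified first; this needs that
  \<open>Q\<^sub>\<pm>\<close> are real.
\<close>

section \<open>Block matrices and bilinear maps\<close>

text \<open>The resolvent equation leaves only the initial value \<open>w a\<close> free, so the
  boundary condition is one square linear system for it. For square matrices a trivial kernel
  already means invertibility; this is why excluding eigenvalues is enough to place a half plane in
  the resolvent set. The growth of an eigenvector would follow at once from
  \<open>T t f = exp (s t) f\<close>, but the generator only provides the right derivative at time
  0. The detour through the eigenspace makes this derivative uniform: all iterates
  \<open>T (k h) f\<close> stay in one finite-dimensional space, so one step size \<open>h\<close>
  serves each of them. The unit in \<open>Re s - 1\<close> is the price of the crude defect bound
  \<open>nrm f\<close>. Two encodings shape the details. States are functions up to equality almost
  everywhere, so operator identities hold only almost everywhere and must be carried through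
  \<open>T\<close> by hand. Moreover \<open>Q_mat\<close> is a definite description: its entries are
  known to be real only after existence and uniqueness have been shown, and a boundary matrix must
  be real for the complexified operator to be the complex operator with the same matrix.\<close>

lemma bounded_bilinear_mv: "bounded_bilinear ((*v) :: complex^'n^'m \<Rightarrow> complex^'n \<Rightarrow> complex^'m)"
  unfolding bilinear_conv_bounded_bilinear[symmetric] bilinear_def
  by (auto intro!: linearI simp: matrix_vector_mult_def vec_eq_iff algebra_simps sum.distrib
      scaleR_sum_right)

lemma bounded_bilinear_mm:
  "bounded_bilinear ((**) :: complex^'n^'m \<Rightarrow> complex^'k^'n \<Rightarrow> complex^'k^'m)"
  unfolding bilinear_conv_bounded_bilinear[symmetric] bilinear_def
  by (auto intro!: linearI simp: matrix_matrix_mult_def vec_eq_iff algebra_simps sum.distrib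
      scaleR_sum_right)

lemma inner_eq_Re_cinner: "x \<bullet> y = Re (cinner x y)"
  by (simp add: inner_vec_def cinner_def inner_complex_def algebra_simps)

lemma sum_UNIV_Plus:
  fixes f :: "'n::finite + 'm::finite \<Rightarrow> 'a::comm_monoid_add"
  shows "sum f UNIV = (\<Sum>k\<in>UNIV. f (Inl k)) + (\<Sum>k\<in>UNIV. f (Inr k))"
  using sum.Plus[of "UNIV::'n set" "UNIV::'m set" f] by (simp add: UNIV_Plus_UNIV o_def)

lemma hblock_mult_vstack:
  fixes A :: "'a::semiring_1^'n::finite^'k" and B :: "'a^'m::finite^'k"
  shows "hblock A B *v vstack x y = A *v x + B *v y"
  by (simp add: hblock_def vstack_def matrix_vector_mult_def vec_eq_iff sum_UNIV_Plus)

lemma vblock_mult_vec: "vblock A B *v x = vstack (A *v x) (B *v x)"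
  by (auto simp: vblock_def vstack_def matrix_vector_mult_def vec_eq_iff split: sum.split)

lemma vstack_add: "vstack (u + u') (v + v') = vstack u v + vstack u' v'"
  by (auto simp: vstack_def vec_eq_iff split: sum.split)

lemma Fmat_UNIV [simp]: "A \<in> Fmat UNIV" by (simp add: Fmat_def)
lemma Fvec_UNIV [simp]: "v \<in> Fvec UNIV" by (simp add: Fvec_def)

section \<open>The matrices \<open>Q\<^sub>\<pm>\<close> over the reals\<close>

lemma cinner_Fvec_Reals:
  assumes "x \<in> Fvec \<real>" "y \<in> Fvec \<real>"
  shows "cinner x y = complex_of_real (x \<bullet> y)"
proof -
  have "cinner x y \<in> \<real>"
    unfolding cinner_def using assms by (auto simp: Fvec_def Reals_cnj_iff intro!: sum_in_Reals Reals_mult)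
  then show ?thesis by (simp add: inner_eq_Re_cinner)
qed

lemma subspace_Fvec_Reals: "subspace (Fvec \<real>)"
  by (auto simp: subspace_def Fvec_def scaleR_conv_of_real[where 'a=complex])

lemma complex_scaleR_eq: "complex_of_real r *s (v::complex^'n) = r *\<^sub>R v"
  by (simp add: vec_eq_iff) (simp add: scaleR_conv_of_real)

text \<open>Makes the theory of real subspaces available: complex vectors are regarded as a real
  vector space.\<close>

lemma Fspan_Reals: "Fspan \<real> B = span B"
proof (intro subset_antisym subsetI)
  fix x assume "x \<in> Fspan \<real> B"
  then obtain t c where t: "x = (\<Sum>v\<in>t. c v *s v)" "t \<subseteq> B" "\<forall>v\<in>t. c v \<in> \<real>"
    by (auto simp: Fspan_def)
  then have "x = (\<Sum>v\<in>t. Re (c v) *\<^sub>R v)"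
    by (auto intro!: sum.cong simp flip: complex_scaleR_eq)
  also have "\<dots> \<in> span B" using t by (intro span_sum span_scale span_base) auto
  finally show "x \<in> span B" .
next
  fix x assume "x \<in> span B"
  then obtain t r where t: "x = (\<Sum>v\<in>t. r v *\<^sub>R v)" "t \<subseteq> B" "finite t"
    by (auto simp: span_explicit)
  then have "x = (\<Sum>v\<in>t. complex_of_real (r v) *s v) \<and> finite t \<and> t \<subseteq> B \<and> (\<forall>v\<in>t. complex_of_real (r v) \<in> \<real>)"
    by (simp add: complex_scaleR_eq)
  then show "x \<in> Fspan \<real> B" unfolding Fspan_def mem_Collect_eq
    by (intro exI[of _ t] exI[of _ "\<lambda>v. complex_of_real (r v)"])
qed

lemma self_adjoint_inner:
  assumes "self_adjoint A"
  shows "(A *v x) \<bullet> y = x \<bullet> (A *v y)"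
proof -
  have A: "cnj (A $ j $ i) = A $ i $ j" for i j
    using assms by (simp add: self_adjoint_def vec_eq_iff)
  have "cinner (A *v x) y = (\<Sum>i\<in>UNIV. \<Sum>j\<in>UNIV. cnj (y $ i) * (A $ i $ j * x $ j))"
    by (simp add: cinner_def matrix_vector_mult_def sum_distrib_left)
  also have "\<dots> = (\<Sum>j\<in>UNIV. \<Sum>i\<in>UNIV. cnj (y $ i) * (A $ i $ j * x $ j))" by (rule sum.swap)
  also have "\<dots> = cinner x (A *v y)"
    by (simp add: cinner_def matrix_vector_mult_def sum_distrib_right sum_distrib_left A ac_simps)
  finally show ?thesis by (simp add: inner_eq_Re_cinner)
qed


lemma mv_scaleR: "(A::complex^'n^'m) *v (r *\<^sub>R v) = r *\<^sub>R (A *v v)"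
  by (rule bounded_bilinear.scaleR_right[OF bounded_bilinear_mv])

lemma mv_sum: "(A::complex^'n^'m) *v (\<Sum>i\<in>I. f i) = (\<Sum>i\<in>I. A *v f i)"
  by (rule bounded_bilinear.sum_right[OF bounded_bilinear_mv])

lemma mv_Fvec_Reals:
  assumes "A \<in> Fmat \<real>" "v \<in> Fvec \<real>" shows "A *v v \<in> Fvec \<real>"
  using assms by (auto simp: Fmat_def Fvec_def matrix_vector_mult_def intro!: sum_in_Reals Reals_mult)

text \<open>The unit vectors are real, so real test vectors determine even a complex matrix.\<close>

lemma Fmat_Reals_eqI:
  fixes A B :: "complex^'n^'m"
  assumes "\<And>v. v \<in> Fvec \<real> \<Longrightarrow> A *v v = B *v v"
  shows "A = B"
proof -
  have "A $ i $ j = B $ i $ j" for i j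
  proof -
    have "A *v axis j 1 = B *v axis j 1"
      by (rule assms) (simp add: Fvec_def axis_def)
    then show ?thesis
      by (simp add: matrix_vector_mult_def axis_def vec_eq_iff if_distrib cong: if_cong)
  qed
  then show ?thesis by (simp add: vec_eq_iff)
qed

definition E_eigen :: "complex^'n^'n \<Rightarrow> real \<Rightarrow> (complex^'n) set" where
  "E_eigen P \<sigma> = {v \<in> Fvec \<real>. v \<noteq> 0 \<and> (\<exists>\<mu>::real. \<sigma> * \<mu> > 0 \<and> P *v v = complex_of_real \<mu> *s v)}"

text \<open>The spectral theorem for the eigenvalues of one sign. A largest orthonormal set of such
  eigenvectors must span: the part of an eigenvector orthogonal to it would, once normalised,
  enlarge the set.\<close>

lemma E_space_orthonormal_eigenbasis:
  fixes P :: "complex^'n^('n::finite)"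
  assumes P: "P \<in> Fmat \<real>" "self_adjoint P"
  obtains B m where "finite B" "B \<subseteq> Fvec \<real>" "\<And>c. c \<in> B \<Longrightarrow> c \<bullet> c = 1"
    "\<And>c d. c \<in> B \<Longrightarrow> d \<in> B \<Longrightarrow> c \<noteq> d \<Longrightarrow> c \<bullet> d = 0"
    "\<And>c. c \<in> B \<Longrightarrow> \<sigma> * m c > 0" "\<And>c. c \<in> B \<Longrightarrow> P *v c = m c *\<^sub>R c"
    "E_space \<real> P \<sigma> = span B"
proof -
  define EV where "EV = E_eigen P \<sigma>"
  define ok where "ok B \<longleftrightarrow> B \<subseteq> EV \<and> (\<forall>c\<in>B. c \<bullet> c = 1) \<and> (\<forall>c\<in>B. \<forall>d\<in>B. c \<noteq> d \<longrightarrow> c \<bullet> d = 0)" for B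
  have fin: "finite B \<and> card B \<le> DIM(complex^'n)" if "ok B" for B
  proof -
    have "independent B"
      by (rule pairwise_orthogonal_independent)
        (use that in \<open>auto simp: ok_def pairwise_def orthogonal_def\<close>)
    then show ?thesis using independent_bound by blast
  qed
  have "ok {}" by (simp add: ok_def)
  moreover have "\<forall>B. ok B \<longrightarrow> card B < Suc DIM(complex^'n)" using fin by (simp add: less_Suc_eq_le)
  \<comment> \<open>Orthonormal sets are independent, so the real dimension bounds their size and a
    largest one exists.\<close>
  ultimately obtain B where B: "ok B" and max: "\<And>C. ok C \<Longrightarrow> card C \<le> card B"
    using ex_has_greatest_nat[of ok "{}" card "Suc DIM(complex^'n)"] by metis
  have "\<exists>\<mu>. \<sigma> * \<mu> > 0 \<and> P *v c = \<mu> *\<^sub>R c" if "c \<in> B" for c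
    using that B by (auto simp: ok_def EV_def E_eigen_def complex_scaleR_eq)
  then obtain m where m: "\<And>c. c \<in> B \<Longrightarrow> \<sigma> * m c > 0 \<and> P *v c = m c *\<^sub>R c" by metis
  have BF: "B \<subseteq> Fvec \<real>" using B by (auto simp: ok_def EV_def E_eigen_def)
  note finB = conjunct1[OF fin[OF B]]
  have EVB: "v \<in> span B" if v: "v \<in> EV" for v
  proof -
    obtain \<mu> where \<mu>: "\<sigma> * \<mu> > 0" "P *v v = \<mu> *\<^sub>R v" and vF: "v \<in> Fvec \<real>"
      using v by (auto simp: EV_def E_eigen_def complex_scaleR_eq)
    \<comment> \<open>Subtracting only the components with the same eigenvalue keeps
      \<open>u\<close> an eigenvector; orthogonality to the rest of \<open>B\<close> comes from
      self-adjointness.\<close>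
    define B' where "B' = {c \<in> B. m c = \<mu>}"
    define u where "u = v - (\<Sum>c\<in>B'. (v \<bullet> c) *\<^sub>R c)"
    have finB': "finite B'" and B'B: "B' \<subseteq> B" using finB by (auto simp: B'_def)
    have uF: "u \<in> Fvec \<real>" unfolding u_def
      by (intro subspace_diff subspace_sum subspace_scale subspace_Fvec_Reals vF)
        (use BF B'B in auto)
    have Pu: "P *v u = \<mu> *\<^sub>R u"
    proof -
      have "P *v u = \<mu> *\<^sub>R v - (\<Sum>c\<in>B'. (v \<bullet> c) *\<^sub>R (P *v c))"
        by (simp add: u_def matrix_vector_mult_diff_distrib \<mu> mv_sum mv_scaleR)
      also have "(\<Sum>c\<in>B'. (v \<bullet> c) *\<^sub>R (P *v c)) = (\<Sum>c\<in>B'. \<mu> *\<^sub>R (v \<bullet> c) *\<^sub>R c)"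
        by (rule sum.cong) (use m in \<open>auto simp: B'_def\<close>)
      finally show ?thesis by (simp add: u_def scaleR_diff_right scaleR_sum_right)
    qed
    have ub: "u \<bullet> c = 0" if c: "c \<in> B" for c
    proof -
      have 1: "v \<bullet> c = 0" if "m c \<noteq> \<mu>"
      proof -
        have "(P *v v) \<bullet> c = v \<bullet> (P *v c)" by (rule self_adjoint_inner[OF P(2)])
        then have "\<mu> * (v \<bullet> c) = m c * (v \<bullet> c)" using \<mu> m[OF c] by simp
        then show ?thesis using that by simp
      qed
      have "(\<Sum>d\<in>B'. (v \<bullet> d) * (d \<bullet> c)) = (\<Sum>d\<in>B'. if d = c then v \<bullet> c else 0)"
        by (rule sum.cong) (use B B'B c in \<open>auto simp: ok_def\<close>)
      also have "\<dots> = (if c \<in> B' then v \<bullet> c else 0)" using finB' by simp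
      also have "\<dots> = v \<bullet> c" using 1 c by (auto simp: B'_def)
      finally show ?thesis by (simp add: u_def inner_diff_left inner_sum_left)
    qed
    have "u = 0"
    proof (rule ccontr)
      assume u0: "u \<noteq> 0"
      define u' where "u' = (1 / norm u) *\<^sub>R u"
      have n1: "u' \<bullet> u' = 1" using u0 by (simp add: u'_def dot_square_norm power2_eq_square)
      have ub': "u' \<bullet> c = 0" "c \<bullet> u' = 0" if "c \<in> B" for c
        using ub[OF that] by (simp_all add: u'_def inner_commute)
      have "u' \<in> EV"
        unfolding EV_def E_eigen_def
        using uF u0 Pu \<mu>(1) by (auto simp: u'_def complex_scaleR_eq mv_scaleR intro!: subspace_scale[OF subspace_Fvec_Reals] exI[of _ \<mu>])
      then have "ok (insert u' B)" using B n1 ub' by (auto simp: ok_def)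
      moreover have "u' \<notin> B" using ub' n1 by fastforce
      ultimately show False using max[of "insert u' B"] finB by simp
    qed
    then have "v = (\<Sum>c\<in>B'. (v \<bullet> c) *\<^sub>R c)" by (simp add: u_def)
    also have "\<dots> \<in> span B" by (intro span_sum span_scale span_base) (use B'B in auto)
    finally show ?thesis .
  qed
  have "E_space \<real> P \<sigma> = span EV" by (simp add: E_space_def EV_def E_eigen_def Fspan_Reals)
  also have "\<dots> = span B"
    using EVB B span_minimal[OF _ subspace_span, of EV B] span_mono[of B EV] by (auto simp: ok_def)
  finally show thesis using that[of B m] finB BF B m by (auto simp: ok_def)
qed

text \<open>Evaluates the description in \<open>Q_mat\<close>: in an orthonormal eigenbasis
  projection and square root are diagonal, which exhibits a real candidate, and uniqueness of the
  positive square root makes it the only one.\<close>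

lemma Q_mat_Reals:
  fixes P :: "complex^'n^('n::finite)"
  assumes P: "P \<in> Fmat \<real>" "self_adjoint P"
  shows "Q_mat \<real> P \<sigma> \<in> Fmat \<real>"
proof -
  obtain B m where finB: "finite B" and BF: "B \<subseteq> Fvec \<real>" and n1: "\<And>c. c \<in> B \<Longrightarrow> c \<bullet> c = 1"
    and orth: "\<And>c d. c \<in> B \<Longrightarrow> d \<in> B \<Longrightarrow> c \<noteq> d \<Longrightarrow> c \<bullet> d = 0"
    and mpos: "\<And>c. c \<in> B \<Longrightarrow> \<sigma> * m c > 0" and Pc: "\<And>c. c \<in> B \<Longrightarrow> P *v c = m c *\<^sub>R c"
    and EB: "E_space \<real> P \<sigma> = span B"
    using E_space_orthonormal_eigenbasis[OF P, of \<sigma>] by metis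
  define E where "E = span B"
  have EF: "E \<subseteq> Fvec \<real>" unfolding E_def
    by (rule span_minimal[OF BF subspace_Fvec_Reals])
  have Esub: "subspace E" unfolding E_def by (rule subspace_span)
  \<comment> \<open>A functional calculus: \<open>D r\<close> scales each basis vector
    \<open>c\<close> by \<open>r c\<close> and kills their orthogonal complement. Thus
    \<open>D (\<lambda>_. 1)\<close> is the orthogonal projection onto \<open>E\<close> and
    \<open>D q\<close> the square root.\<close>
  define D where "D r v = (\<Sum>c\<in>B. (r c * (v \<bullet> c)) *\<^sub>R c)" for r :: "complex^'n \<Rightarrow> real" and v
  have DE: "D r v \<in> E" for r v unfolding D_def E_def by (intro span_sum span_scale span_base)
  have Dinner: "D r v \<bullet> c = r c * (v \<bullet> c)" if "c \<in> B" for r v c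
  proof -
    have "D r v \<bullet> c = (\<Sum>d\<in>B. if d = c then r c * (v \<bullet> c) else 0)"
      unfolding D_def inner_sum_left
      by (rule sum.cong) (use that n1 orth in auto)
    then show ?thesis using finB that by simp
  qed
  have gen_defect: "D r (D r' v) = D (\<lambda>c. r c * r' c) v" for r r' v
    unfolding D_def[of r] D_def[of "\<lambda>c. r c * r' c"] by (rule sum.cong) (auto simp: Dinner)
  have Dlin: "linear (D r)" for r
    by (auto intro!: linearI simp: D_def inner_add_left algebra_simps sum.distrib scaleR_sum_right)
  have D1E: "D (\<lambda>_. 1) v = v" if "v \<in> E" for v
  proof -
    have "D (\<lambda>_. 1) v = id v"
    proof (rule linear_eq_on_span[of "D (\<lambda>_. 1)" id B])
      fix c assume c: "c \<in> B"
      have "D (\<lambda>_. 1) c = (\<Sum>d\<in>B. if d = c then d else 0)"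
        unfolding D_def by (rule sum.cong) (use c n1 orth in auto)
      then show "D (\<lambda>_. 1) c = id c" using finB c by simp
    qed (use Dlin that in \<open>auto simp: E_def linear_id\<close>)
    then show ?thesis by simp
  qed
  have adj: "embed_adj E v = D (\<lambda>_. 1) v" if v: "v \<in> Fvec \<real>" for v
    unfolding embed_adj_def
  proof (rule the_equality)
    have "D (\<lambda>_. 1) v \<bullet> e = v \<bullet> e" if "e \<in> E" for e
    proof (rule linear_eq_on_span[of "\<lambda>e. D (\<lambda>_. 1) v \<bullet> e" "\<lambda>e. v \<bullet> e" B])
      show "e \<in> span B" using that by (simp add: E_def)
    qed (auto simp: Dinner inner_add_right intro!: linearI)
    then show *: "D (\<lambda>_. 1) v \<in> E \<and> (\<forall>e\<in>E. cinner (D (\<lambda>_. 1) v) e = cinner v e)"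
      using DE EF v by (auto simp: cinner_Fvec_Reals subset_iff)
    fix p assume p: "p \<in> E \<and> (\<forall>e\<in>E. cinner p e = cinner v e)"
    let ?d = "p - D (\<lambda>_. 1) v"
    have dE: "?d \<in> E" using p DE Esub subspace_diff by blast
    have "?d \<bullet> ?d = p \<bullet> ?d - D (\<lambda>_. 1) v \<bullet> ?d" by (simp add: inner_diff_left)
    also have "\<dots> = 0" using p * dE by (simp add: inner_eq_Re_cinner)
    finally show "p = D (\<lambda>_. 1) v" by simp
  qed
  define q where "q c = sqrt (\<sigma> * m c)" for c
  have qpos: "q c > 0" and qq: "q c * q c = \<sigma> * m c" if "c \<in> B" for c
    using mpos[OF that] by (simp_all add: q_def)
  define T where "T = (\<lambda>x. embed_adj E (\<sigma> *\<^sub>R (P *v x)))"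
  have T: "T x = D (\<lambda>c. q c * q c) x" if "x \<in> E" for x
  proof -
    have "\<sigma> *\<^sub>R (P *v x) \<in> Fvec \<real>"
      using that EF P by (intro subspace_scale subspace_Fvec_Reals mv_Fvec_Reals) auto
    then have "T x = D (\<lambda>_. 1) (\<sigma> *\<^sub>R (P *v x))" unfolding T_def by (rule adj)
    also have "\<dots> = D (\<lambda>c. q c * q c) x" unfolding D_def
      by (rule sum.cong) (auto simp: qq self_adjoint_inner[OF P(2)] Pc)
    finally show ?thesis .
  qed
  \<comment> \<open>A sum of weighted rank-one projections; \<open>c $ j\<close> carries no
    conjugate because the basis is real.\<close>
  define Q where "Q = (\<chi> i j. \<Sum>c\<in>B. complex_of_real (q c) * c $ i * c $ j)"
  have QF: "Q \<in> Fmat \<real>" using BF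
    by (auto simp: Q_def Fmat_def Fvec_def intro!: sum_in_Reals Reals_mult)
  have Qv: "Q *v v = D q v" if v: "v \<in> Fvec \<real>" for v
  proof -
    have "(Q *v v) $ i = (D q v) $ i" for i
    proof -
      have "(Q *v v) $ i = (\<Sum>j\<in>UNIV. \<Sum>c\<in>B. complex_of_real (q c) * c $ i * c $ j * v $ j)"
        by (simp add: Q_def matrix_vector_mult_def sum_distrib_right)
      also have "\<dots> = (\<Sum>c\<in>B. \<Sum>j\<in>UNIV. complex_of_real (q c) * c $ i * c $ j * v $ j)" by (rule sum.swap)
      also have "\<dots> = (\<Sum>c\<in>B. complex_of_real (q c) * c $ i * cinner v c)"
      proof (rule sum.cong[OF refl])
        fix c assume "c \<in> B"
        then have "cnj (c $ j) = c $ j" for j using BF by (auto simp: Fvec_def Reals_cnj_iff)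
        then show "(\<Sum>j\<in>UNIV. complex_of_real (q c) * c $ i * c $ j * v $ j)
            = complex_of_real (q c) * c $ i * cinner v c"
          by (simp add: cinner_def sum_distrib_left mult.assoc)
      qed
      also have "\<dots> = (\<Sum>c\<in>B. complex_of_real (q c * (v \<bullet> c)) * c $ i)"
        by (rule sum.cong) (use BF v in \<open>auto simp: cinner_Fvec_Reals subset_iff\<close>)
      also have "\<dots> = D q v $ i" by (simp add: D_def scaleR_conv_of_real[where 'a=complex])
      finally show ?thesis .
    qed
    then show ?thesis by (simp add: vec_eq_iff)
  qed
  have RE: "c *s x + d *s y = Re c *\<^sub>R x + Re d *\<^sub>R y" if "c \<in> \<real>" "d \<in> \<real>" for c d and x y :: "complex^'n"
    using that complex_scaleR_eq by (metis of_real_Re)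
  have sq: "is_pos_sqrt_on \<real> E T (D q)"
    unfolding is_pos_sqrt_on_def
  proof (intro conjI ballI)
    show "D q x \<in> E" for x by (rule DE)
    show "D q (c *s x + d *s y) = c *s D q x + d *s D q y" if "c \<in> \<real>" "d \<in> \<real>" for c d x y
      using Dlin[of q] that by (simp add: RE linear_add linear_scale)
    show "cinner (D q x) y = cinner x (D q y)" if "x \<in> E" "y \<in> E" for x y
    proof -
      have "D q x \<bullet> y = x \<bullet> D q y"
        by (auto simp: D_def inner_sum_left inner_sum_right inner_commute intro!: sum.cong)
      then show ?thesis using that EF DE by (simp add: cinner_Fvec_Reals subset_iff)
    qed
    show "0 \<le> Re (cinner (D q x) x)" for x
    proof -
      have "D q x \<bullet> x = (\<Sum>c\<in>B. q c * (x \<bullet> c)\<^sup>2)"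
        unfolding D_def inner_sum_left
        by (auto simp: power2_eq_square inner_commute intro!: sum.cong)
      also have "\<dots> \<ge> 0" by (intro sum_nonneg mult_nonneg_nonneg less_imp_le[OF qpos]) auto
      finally show ?thesis by (simp add: inner_eq_Re_cinner)
    qed
    show "D q (D q x) = T x" if "x \<in> E" for x using that by (simp add: T gen_defect)
  qed
  have uniq: "S x = D q x" if S: "is_pos_sqrt_on \<real> E T S" and x: "x \<in> E" for S x
  proof -
    have Slin: "S (r *\<^sub>R x + r' *\<^sub>R y) = r *\<^sub>R S x + r' *\<^sub>R S y" if "x \<in> E" "y \<in> E" for r r' x y
      using S that unfolding is_pos_sqrt_on_def complex_scaleR_eq[symmetric] by auto
    have Sc: "S c = q c *\<^sub>R c" if c: "c \<in> B" for c
    proof -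
      have cE: "c \<in> E" using c by (simp add: E_def span_base)
      have SE: "S x \<in> E" if "x \<in> E" for x using S that by (auto simp: is_pos_sqrt_on_def)
      \<comment> \<open>\<open>S (S c) = T c\<close> says that \<open>S + q c\<close> annihilates
        \<open>y\<close>, so a nonzero \<open>y\<close> would be an eigenvector of \<open>S\<close>
        for the negative value \<open>- q c\<close>, against positivity.\<close>
      define y where "y = 1 *\<^sub>R S c + (- q c) *\<^sub>R c"
      have yE: "y \<in> E" unfolding y_def using cE SE Esub by (intro subspace_add subspace_scale) auto
      have "T c = (\<Sum>d\<in>B. if d = c then (q c * q c) *\<^sub>R c else 0)"
        unfolding T[OF cE] D_def by (rule sum.cong) (use c n1 orth in auto)
      then have Tc: "T c = (q c * q c) *\<^sub>R c" using finB c by simp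
      have "S y = 1 *\<^sub>R S (S c) + (- q c) *\<^sub>R S c" unfolding y_def by (rule Slin) (use cE SE in auto)
      also have "S (S c) = T c" using S cE by (auto simp: is_pos_sqrt_on_def)
      finally have "S y = (- q c) *\<^sub>R y" by (simp add: Tc y_def algebra_simps)
      moreover have "0 \<le> S y \<bullet> y" using S yE by (auto simp: is_pos_sqrt_on_def inner_eq_Re_cinner)
      ultimately have "q c * (y \<bullet> y) \<le> 0" by simp
      then have "y \<bullet> y \<le> 0" using qpos[OF c] by (simp add: mult_le_0_iff)
      then have "y = 0" by (metis inner_eq_zero_iff inner_ge_zero order_antisym)
      then show ?thesis by (simp add: y_def)
    qed
    have "S (\<Sum>c\<in>C. t c *\<^sub>R c) = (\<Sum>c\<in>C. (t c * q c) *\<^sub>R c)" if "C \<subseteq> B" for C t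
      using finite_subset[OF that finB] that
    proof (induction C rule: finite_induct)
      case empty
      have "S (0 *\<^sub>R 0 + 0 *\<^sub>R 0) = 0 *\<^sub>R S 0 + 0 *\<^sub>R S 0" by (rule Slin) (use Esub subspace_0 in auto)
      then show ?case by simp
    next
      case (insert c C)
      have "S (t c *\<^sub>R c + 1 *\<^sub>R (\<Sum>c\<in>C. t c *\<^sub>R c)) = t c *\<^sub>R S c + 1 *\<^sub>R S (\<Sum>c\<in>C. t c *\<^sub>R c)"
        by (rule Slin) (use insert in \<open>auto simp: E_def intro!: span_base span_sum span_scale\<close>)
      then show ?case using insert Sc by simp
    qed
    from this[of B "\<lambda>c. x \<bullet> c"] have "S (D (\<lambda>_. 1) x) = D q x" by (simp add: D_def mult.commute)
    then show ?thesis using D1E[OF x] by simp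
  qed
  have "Q_mat \<real> P \<sigma> = Q"
    unfolding Q_mat_def Let_def EB E_def[symmetric] T_def[symmetric]
  proof (rule the_equality)
    have "Q *v v = D q (embed_adj E v)" if "v \<in> Fvec \<real>" for v
      using that by (simp add: Qv adj gen_defect)
    then show "Q \<in> Fmat \<real> \<and> (\<exists>S. is_pos_sqrt_on \<real> E T S \<and> (\<forall>v\<in>Fvec \<real>. Q *v v = S (embed_adj E v)))"
      using QF sq by blast
    fix Q' assume "Q' \<in> Fmat \<real> \<and> (\<exists>S. is_pos_sqrt_on \<real> E T S \<and> (\<forall>v\<in>Fvec \<real>. Q' *v v = S (embed_adj E v)))"
    then obtain S where S: "is_pos_sqrt_on \<real> E T S" "\<forall>v\<in>Fvec \<real>. Q' *v v = S (embed_adj E v)" by blast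
    show "Q' = Q"
      by (rule Fmat_Reals_eqI) (use S(2) uniq[OF S(1) DE] in \<open>simp add: Qv adj gen_defect\<close>)
  qed
  then show ?thesis using QF by simp
qed

section \<open>Linear Caratheodory equations\<close>

lemma LINT_Icc_continuous:
  fixes f :: "real \<Rightarrow> 'a::euclidean_space"
  assumes "integrable (lebesgue_on {a..b}) f"
  shows "continuous_on {a..b} (\<lambda>x. LINT \<tau>|lebesgue_on {a..x}. f \<tau>)"
proof -
  have "(LINT \<tau>|lebesgue_on {a..x}. f \<tau>) = integral {a..x} f" if "x \<in> {a..b}" for x
    by (rule lebesgue_integral_eq_integral) (use that assms integrable_subinterval[of a b f a x] in auto)
  moreover have "continuous_on {a..b} (\<lambda>x. integral {a..x} f)"
    by (intro indefinite_integral_continuous_1 integrable_on_lebesgue_on[OF assms]) auto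
  ultimately show ?thesis by (subst continuous_on_cong[OF refl])
qed

lemma AE_lebesgue_on_subset:
  assumes "AE x in lebesgue_on T. P x" "S \<subseteq> T" "S \<in> sets lebesgue" "T \<in> sets lebesgue"
  shows "AE x in lebesgue_on S. P x"
  using assms by (auto simp: AE_restrict_space_iff elim!: eventually_mono)

lemma continuous_measurable_Icc:
  fixes w :: "real \<Rightarrow> 'a::euclidean_space"
  shows "continuous_on {a..b} w \<Longrightarrow> w \<in> borel_measurable (lebesgue_on {a..b})"
  by (rule continuous_imp_measurable_on_sets_lebesgue) auto

lemma continuous_bounded_Icc:
  fixes w :: "real \<Rightarrow> 'a::real_normed_vector"
  assumes "continuous_on {a..b} w"
  obtains C where "C \<ge> 0" "\<And>x. x \<in> {a..b} \<Longrightarrow> norm (w x) \<le> C"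
proof -
  have "bounded (w ` {a..b})" by (intro compact_imp_bounded compact_continuous_image assms) auto
  then obtain C where "\<forall>x\<in>w ` {a..b}. norm x \<le> C" by (auto simp: bounded_iff)
  then show thesis using that[of "max C 0"] by force
qed

lemma LINT_exp:
  fixes L :: real
  assumes "L > 0" "a \<le> x"
  shows "integrable (lebesgue_on {a..x}) (\<lambda>\<tau>. exp (L * (\<tau> - a)))"
    and "(LINT \<tau>|lebesgue_on {a..x}. exp (L * (\<tau> - a))) = (exp (L * (x - a)) - 1) / L"
proof -
  have c: "continuous_on {a..x} (\<lambda>\<tau>. exp (L * (\<tau> - a)))" by (intro continuous_intros)
  have "(\<lambda>\<tau>. exp (L * (\<tau> - a))) absolutely_integrable_on {a..x}"
    by (rule absolutely_integrable_continuous_real[OF c])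
  then show i: "integrable (lebesgue_on {a..x}) (\<lambda>\<tau>. exp (L * (\<tau> - a)))"
    by (simp add: integrable_restrict_space set_integrable_def)
  have "((\<lambda>\<tau>. exp (L * (\<tau> - a))) has_integral (exp (L * (x - a)) / L - exp (L * (a - a)) / L)) {a..x}"
    by (rule fundamental_theorem_of_calculus[OF assms(2)])
      (use assms in \<open>auto simp flip: has_real_derivative_iff_has_vector_derivative intro!: derivative_eq_intros\<close>)
  then show "(LINT \<tau>|lebesgue_on {a..x}. exp (L * (\<tau> - a))) = (exp (L * (x - a)) - 1) / L"
    using lebesgue_integral_eq_integral[OF i] by (auto simp: integral_unique diff_divide_distrib)
qed

text \<open>Generic in the space of the unknown, since it serves both vector solutions and the
  matrix-valued fundamental solution. \<open>lip\<close> and \<open>zero\<close> together bound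
  \<open>G \<tau> (w \<tau>)\<close> by \<open>L\<close> times the supremum of \<open>w\<close>,
  whence integrability.\<close>

locale caratheodory =
  fixes a b L :: real and G :: "real \<Rightarrow> 'e::euclidean_space \<Rightarrow> 'e"
  assumes ab: "a \<le> b" and L: "L > 0"
    and meas: "continuous_on {a..b} w \<Longrightarrow> (\<lambda>\<tau>. G \<tau> (w \<tau>)) \<in> borel_measurable (lebesgue_on {a..b})"
    and lip: "AE \<tau> in lebesgue_on {a..b}. \<forall>x y. norm (G \<tau> x - G \<tau> y) \<le> L * norm (x - y)"
    and zero: "AE \<tau> in lebesgue_on {a..b}. G \<tau> 0 = 0"
begin

lemma int_G:
  assumes w: "continuous_on {a..b} w"
  shows "integrable (lebesgue_on {a..b}) (\<lambda>\<tau>. G \<tau> (w \<tau>))"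
proof -
  obtain C where C: "C \<ge> 0" "\<And>x. x \<in> {a..b} \<Longrightarrow> norm (w x) \<le> C" using continuous_bounded_Icc[OF w] by blast
  interpret finite_measure "lebesgue_on {a..b}" by (rule finite_measure_lebesgue_on) auto
  have "AE \<tau> in lebesgue_on {a..b}. \<tau> \<in> {a..b}" using AE_space[of "lebesgue_on {a..b}"] by simp
  with lip zero have "AE \<tau> in lebesgue_on {a..b}. norm (G \<tau> (w \<tau>)) \<le> L * C"
  proof eventually_elim
    case (elim \<tau>)
    have "norm (G \<tau> (w \<tau>) - G \<tau> 0) \<le> L * norm (w \<tau> - 0)" using elim by blast
    also have "\<dots> \<le> L * C" using C elim L by simp
    finally show ?case using elim by simp
  qed
  then show ?thesis by (intro integrable_const_bound[of _ "L * C"] meas w) auto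
qed

lemma int_G_sub:
  "continuous_on {a..b} w \<Longrightarrow> \<zeta> \<in> {a..b} \<Longrightarrow> integrable (lebesgue_on {a..\<zeta>}) (\<lambda>\<tau>. G \<tau> (w \<tau>))"
  using integrable_subinterval[OF int_G, of w a \<zeta>] by auto

abbreviation I where "I w \<zeta> \<equiv> (LINT \<tau>|lebesgue_on {a..\<zeta>}. G \<tau> (w \<tau>))"

text \<open>In the norm weighted by \<open>exp (- 2 * L * (\<zeta> - a))\<close> the integral operator is a contraction.\<close>

lemma I_contraction:
  assumes u: "continuous_on {a..b} u" and v: "continuous_on {a..b} v"
    and m: "\<And>\<tau>. \<tau> \<in> {a..b} \<Longrightarrow> norm (u \<tau> - v \<tau>) \<le> m * exp (2 * L * (\<tau> - a))"
    and \<zeta>: "\<zeta> \<in> {a..b}"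
  shows "norm (I u \<zeta> - I v \<zeta>) \<le> m / 2 * exp (2 * L * (\<zeta> - a))"
proof -
  have m0: "m \<ge> 0"
  proof -
    have "0 \<le> m * exp (2 * L * (a - a))" by (rule order_trans[OF norm_ge_zero m]) (use ab in auto)
    then show ?thesis by simp
  qed
  have sub: "{a..\<zeta>} \<subseteq> {a..b}" using \<zeta> by auto
  have sp: "AE \<tau> in lebesgue_on {a..\<zeta>}. \<tau> \<in> {a..\<zeta>}" using AE_space[of "lebesgue_on {a..\<zeta>}"] by simp
  have lip': "AE \<tau> in lebesgue_on {a..\<zeta>}. \<forall>x y. norm (G \<tau> x - G \<tau> y) \<le> L * norm (x - y)"
    by (rule AE_lebesgue_on_subset[OF lip sub]) auto
  note iu = int_G_sub[OF u \<zeta>] and iv = int_G_sub[OF v \<zeta>]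
  have "I u \<zeta> - I v \<zeta> = (LINT \<tau>|lebesgue_on {a..\<zeta>}. G \<tau> (u \<tau>) - G \<tau> (v \<tau>))"
    by (rule Bochner_Integration.integral_diff[symmetric, OF iu iv])
  also have "norm \<dots> \<le> (LINT \<tau>|lebesgue_on {a..\<zeta>}. norm (G \<tau> (u \<tau>) - G \<tau> (v \<tau>)))"
    by (rule integral_norm_bound)
  also have "\<dots> \<le> (LINT \<tau>|lebesgue_on {a..\<zeta>}. (L * m) * exp (2 * L * (\<tau> - a)))"
  proof (rule integral_mono_AE)
    show "integrable (lebesgue_on {a..\<zeta>}) (\<lambda>\<tau>. norm (G \<tau> (u \<tau>) - G \<tau> (v \<tau>)))" using iu iv by auto
    show "integrable (lebesgue_on {a..\<zeta>}) (\<lambda>\<tau>. (L * m) * exp (2 * L * (\<tau> - a)))"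
      by (rule integrable_mult_right) (use LINT_exp(1)[of "2*L" a \<zeta>] L \<zeta> in auto)
    from lip' sp show "AE \<tau> in lebesgue_on {a..\<zeta>}. norm (G \<tau> (u \<tau>) - G \<tau> (v \<tau>)) \<le> (L * m) * exp (2 * L * (\<tau> - a))"
    proof eventually_elim
      case (elim \<tau>)
      have "norm (G \<tau> (u \<tau>) - G \<tau> (v \<tau>)) \<le> L * norm (u \<tau> - v \<tau>)" using elim by blast
      also have "\<dots> \<le> L * (m * exp (2 * L * (\<tau> - a)))" using m[of \<tau>] elim \<zeta> L by simp
      finally show ?case by simp
    qed
  qed
  also have "\<dots> = (L * m) * ((exp (2 * L * (\<zeta> - a)) - 1) / (2 * L))"
    using LINT_exp(2)[of "2*L" a \<zeta>] L \<zeta> by simp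
  also have "\<dots> = m / 2 * (exp (2 * L * (\<zeta> - a)) - 1)" using L by simp
  also have "\<dots> \<le> m / 2 * exp (2 * L * (\<zeta> - a))" using m0 by (simp add: mult_left_mono)
  finally show ?thesis .
qed

text \<open>A Gronwall estimate: at the maximum \<open>m\<close> of the weighted difference the
  contraction gives \<open>m \<le> P + m / 2\<close>, so \<open>m \<le> 2 * P\<close>; the
  exponential undoes the weight. With \<open>P = 0\<close> this is uniqueness, and compared with the
  zero solution it bounds solutions by their forcing term.\<close>

lemma solution_stable:
  assumes u: "continuous_on {a..b} u" "\<And>\<zeta>. \<zeta> \<in> {a..b} \<Longrightarrow> u \<zeta> = p \<zeta> + I u \<zeta>"
    and v: "continuous_on {a..b} v" "\<And>\<zeta>. \<zeta> \<in> {a..b} \<Longrightarrow> v \<zeta> = q \<zeta> + I v \<zeta>"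
    and P: "\<And>\<zeta>. \<zeta> \<in> {a..b} \<Longrightarrow> norm (p \<zeta> - q \<zeta>) \<le> P"
    and \<zeta>: "\<zeta> \<in> {a..b}"
  shows "norm (u \<zeta> - v \<zeta>) \<le> 2 * P * exp (2 * L * (b - a))"
proof -
  define g where "g \<tau> = exp (- (2 * L * (\<tau> - a))) * norm (u \<tau> - v \<tau>)" for \<tau>
  have "continuous_on {a..b} g" unfolding g_def by (intro continuous_intros u v)
  then obtain t where t: "t \<in> {a..b}" "\<And>\<tau>. \<tau> \<in> {a..b} \<Longrightarrow> g \<tau> \<le> g t"
    using continuous_attains_sup[of "{a..b}" g] ab by auto
  define m where "m = g t"
  have le: "norm (u \<tau> - v \<tau>) \<le> m * exp (2 * L * (\<tau> - a))" if "\<tau> \<in> {a..b}" for \<tau>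
  proof -
    have "norm (u \<tau> - v \<tau>) = g \<tau> * exp (2 * L * (\<tau> - a))"
      by (simp add: g_def mult.assoc mult.left_commute flip: exp_add)
    also have "\<dots> \<le> m * exp (2 * L * (\<tau> - a))" unfolding m_def by (rule mult_right_mono[OF t(2)[OF that]]) simp
    finally show ?thesis .
  qed
  have P0: "P \<ge> 0" using P[OF \<zeta>] norm_ge_zero order_trans by blast
  have "norm (u t - v t) = norm ((p t - q t) + (I u t - I v t))"
    using u(2)[OF t(1)] v(2)[OF t(1)] by (simp add: algebra_simps)
  also have "\<dots> \<le> P + m / 2 * exp (2 * L * (t - a))"
    using norm_triangle_ineq P[OF t(1)] I_contraction[OF u(1) v(1) le t(1)] add_mono order_trans by meson
  finally have "g t \<le> exp (- (2 * L * (t - a))) * (P + m / 2 * exp (2 * L * (t - a)))"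
    by (simp add: g_def)
  also have "\<dots> = exp (- (2 * L * (t - a))) * P + m / 2 * (exp (- (2 * L * (t - a))) * exp (2 * L * (t - a)))"
    by (simp only: distrib_left mult_ac)
  also have "exp (- (2 * L * (t - a))) * exp (2 * L * (t - a)) = 1" by (simp flip: exp_add)
  also have "exp (- (2 * L * (t - a))) * P \<le> 1 * P"
    by (rule mult_right_mono) (use t L P0 in auto)
  finally have "m \<le> 2 * P" by (simp flip: m_def)
  moreover have "exp (2 * L * (\<zeta> - a)) \<le> exp (2 * L * (b - a))" using \<zeta> L by simp
  moreover have "m \<ge> 0" by (simp add: m_def g_def)
  ultimately have "m * exp (2 * L * (\<zeta> - a)) \<le> 2 * P * exp (2 * L * (b - a))"
    using P0 by (intro mult_mono) auto
  then show ?thesis using le[OF \<zeta>] by linarith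
qed

lemma solution_unique:
  assumes "continuous_on {a..b} u" "\<And>\<zeta>. \<zeta> \<in> {a..b} \<Longrightarrow> u \<zeta> = p \<zeta> + I u \<zeta>"
    and "continuous_on {a..b} v" "\<And>\<zeta>. \<zeta> \<in> {a..b} \<Longrightarrow> v \<zeta> = p \<zeta> + I v \<zeta>"
    and "\<zeta> \<in> {a..b}"
  shows "u \<zeta> = v \<zeta>"
  using solution_stable[OF assms(1,2,3,4), of 0 \<zeta>] assms(5) by simp

text \<open>Picard iteration started at the forcing term. Consecutive iterates differ by a geometric
  sequence in the weighted norm, so the telescoping series converges uniformly.\<close>

lemma solution_exists:
  assumes p: "continuous_on {a..b} p"
  obtains w where "continuous_on {a..b} w" "\<And>\<zeta>. \<zeta> \<in> {a..b} \<Longrightarrow> w \<zeta> = p \<zeta> + I w \<zeta>"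
proof -
  define \<phi> where "\<phi> = rec_nat p (\<lambda>_ u \<zeta>. p \<zeta> + I u \<zeta>)"
  have \<phi>0: "\<phi> 0 = p" and \<phi>S: "\<phi> (Suc k) \<zeta> = p \<zeta> + I (\<phi> k) \<zeta>" for k \<zeta> by (simp_all add: \<phi>_def)
  have c\<phi>: "continuous_on {a..b} (\<phi> k)" for k
  proof (induction k)
    case (Suc k)
    have "\<phi> (Suc k) = (\<lambda>\<zeta>. p \<zeta> + I (\<phi> k) \<zeta>)" by (simp add: \<phi>S fun_eq_iff)
    then show ?case using LINT_Icc_continuous[OF int_G[OF Suc]] p by (simp add: continuous_on_add)
  qed (simp add: \<phi>0 p)
  let ?e = "\<lambda>\<zeta>. exp (2 * L * (\<zeta> - a))" and ?E = "exp (2 * L * (b - a))"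
  have e1: "1 \<le> ?e \<zeta>" and eE: "?e \<zeta> \<le> ?E" if "\<zeta> \<in> {a..b}" for \<zeta> using that L by auto
  have "continuous_on {a..b} (\<lambda>\<zeta>. \<phi> 1 \<zeta> - \<phi> 0 \<zeta>)" by (intro continuous_on_diff c\<phi>)
  then obtain m where m0: "m \<ge> 0" and m: "\<And>\<zeta>. \<zeta> \<in> {a..b} \<Longrightarrow> norm (\<phi> 1 \<zeta> - \<phi> 0 \<zeta>) \<le> m"
    using continuous_bounded_Icc by blast
  have step: "\<forall>\<zeta>\<in>{a..b}. norm (\<phi> (Suc k) \<zeta> - \<phi> k \<zeta>) \<le> m * (1/2) ^ k * ?e \<zeta>" for k
  proof (induction k)
    case 0
    show ?case
    proof
      fix \<zeta> assume z: "\<zeta> \<in> {a..b}"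
      have "m * 1 \<le> m * ?e \<zeta>" using e1[OF z] m0 by (rule mult_left_mono)
      then show "norm (\<phi> (Suc 0) \<zeta> - \<phi> 0 \<zeta>) \<le> m * (1/2) ^ 0 * ?e \<zeta>" using m[OF z] by simp
    qed
  next
    case (Suc k)
    show ?case
    proof
      fix \<zeta> assume z: "\<zeta> \<in> {a..b}"
      have "norm (I (\<phi> (Suc k)) \<zeta> - I (\<phi> k) \<zeta>) \<le> (m * (1/2) ^ k) / 2 * ?e \<zeta>"
        by (rule I_contraction[OF c\<phi> c\<phi> _ z]) (use Suc in auto)
      then show "norm (\<phi> (Suc (Suc k)) \<zeta> - \<phi> (Suc k) \<zeta>) \<le> m * (1/2) ^ Suc k * ?e \<zeta>"
        by (simp add: \<phi>S)
    qed
  qed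
  let ?f = "\<lambda>k \<zeta>. \<phi> (Suc k) \<zeta> - \<phi> k \<zeta>"
  have sm: "summable (\<lambda>k. m * ?E * (1/2) ^ k)" by (intro summable_mult summable_geometric) auto
  have bd: "norm (?f k \<zeta>) \<le> m * ?E * (1/2) ^ k" if "\<zeta> \<in> {a..b}" for k \<zeta>
  proof -
    have "m * (1/2)^k * ?e \<zeta> \<le> m * (1/2)^k * ?E" using eE[OF that] m0 by (intro mult_left_mono) auto
    then show ?thesis using step[of k] that by (force simp: mult_ac)
  qed
  have ul: "uniform_limit {a..b} (\<lambda>n \<zeta>. \<Sum>k<n. ?f k \<zeta>) (\<lambda>\<zeta>. \<Sum>k. ?f k \<zeta>) sequentially"
    by (rule Weierstrass_m_test[OF bd sm])
  define w where "w \<zeta> = \<phi> 0 \<zeta> + (\<Sum>k. ?f k \<zeta>)" for \<zeta>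
  have tel: "(\<Sum>k<n. ?f k \<zeta>) = \<phi> n \<zeta> - \<phi> 0 \<zeta>" for n \<zeta> by (rule sum_lessThan_telescope)
  have "uniform_limit {a..b} (\<lambda>n \<zeta>. \<phi> 0 \<zeta> + (\<Sum>k<n. ?f k \<zeta>)) w sequentially"
    unfolding w_def by (intro uniform_limit_intros ul)
  then have ul': "uniform_limit {a..b} \<phi> w sequentially" by (simp add: tel)
  have cw: "continuous_on {a..b} w"
    by (rule uniform_limit_theorem[OF _ ul']) (auto simp: c\<phi>)
  show thesis
  proof (rule that[OF cw])
    fix \<zeta> assume z: "\<zeta> \<in> {a..b}"
    have "norm (w \<zeta> - (p \<zeta> + I w \<zeta>)) \<le> 0"
    proof (rule field_le_epsilon)
      fix e :: real assume e: "e > 0"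
      \<comment> \<open>Both error terms below are at most \<open>d * ?E\<close>, so they add up to
        \<open>e\<close>. As the weight \<open>?e\<close> is at least 1, unweighted closeness
        \<open>d\<close> may be fed to the contraction.\<close>
      define d where "d = e / (2 * ?E)"
      have d: "d > 0" using e by (simp add: d_def)
      have E1: "?E \<ge> 1" using ab L by simp
      obtain N where N: "\<And>n x. n \<ge> N \<Longrightarrow> x \<in> {a..b} \<Longrightarrow> dist (\<phi> n x) (w x) < d"
        using ul' d unfolding uniform_limit_sequentially_iff by meson
      have 1: "norm (w \<zeta> - \<phi> (Suc N) \<zeta>) \<le> d" using N[of "Suc N" \<zeta>] z by (simp add: dist_norm norm_minus_commute)
      have 2: "norm (I (\<phi> N) \<zeta> - I w \<zeta>) \<le> d / 2 * ?e \<zeta>"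
      proof (rule I_contraction[OF c\<phi> cw _ z])
        fix x assume x: "x \<in> {a..b}"
        have "d * 1 \<le> d * ?e x" using e1[OF x] d by (intro mult_left_mono) auto
        then show "norm (\<phi> N x - w x) \<le> d * ?e x" using N[of N x] x by (simp add: dist_norm)
      qed
      have "norm (w \<zeta> - (p \<zeta> + I w \<zeta>)) = norm ((w \<zeta> - \<phi> (Suc N) \<zeta>) + (I (\<phi> N) \<zeta> - I w \<zeta>))"
        by (simp add: \<phi>S algebra_simps)
      also have "\<dots> \<le> d + d / 2 * ?e \<zeta>" using 1 2 norm_triangle_ineq add_mono order_trans by meson
      also have "\<dots> \<le> d * ?E + d * ?E"
      proof (rule add_mono)
        show "d \<le> d * ?E" using E1 d by simp
        show "d / 2 * ?e \<zeta> \<le> d * ?E" using eE[OF z] d by (intro mult_mono) auto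
      qed
      also have "\<dots> = e" by (simp add: d_def)
      finally show "norm (w \<zeta> - (p \<zeta> + I w \<zeta>)) \<le> 0 + e" by simp
    qed
    then show "w \<zeta> = p \<zeta> + I w \<zeta>" by simp
  qed
qed

end

section \<open>The state space\<close>

lemma matrix_inv_cancel:
  assumes "invertible A"
  shows "A ** matrix_inv A = mat 1" "matrix_inv A ** A = mat 1"
  using someI_ex[OF assms[unfolded invertible_def]] by (auto simp: matrix_inv_def)

lemma matrix_inv_mv_cancel:
  assumes "invertible (A::complex^'n^'n)"
  shows "A *v (matrix_inv A *v x) = x" "matrix_inv A *v (A *v x) = x"
  using matrix_inv_cancel[OF assms] by (simp_all add: matrix_vector_mul_assoc)

lemma borel_measurable_vecI:
  fixes f :: "'a \<Rightarrow> 'b::euclidean_space^'n"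
  assumes "\<And>i. (\<lambda>x. f x $ i) \<in> borel_measurable M"
  shows "f \<in> borel_measurable M"
  using assms by (subst borel_measurable_euclidean_space) (auto simp: Basis_vec_def inner_axis)

lemma borel_measurable_vec_nth:
  fixes f :: "'a \<Rightarrow> 'b::euclidean_space^'n"
  assumes "f \<in> borel_measurable M"
  shows "(\<lambda>x. f x $ i) \<in> borel_measurable M"
  by (rule borel_measurable_continuous_on[OF _ assms])
    (intro linear_continuous_on bounded_linear_vec_nth)

lemma borel_measurable_det:
  fixes A :: "'a \<Rightarrow> complex^'n^'n"
  assumes "A \<in> borel_measurable M"
  shows "(\<lambda>x. det (A x)) \<in> borel_measurable M"
proof -
  have [measurable]: "(\<lambda>x. A x $ i $ j) \<in> borel_measurable M" for i j
    using assms by (intro borel_measurable_vec_nth)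
  show ?thesis unfolding det_def by measurable
qed

text \<open>Cramer's rule writes each entry as a quotient of determinants, which are polynomials in
  the entries.\<close>

lemma borel_measurable_matrix_inv:
  fixes A :: "'a \<Rightarrow> complex^'n^'n"
  assumes A: "A \<in> borel_measurable M"
  shows "(\<lambda>x. matrix_inv (A x)) \<in> borel_measurable M"
proof -
  let ?R = "\<lambda>A::complex^'n^'n. \<lambda>l k. \<chi> i j. if j = k then axis l 1 $ i else A $ i $ j"
  have [measurable]: "(\<lambda>x. A x $ i $ j) \<in> borel_measurable M" for i j
    using assms by (intro borel_measurable_vec_nth)
  have [measurable]: "(\<lambda>x. det (A x)) \<in> borel_measurable M" by (rule borel_measurable_det[OF A])
  have [measurable]: "(\<lambda>x. det (?R (A x) l k)) \<in> borel_measurable M" for l k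
    by (intro borel_measurable_det borel_measurable_vecI) (auto simp: axis_def)
  \<comment> \<open>On singular matrices the choice in \<open>matrix_inv\<close> ranges over an
    unsatisfiable predicate and hence gives one fixed default matrix.\<close>
  have eq: "matrix_inv B $ k $ l = (if det B = 0 then (SOME x::complex^'n^'n. False) $ k $ l else det (?R B l k) / det B)"
    for B :: "complex^'n^'n" and k l
  proof (cases "det B = 0")
    case True
    then have "(\<lambda>A'. B ** A' = mat 1 \<and> A' ** B = mat 1) = (\<lambda>x. False)"
      using invertible_det_nz[of B] by (auto simp: invertible_def)
    then show ?thesis using True by (simp add: matrix_inv_def)
  next
    case False
    then have "B *v (matrix_inv B *v axis l 1) = axis l 1"
      by (intro matrix_inv_mv_cancel) (simp add: invertible_det_nz)
    then have "matrix_inv B *v axis l 1 = (\<chi> k. det (?R B l k) / det B)"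
      using cramer[OF False] by blast
    moreover have "(matrix_inv B *v axis l 1) $ k = matrix_inv B $ k $ l"
      by (simp add: matrix_vector_mult_def axis_def if_distrib cong: if_cong)
    ultimately show ?thesis using False by simp
  qed
  have "(\<lambda>x. matrix_inv (A x) $ k $ l) \<in> borel_measurable M" for k l
    unfolding eq by measurable
  then show ?thesis by (intro borel_measurable_vecI)
qed

lemma borel_measurable_mv:
  fixes A :: "'a \<Rightarrow> complex^'n^'m"
  assumes "A \<in> borel_measurable M" "f \<in> borel_measurable M"
  shows "(\<lambda>x. A x *v f x) \<in> borel_measurable M"
  by (rule borel_measurable_continuous_Pair[OF assms])
    (intro bounded_bilinear.continuous_on[OF bounded_bilinear_mv] continuous_intros)

lemma borel_measurable_mm:
  fixes A :: "'a \<Rightarrow> complex^'n^'m" and B :: "'a \<Rightarrow> complex^'k^'n"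
  assumes "A \<in> borel_measurable M" "B \<in> borel_measurable M"
  shows "(\<lambda>x. A x ** B x) \<in> borel_measurable M"
  by (rule borel_measurable_continuous_Pair[OF assms])
    (intro bounded_bilinear.continuous_on[OF bounded_bilinear_mm] continuous_intros)

lemma norm_smult: "norm (c *s (v::complex^'n)) = cmod c * norm v"
  by (simp add: norm_vec_def L2_set_def norm_mult power_mult_distrib real_sqrt_mult flip: sum_distrib_left)

lemma bounded_linear_smult: "bounded_linear (\<lambda>v::complex^'n. c *s v)"
  by (intro bounded_linear_intro[where K="cmod c"])
    (auto simp: vec_eq_iff algebra_simps norm_smult)

lemma bounded_bilinear_cinner: "bounded_bilinear cinner"
  unfolding bilinear_conv_bounded_bilinear[symmetric] bilinear_def
  by (auto intro!: linearI simp: cinner_def algebra_simps sum.distrib scaleR_sum_right)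

lemma borel_measurable_smult:
  fixes f :: "'a \<Rightarrow> complex^'n"
  assumes "f \<in> borel_measurable M" shows "(\<lambda>x. c *s f x) \<in> borel_measurable M"
  by (rule borel_measurable_continuous_on[OF _ assms]) (intro linear_continuous_on bounded_linear_smult)

text \<open>Rests on completeness of Lebesgue measure; extension by zero moves the question from the
  interval to the line.\<close>

lemma borel_measurable_lebesgue_on_AE:
  fixes f g :: "real \<Rightarrow> 'b::euclidean_space"
  assumes f: "f \<in> borel_measurable (lebesgue_on {a..b})" and ae: "AE x in lebesgue_on {a..b}. f x = g x"
  shows "g \<in> borel_measurable (lebesgue_on {a..b})"
proof -
  have "AE x in lebesgue. x \<in> {a..b} \<longrightarrow> f x = g x" using ae by (subst (asm) AE_restrict_space_iff) auto
  then have "AE x in lebesgue. (if x \<in> {a..b} then f x else 0) = (if x \<in> {a..b} then g x else 0)"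
    by eventually_elim auto
  with borel_measurable_if_I[OF f] have "(\<lambda>x. if x \<in> {a..b} then g x else 0) \<in> borel_measurable lebesgue"
    using borel_measurable_AE by fastforce
  then show ?thesis by (rule borel_measurable_if_D)
qed

section \<open>Closure properties of the square-integrable functions\<close>

lemma L2_UNIV_iff: "f \<in> L2 UNIV a b \<longleftrightarrow> f \<in> borel_measurable (lebesgue_on {a..b}) \<and>
                  integrable (lebesgue_on {a..b}) (\<lambda>\<xi>. (norm (f \<xi>))\<^sup>2)"
  by (simp add: L2_def)

lemma L2_dominated:
  assumes f: "f \<in> L2 UNIV a b" and g: "g \<in> borel_measurable (lebesgue_on {a..b})"
    and le: "AE \<xi> in lebesgue_on {a..b}. norm (g \<xi>) \<le> C * norm (f \<xi>)"
  shows "g \<in> L2 UNIV a b"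
proof -
  have "integrable (lebesgue_on {a..b}) (\<lambda>\<xi>. (norm (g \<xi>))\<^sup>2)"
  proof (rule Bochner_Integration.integrable_bound[where f="\<lambda>\<xi>. C\<^sup>2 * (norm (f \<xi>))\<^sup>2"])
    show "integrable (lebesgue_on {a..b}) (\<lambda>\<xi>. C\<^sup>2 * (norm (f \<xi>))\<^sup>2)" using f by (auto simp: L2_UNIV_iff)
    show "(\<lambda>\<xi>. (norm (g \<xi>))\<^sup>2) \<in> borel_measurable (lebesgue_on {a..b})" using g by measurable
    from le show "AE \<xi> in lebesgue_on {a..b}. norm ((norm (g \<xi>))\<^sup>2) \<le> norm (C\<^sup>2 * (norm (f \<xi>))\<^sup>2)"
    proof eventually_elim
      case (elim \<xi>)
      then have "(norm (g \<xi>))\<^sup>2 \<le> (C * norm (f \<xi>))\<^sup>2" by (intro power_mono) auto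
      then show ?case by (simp add: power_mult_distrib abs_mult)
    qed
  qed
  then show ?thesis using g by (simp add: L2_UNIV_iff)
qed

lemma L2_add:
  assumes f: "f \<in> L2 UNIV a b" and g: "g \<in> L2 UNIV a b"
  shows "(\<lambda>\<xi>. f \<xi> + g \<xi>) \<in> L2 UNIV a b"
proof -
  have m: "f \<in> borel_measurable (lebesgue_on {a..b})" "g \<in> borel_measurable (lebesgue_on {a..b})"
    using f g by (auto simp: L2_UNIV_iff)
  have "integrable (lebesgue_on {a..b}) (\<lambda>\<xi>. (norm (f \<xi> + g \<xi>))\<^sup>2)"
  proof (rule Bochner_Integration.integrable_bound[where f="\<lambda>\<xi>. 2 * (norm (f \<xi>))\<^sup>2 + 2 * (norm (g \<xi>))\<^sup>2"])
    show "integrable (lebesgue_on {a..b}) (\<lambda>\<xi>. 2 * (norm (f \<xi>))\<^sup>2 + 2 * (norm (g \<xi>))\<^sup>2)" using f g by (auto simp: L2_UNIV_iff)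
    show "(\<lambda>\<xi>. (norm (f \<xi> + g \<xi>))\<^sup>2) \<in> borel_measurable (lebesgue_on {a..b})" using m by measurable
    have "(norm (f \<xi> + g \<xi>))\<^sup>2 \<le> 2 * (norm (f \<xi>))\<^sup>2 + 2 * (norm (g \<xi>))\<^sup>2" for \<xi>
    proof -
      have "(norm (f \<xi> + g \<xi>))\<^sup>2 \<le> (norm (f \<xi>) + norm (g \<xi>))\<^sup>2" by (intro power_mono norm_triangle_ineq) auto
      moreover have "0 \<le> (norm (f \<xi>) - norm (g \<xi>))\<^sup>2" by simp
      ultimately show ?thesis unfolding power2_sum power2_diff by linarith
    qed
    then show "AE \<xi> in lebesgue_on {a..b}. norm ((norm (f \<xi> + g \<xi>))\<^sup>2) \<le> norm (2 * (norm (f \<xi>))\<^sup>2 + 2 * (norm (g \<xi>))\<^sup>2)"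
      by (intro AE_I2) (simp add: abs_of_nonneg)
  qed
  then show ?thesis using m by (simp add: L2_UNIV_iff)
qed

lemma L2_smult:
  assumes "f \<in> L2 UNIV a b" shows "(\<lambda>\<xi>. c *s f \<xi>) \<in> L2 UNIV a b"
  by (rule L2_dominated[OF assms, where C="cmod c"])
    (use assms in \<open>auto simp: L2_UNIV_iff norm_smult intro: borel_measurable_smult\<close>)

lemma L2_scaleR:
  assumes "f \<in> L2 UNIV a b" shows "(\<lambda>\<xi>. r *\<^sub>R f \<xi>) \<in> L2 UNIV a b"
  using L2_smult[OF assms, of "complex_of_real r"] by (simp add: complex_scaleR_eq)

lemma L2_diff:
  assumes "f \<in> L2 UNIV a b" "g \<in> L2 UNIV a b" shows "(\<lambda>\<xi>. f \<xi> - g \<xi>) \<in> L2 UNIV a b"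
  using L2_add[OF assms(1) L2_scaleR[OF assms(2), of "-1"]] by simp

lemma L2_zero: "(\<lambda>\<xi>. 0) \<in> L2 UNIV a b"
  by (simp add: L2_UNIV_iff)

lemma L2_AE_cong:
  assumes f: "f \<in> L2 UNIV a b" and ae: "AE \<xi> in lebesgue_on {a..b}. f \<xi> = g \<xi>"
  shows "g \<in> L2 UNIV a b"
proof (rule L2_dominated[OF f, where C=1])
  show "g \<in> borel_measurable (lebesgue_on {a..b})"
    using f ae by (auto simp: L2_UNIV_iff intro: borel_measurable_lebesgue_on_AE)
  show "AE \<xi> in lebesgue_on {a..b}. norm (g \<xi>) \<le> 1 * norm (f \<xi>)" using ae by eventually_elim simp
qed

lemma L2_continuous:
  assumes w: "continuous_on {a..b} w" shows "w \<in> L2 UNIV a b"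
proof -
  obtain C where C: "C \<ge> 0" "\<And>x. x \<in> {a..b} \<Longrightarrow> norm (w x) \<le> C" using continuous_bounded_Icc[OF w] by blast
  interpret finite_measure "lebesgue_on {a..b}" by (rule finite_measure_lebesgue_on) auto
  have m: "w \<in> borel_measurable (lebesgue_on {a..b})" by (rule continuous_measurable_Icc[OF w])
  have "AE \<xi> in lebesgue_on {a..b}. norm ((norm (w \<xi>))\<^sup>2) \<le> C\<^sup>2"
    by (rule AE_I2) (use C in \<open>auto intro!: power_mono\<close>)
  then have "integrable (lebesgue_on {a..b}) (\<lambda>\<xi>. (norm (w \<xi>))\<^sup>2)"
    by (rule integrable_const_bound) (use m in measurable)
  then show ?thesis using m by (simp add: L2_UNIV_iff)
qed

lemma L2_integrable:
  assumes f: "f \<in> L2 UNIV a b"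
  shows "integrable (lebesgue_on {a..b}) f"
proof (rule Bochner_Integration.integrable_bound[where f="\<lambda>\<xi>. 1 + (norm (f \<xi>))\<^sup>2"])
  interpret finite_measure "lebesgue_on {a..b}" by (rule finite_measure_lebesgue_on) auto
  show "integrable (lebesgue_on {a..b}) (\<lambda>\<xi>. 1 + (norm (f \<xi>))\<^sup>2)" using f by (auto simp: L2_UNIV_iff)
  have "norm (f \<xi>) \<le> 1 + (norm (f \<xi>))\<^sup>2" for \<xi>
  proof -
    have "0 \<le> (norm (f \<xi>))\<^sup>2 - 2 * norm (f \<xi>) + 1"
      using zero_le_power2[of "norm (f \<xi>) - 1"] unfolding power2_diff by simp
    then show ?thesis using norm_ge_zero[of "f \<xi>"] by linarith
  qed
  then show "AE \<xi> in lebesgue_on {a..b}. norm (f \<xi>) \<le> norm (1 + (norm (f \<xi>))\<^sup>2)"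
    by (intro AE_I2) (simp add: abs_of_nonneg)
qed (use f in \<open>simp add: L2_UNIV_iff\<close>)

lemma L2_cinner_integrable:
  assumes f: "f \<in> L2 UNIV a b" and g: "g \<in> L2 UNIV a b"
  shows "integrable (lebesgue_on {a..b}) (\<lambda>\<xi>. cinner (f \<xi>) (g \<xi>))"
proof -
  obtain K where K: "\<And>x y::complex^'a. norm (cinner x y) \<le> norm x * norm y * K" "K > 0"
    using bounded_bilinear.pos_bounded[OF bounded_bilinear_cinner] by blast
  have m: "f \<in> borel_measurable (lebesgue_on {a..b})" "g \<in> borel_measurable (lebesgue_on {a..b})"
    using f g by (auto simp: L2_UNIV_iff)
  show ?thesis
  proof (rule Bochner_Integration.integrable_bound[where f="\<lambda>\<xi>. K * ((norm (f \<xi>))\<^sup>2 + (norm (g \<xi>))\<^sup>2)"])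
    show "integrable (lebesgue_on {a..b}) (\<lambda>\<xi>. K * ((norm (f \<xi>))\<^sup>2 + (norm (g \<xi>))\<^sup>2))" using f g by (auto simp: L2_UNIV_iff)
    show "(\<lambda>\<xi>. cinner (f \<xi>) (g \<xi>)) \<in> borel_measurable (lebesgue_on {a..b})"
      by (rule borel_measurable_continuous_Pair[OF m])
        (intro bounded_bilinear.continuous_on[OF bounded_bilinear_cinner] continuous_intros)
    have "norm (cinner (f \<xi>) (g \<xi>)) \<le> K * ((norm (f \<xi>))\<^sup>2 + (norm (g \<xi>))\<^sup>2)" for \<xi>
    proof -
      have "norm (f \<xi>) * norm (g \<xi>) \<le> (norm (f \<xi>))\<^sup>2 + (norm (g \<xi>))\<^sup>2"
      proof -
        have "0 \<le> (norm (f \<xi>))\<^sup>2 - 2 * (norm (f \<xi>) * norm (g \<xi>)) + (norm (g \<xi>))\<^sup>2"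
          using zero_le_power2[of "norm (f \<xi>) - norm (g \<xi>)"] unfolding power2_diff by (simp add: mult.assoc)
        moreover have "0 \<le> norm (f \<xi>) * norm (g \<xi>)" by simp
        ultimately show ?thesis by linarith
      qed
      then have "K * (norm (f \<xi>) * norm (g \<xi>)) \<le> K * ((norm (f \<xi>))\<^sup>2 + (norm (g \<xi>))\<^sup>2)"
        using K(2) by simp
      then show ?thesis using K(1)[of "f \<xi>" "g \<xi>"] by (simp add: mult.commute)
    qed
    then show "AE \<xi> in lebesgue_on {a..b}. norm (cinner (f \<xi>) (g \<xi>)) \<le> norm (K * ((norm (f \<xi>))\<^sup>2 + (norm (g \<xi>))\<^sup>2))"
      using K(2) by (intro AE_I2) (simp add: abs_of_nonneg)
  qed
qed

text \<open>Integrates \<open>x \<le> e + x\<^sup>2 / e\<close>. The choice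
  \<open>e = sqrt G\<close> gives the factor \<open>b - a + 1\<close>; if \<open>G = 0\<close>,
  arbitrarily small \<open>e\<close> force the left side to vanish.\<close>

lemma L2_L1_bound:
  assumes ab: "a \<le> b" and f: "f \<in> L2 UNIV a b"
  shows "(LINT \<xi>|lebesgue_on {a..b}. norm (f \<xi>)) \<le> (b - a + 1) * sqrt (LINT \<xi>|lebesgue_on {a..b}. (norm (f \<xi>))\<^sup>2)"
proof -
  interpret finite_measure "lebesgue_on {a..b}" by (rule finite_measure_lebesgue_on) auto
  define G where "G = (LINT \<xi>|lebesgue_on {a..b}. (norm (f \<xi>))\<^sup>2)"
  define I where "I = (LINT \<xi>|lebesgue_on {a..b}. norm (f \<xi>))"
  have fi: "integrable (lebesgue_on {a..b}) (\<lambda>\<xi>. (norm (f \<xi>))\<^sup>2)" using f by (simp add: L2_UNIV_iff)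
  have G0: "G \<ge> 0" unfolding G_def by (rule integral_nonneg_AE) auto
  have le: "I \<le> (b - a) * e + G / e" if e: "e > 0" for e
  proof -
    have "I \<le> (LINT \<xi>|lebesgue_on {a..b}. e + (norm (f \<xi>))\<^sup>2 / e)" unfolding I_def
    proof (rule integral_mono_AE)
      show "integrable (lebesgue_on {a..b}) (\<lambda>\<xi>. norm (f \<xi>))" using L2_integrable[OF f] by simp
      show "integrable (lebesgue_on {a..b}) (\<lambda>\<xi>. e + (norm (f \<xi>))\<^sup>2 / e)" using fi by simp
      have "x \<le> e + x\<^sup>2 / e" for x :: real
      proof -
        have "0 \<le> (x - e)\<^sup>2" "e * e > 0" using e by simp_all
        then have "2 * (x * e) \<le> e * e + x * x" "0 \<le> x * x" "0 \<le> e * e"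
          unfolding power2_diff by (simp_all add: power2_eq_square)
        then have "x * e \<le> e * e + x\<^sup>2" unfolding power2_eq_square by linarith
        then show ?thesis using e by (simp add: field_simps)
      qed
      then show "AE \<xi> in lebesgue_on {a..b}. norm (f \<xi>) \<le> e + (norm (f \<xi>))\<^sup>2 / e" by (intro AE_I2)
    qed
    also have "\<dots> = (b - a) * e + G / e"
      using fi ab by (simp add: G_def measure_restrict_space)
    finally show ?thesis .
  qed
  show ?thesis
  proof (cases "G = 0")
    case True
    have "I \<le> 0"
    proof (rule field_le_epsilon)
      fix e :: real assume e: "e > 0"
      have "(b - a) * (e / (b - a + 1)) \<le> e" using ab e by (simp add: field_simps)
      then show "I \<le> 0 + e" using le[of "e / (b - a + 1)"] True ab e by auto
    qed
    then show ?thesis using True by (simp add: G_def I_def)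
  next
    case False
    then have "sqrt G > 0" "G / sqrt G = sqrt G" using G0 by (auto simp: real_div_sqrt)
    then have "I \<le> (b - a + 1) * sqrt G" using le[of "sqrt G"] by (simp add: algebra_simps)
    then show ?thesis by (simp add: G_def I_def)
  qed
qed

text \<open>The complex setting common to both fields, as resolvents are always taken after
  complexification. The conditions quantify over all complex vectors and use the real inner product,
  which is the real part of \<open>cinner\<close>.\<close>

locale hyperbolic_coefficients =
  fixes a b m0 C0 :: real
    and P1 :: "complex^'n^('n::finite)"
    and P0 H :: "real \<Rightarrow> complex^'n^'n"
  assumes ab: "a < b" and P1inv: "invertible P1" and m0: "m0 > 0" and C0: "C0 > 0"
    and P0m: "P0 \<in> borel_measurable (lebesgue_on {a..b})"
    and Hm: "H \<in> borel_measurable (lebesgue_on {a..b})"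
    and coeff_bounds: "AE \<xi> in lebesgue_on {a..b}. (\<forall>x. norm (P0 \<xi> *v x) \<le> C0 * norm x) \<and>
      (\<forall>x. norm (H \<xi> *v x) \<le> C0 * norm x) \<and> (\<forall>x. m0 * (norm x)\<^sup>2 \<le> (H \<xi> *v x) \<bullet> x) \<and>
      (\<forall>x y. (H \<xi> *v x) \<bullet> y = x \<bullet> (H \<xi> *v y))"
begin

abbreviation X :: "'n state set" where "X \<equiv> L2 UNIV a b"
abbreviation nrm :: "'n state \<Rightarrow> real" where "nrm \<equiv> X_norm a b H"
abbreviation M where "M \<equiv> lebesgue_on {a..b}"

lemma H_coercive: "AE \<xi> in M. \<forall>x. m0 * (norm x)\<^sup>2 \<le> (H \<xi> *v x) \<bullet> x"
  and H_symmetric: "AE \<xi> in M. \<forall>x y. (H \<xi> *v x) \<bullet> y = x \<bullet> (H \<xi> *v y)"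
  using coeff_bounds by (auto elim!: eventually_mono)

text \<open>Coercivity and Cauchy-Schwarz give \<open>m0 * norm x \<le> norm (H \<xi> *v x)\<close>,
  hence a trivial kernel and the bound on the inverse.\<close>

lemma Hinv: "AE \<xi> in M. (\<forall>x. H \<xi> *v (matrix_inv (H \<xi>) *v x) = x) \<and>
  (\<forall>x. matrix_inv (H \<xi>) *v (H \<xi> *v x) = x) \<and> (\<forall>x. norm (matrix_inv (H \<xi>) *v x) \<le> norm x / m0)"
  using coeff_bounds
proof eventually_elim
  case (elim \<xi>)
  have low: "m0 * norm x \<le> norm (H \<xi> *v x)" for x
  proof (cases "x = 0")
    case False
    have "m0 * (norm x)\<^sup>2 \<le> norm (H \<xi> *v x) * norm x"
      using elim norm_cauchy_schwarz order_trans by meson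
    then show ?thesis using False by (simp add: power2_eq_square)
  qed simp
  have "H \<xi> *v x = 0 \<Longrightarrow> x = 0" for x using low[of x] m0 by (simp add: mult_le_0_iff)
  then have inv: "invertible (H \<xi>)"
    using invertible_left_inverse matrix_left_invertible_ker by blast
  have "norm (matrix_inv (H \<xi>) *v x) \<le> norm x / m0" for x
    using low[of "matrix_inv (H \<xi>) *v x"] m0 by (simp add: matrix_inv_mv_cancel[OF inv] field_simps)
  then show ?case using matrix_inv_mv_cancel[OF inv] by blast
qed

lemma X_H: "f \<in> X \<Longrightarrow> (\<lambda>\<xi>. H \<xi> *v f \<xi>) \<in> X"
  by (rule L2_dominated[where C=C0])
    (use coeff_bounds in \<open>auto simp: L2_UNIV_iff intro: borel_measurable_mv Hm\<close>)

lemma X_P0: "f \<in> X \<Longrightarrow> (\<lambda>\<xi>. P0 \<xi> *v f \<xi>) \<in> X"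
  by (rule L2_dominated[where C=C0])
    (use coeff_bounds in \<open>auto simp: L2_UNIV_iff intro: borel_measurable_mv P0m\<close>)

lemma X_Hinv: "f \<in> X \<Longrightarrow> (\<lambda>\<xi>. matrix_inv (H \<xi>) *v f \<xi>) \<in> X"
  by (rule L2_dominated[where C="1/m0"])
    (use Hinv in \<open>auto simp: L2_UNIV_iff intro!: borel_measurable_mv borel_measurable_matrix_inv Hm\<close>)

lemma X_mv:
  fixes A :: "complex^'n^'n"
  assumes "f \<in> X" shows "(\<lambda>\<xi>. A *v f \<xi>) \<in> X"
proof -
  obtain K where K: "\<And>(A::complex^'n^'n) (x::complex^'n). norm (A *v x) \<le> norm A * norm x * K"
    using bounded_bilinear.nonneg_bounded[OF bounded_bilinear_mv] by blast
  show ?thesis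
    by (rule L2_dominated[OF assms, where C="norm A * K"])
      (use assms K[of A] in \<open>auto simp: L2_UNIV_iff mult.assoc mult.commute[of K] intro: borel_measurable_mv\<close>)
qed

text \<open>The real part of \<open>X_inner\<close>. As a symmetric real bilinear form it determines
  the norm and spares the conjugates in the Cauchy-Schwarz and triangle inequalities.\<close>

definition energy :: "'n state \<Rightarrow> 'n state \<Rightarrow> real" where
  "energy f g = 1/2 * (LINT \<xi>|M. (H \<xi> *v f \<xi>) \<bullet> g \<xi>)"

lemma energy_integrable: "f \<in> X \<Longrightarrow> g \<in> X \<Longrightarrow> integrable M (\<lambda>\<xi>. (H \<xi> *v f \<xi>) \<bullet> g \<xi>)"
  unfolding inner_eq_Re_cinner
  by (rule integrable_bounded_linear[OF bounded_linear_Re L2_cinner_integrable[OF X_H]])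

lemma nrm_eq: "f \<in> X \<Longrightarrow> nrm f = sqrt (energy f f)"
  unfolding X_norm_def X_inner_def energy_def inner_eq_Re_cinner
  by (subst integral_bounded_linear[OF bounded_linear_Re L2_cinner_integrable[OF X_H]]) auto

lemma energy_cong:
  assumes "f \<in> X" "g \<in> X" "f' \<in> X" "g' \<in> X" "AE \<xi> in M. f \<xi> = f' \<xi>" "AE \<xi> in M. g \<xi> = g' \<xi>"
  shows "energy f g = energy f' g'"
  unfolding energy_def using assms
  by (intro arg_cong2[where f="(*)"] refl integral_cong_AE borel_measurable_integrable energy_integrable) auto

lemma energy_commute:
  assumes "f \<in> X" "g \<in> X" shows "energy f g = energy g f"
  unfolding energy_def
proof (intro arg_cong2[where f="(*)"] refl integral_cong_AE borel_measurable_integrable energy_integrable assms)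
  show "AE \<xi> in M. (H \<xi> *v f \<xi>) \<bullet> g \<xi> = (H \<xi> *v g \<xi>) \<bullet> f \<xi>"
    using H_symmetric by eventually_elim (metis inner_commute)
qed

lemma energy_add_left: "f \<in> X \<Longrightarrow> g \<in> X \<Longrightarrow> h \<in> X \<Longrightarrow> energy (\<lambda>\<xi>. f \<xi> + g \<xi>) h = energy f h + energy g h"
  by (simp add: energy_def matrix_vector_right_distrib inner_add_left energy_integrable)

lemma energy_scaleR_left: "f \<in> X \<Longrightarrow> h \<in> X \<Longrightarrow> energy (\<lambda>\<xi>. r *\<^sub>R f \<xi>) h = r * energy f h"
  by (simp add: energy_def mv_scaleR energy_integrable)

lemma energy_add_right: "f \<in> X \<Longrightarrow> g \<in> X \<Longrightarrow> h \<in> X \<Longrightarrow> energy h (\<lambda>\<xi>. f \<xi> + g \<xi>) = energy h f + energy h g"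
  by (simp add: energy_def inner_add_right energy_integrable)

lemma energy_scaleR_right: "f \<in> X \<Longrightarrow> h \<in> X \<Longrightarrow> energy h (\<lambda>\<xi>. r *\<^sub>R f \<xi>) = r * energy h f"
  by (simp add: energy_def energy_integrable)

lemma energy_lower:
  assumes "f \<in> X" shows "m0 / 2 * (LINT \<xi>|M. (norm (f \<xi>))\<^sup>2) \<le> energy f f"
proof -
  have "(LINT \<xi>|M. m0 * (norm (f \<xi>))\<^sup>2) \<le> (LINT \<xi>|M. (H \<xi> *v f \<xi>) \<bullet> f \<xi>)"
  proof (rule integral_mono_AE)
    show "AE \<xi> in M. m0 * (norm (f \<xi>))\<^sup>2 \<le> (H \<xi> *v f \<xi>) \<bullet> f \<xi>" using H_coercive by eventually_elim simp
  qed (use assms energy_integrable in \<open>auto simp: L2_UNIV_iff\<close>)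
  then show ?thesis by (simp add: energy_def)
qed

lemma energy_upper:
  assumes "f \<in> X" shows "energy f f \<le> C0 / 2 * (LINT \<xi>|M. (norm (f \<xi>))\<^sup>2)"
proof -
  have "(LINT \<xi>|M. (H \<xi> *v f \<xi>) \<bullet> f \<xi>) \<le> (LINT \<xi>|M. C0 * (norm (f \<xi>))\<^sup>2)"
  proof (rule integral_mono_AE)
    show "AE \<xi> in M. (H \<xi> *v f \<xi>) \<bullet> f \<xi> \<le> C0 * (norm (f \<xi>))\<^sup>2"
      using coeff_bounds
    proof eventually_elim
      case (elim \<xi>)
      have "(H \<xi> *v f \<xi>) \<bullet> f \<xi> \<le> norm (H \<xi> *v f \<xi>) * norm (f \<xi>)" by (rule norm_cauchy_schwarz)
      also have "\<dots> \<le> (C0 * norm (f \<xi>)) * norm (f \<xi>)" using elim by (intro mult_right_mono) auto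
      finally show ?case by (simp add: power2_eq_square mult.assoc)
    qed
  qed (use assms energy_integrable in \<open>auto simp: L2_UNIV_iff\<close>)
  then show ?thesis by (simp add: energy_def)
qed

lemma energy_nonneg: "f \<in> X \<Longrightarrow> 0 \<le> energy f f"
proof -
  assume "f \<in> X"
  moreover have "0 \<le> m0 / 2 * (LINT \<xi>|M. (norm (f \<xi>))\<^sup>2)"
    using m0 by (intro mult_nonneg_nonneg integral_nonneg_AE) auto
  ultimately show ?thesis using energy_lower by fastforce
qed

lemma nrm_sq: "f \<in> X \<Longrightarrow> (nrm f)\<^sup>2 = energy f f" by (simp add: nrm_eq energy_nonneg)
lemma nrm_nonneg: "f \<in> X \<Longrightarrow> 0 \<le> nrm f" by (simp add: nrm_eq energy_nonneg)

lemma nrm_cong: "f \<in> X \<Longrightarrow> AE \<xi> in M. f \<xi> = g \<xi> \<Longrightarrow> nrm f = nrm g"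
  using L2_AE_cong[of f a b g] by (simp add: nrm_eq energy_cong[of f f g g])

lemma nrm_zero: "nrm (\<lambda>\<xi>. 0) = 0" by (simp add: X_norm_def X_inner_def cinner_def)

text \<open>Translates the equality used in \<open>C0_semigroup\<close> and
  \<open>resolvent_set\<close>, where the seminorm of a difference vanishes, into equality almost
  everywhere. Coercivity of \<open>H\<close> is the reason.\<close>

lemma nrm_eq_0_iff:
  assumes "f \<in> X" shows "nrm f = 0 \<longleftrightarrow> (AE \<xi> in M. f \<xi> = 0)"
proof
  assume "nrm f = 0"
  then have "energy f f = 0" using assms by (simp flip: nrm_sq)
  then have "m0 / 2 * (LINT \<xi>|M. (norm (f \<xi>))\<^sup>2) \<le> 0" using energy_lower[OF assms] by simp
  then have "(LINT \<xi>|M. (norm (f \<xi>))\<^sup>2) \<le> 0" using m0 by (simp add: mult_le_0_iff)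
  moreover have "(LINT \<xi>|M. (norm (f \<xi>))\<^sup>2) \<ge> 0" by (rule integral_nonneg_AE) auto
  ultimately have "(LINT \<xi>|M. (norm (f \<xi>))\<^sup>2) = 0" by simp
  then have "AE \<xi> in M. (norm (f \<xi>))\<^sup>2 = 0"
    using integral_nonneg_eq_0_iff_AE[of M "\<lambda>\<xi>. (norm (f \<xi>))\<^sup>2"] assms by (simp add: L2_UNIV_iff)
  then show "AE \<xi> in M. f \<xi> = 0" by simp
next
  assume "AE \<xi> in M. f \<xi> = 0"
  then show "nrm f = 0" using nrm_cong[OF assms, of "\<lambda>_. 0"] nrm_zero by simp
qed

lemma nrm_smult: "f \<in> X \<Longrightarrow> nrm (\<lambda>\<xi>. c *s f \<xi>) = cmod c * nrm f"
proof -
  assume f: "f \<in> X"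
  have "cinner (A *v (c *s v)) (c *s v) = complex_of_real ((cmod c)\<^sup>2) * cinner (A *v v) v" for A :: "complex^'n^'n" and v
  proof -
    have "cinner (c *s w) (c *s v) = (cnj c * c) * cinner w v" for w v :: "complex^'n"
      by (simp add: cinner_def sum_distrib_left mult_ac)
    then show ?thesis unfolding vector_scalar_commute complex_norm_square mult.commute[of c] .
  qed
  then have "(A *v (c *s v)) \<bullet> (c *s v) = (cmod c)\<^sup>2 * ((A *v v) \<bullet> v)" for A :: "complex^'n^'n" and v
    by (simp add: inner_eq_Re_cinner)
  then have "energy (\<lambda>\<xi>. c *s f \<xi>) (\<lambda>\<xi>. c *s f \<xi>) = (cmod c)\<^sup>2 * energy f f"
    by (simp add: energy_def)
  then show ?thesis using f by (simp add: nrm_eq L2_smult real_sqrt_mult)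
qed

lemma nrm_scaleR: "f \<in> X \<Longrightarrow> nrm (\<lambda>\<xi>. r *\<^sub>R f \<xi>) = \<bar>r\<bar> * nrm f"
  using nrm_smult[of f "complex_of_real r"] by (simp add: complex_scaleR_eq)

text \<open>Expands the nonnegative energy of \<open>q f - p g\<close> with \<open>p = nrm f\<close>
  and \<open>q = nrm g\<close>. A vanishing norm is treated apart since the last step divides by
  \<open>p q\<close>.\<close>

lemma energy_Cauchy_Schwarz:
  assumes f: "f \<in> X" and g: "g \<in> X" shows "energy f g \<le> nrm f * nrm g"
proof (cases "nrm f = 0 \<or> nrm g = 0")
  case True
  then have "energy f g = 0"
  proof
    assume "nrm f = 0"
    then have "energy f g = energy (\<lambda>_. 0) g" using f g by (intro energy_cong) (auto simp: nrm_eq_0_iff L2_zero)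
    then show ?thesis by (simp add: energy_def)
  next
    assume "nrm g = 0"
    then have "energy f g = energy f (\<lambda>_. 0)" using f g by (intro energy_cong) (auto simp: nrm_eq_0_iff L2_zero)
    then show ?thesis by (simp add: energy_def)
  qed
  then show ?thesis using f g nrm_nonneg by simp
next
  case False
  let ?p = "nrm f" and ?q = "nrm g"
  have pos: "?p * ?q > 0" using False nrm_nonneg[OF f] nrm_nonneg[OF g] by (simp add: less_le)
  let ?h = "\<lambda>\<xi>. ?q *\<^sub>R f \<xi> + (- ?p) *\<^sub>R g \<xi>"
  have qf: "(\<lambda>\<xi>. ?q *\<^sub>R f \<xi>) \<in> X" and pg: "(\<lambda>\<xi>. (- ?p) *\<^sub>R g \<xi>) \<in> X" by (rule L2_scaleR[OF f], rule L2_scaleR[OF g])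
  have "0 \<le> energy ?h ?h" using L2_add[OF qf pg] by (rule energy_nonneg)
  also have "energy ?h ?h = ?q\<^sup>2 * energy f f - 2 * (?p * ?q) * energy f g + ?p\<^sup>2 * energy g g"
    unfolding energy_add_left[OF qf pg L2_add[OF qf pg]] energy_add_right[OF qf pg qf] energy_add_right[OF qf pg pg]
      energy_scaleR_left[OF f qf] energy_scaleR_left[OF g qf] energy_scaleR_left[OF f pg] energy_scaleR_left[OF g pg]
      energy_scaleR_right[OF f f] energy_scaleR_right[OF f g] energy_scaleR_right[OF g f] energy_scaleR_right[OF g g]
      energy_commute[OF g f] by (simp add: power2_eq_square algebra_simps)
  also have "\<dots> = 2 * (?p * ?q) * (?p * ?q - energy f g)"
    unfolding nrm_sq[OF f, symmetric] nrm_sq[OF g, symmetric] by (simp add: power2_eq_square algebra_simps)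
  finally have "0 \<le> (?p * ?q) * (?p * ?q - energy f g)" by simp
  then show ?thesis using pos by (simp add: zero_le_mult_iff)
qed

lemma nrm_triangle:
  assumes f: "f \<in> X" and g: "g \<in> X" shows "nrm (\<lambda>\<xi>. f \<xi> + g \<xi>) \<le> nrm f + nrm g"
proof (rule power2_le_imp_le)
  have "(nrm (\<lambda>\<xi>. f \<xi> + g \<xi>))\<^sup>2 = energy f f + 2 * energy f g + energy g g"
    unfolding nrm_sq[OF L2_add[OF f g]] energy_add_left[OF f g L2_add[OF f g]] energy_add_right[OF f g f] energy_add_right[OF f g g]
      energy_commute[OF g f] by simp
  also have "\<dots> \<le> (nrm f + nrm g)\<^sup>2"
    unfolding power2_sum nrm_sq[OF f] nrm_sq[OF g] using energy_Cauchy_Schwarz[OF f g] by simp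
  finally show "(nrm (\<lambda>\<xi>. f \<xi> + g \<xi>))\<^sup>2 \<le> (nrm f + nrm g)\<^sup>2" .
qed (use f g nrm_nonneg in auto)

lemma nrm_ge_L2: 
  assumes "f \<in> X" shows "sqrt (LINT \<xi>|M. (norm (f \<xi>))\<^sup>2) \<le> sqrt (2 / m0) * nrm f"
proof -
  have "(LINT \<xi>|M. (norm (f \<xi>))\<^sup>2) \<le> 2 / m0 * energy f f" using energy_lower[OF assms] m0 by (simp add: field_simps)
  then have "sqrt (LINT \<xi>|M. (norm (f \<xi>))\<^sup>2) \<le> sqrt (2 / m0 * energy f f)" by (rule real_sqrt_le_mono)
  then show ?thesis unfolding nrm_eq[OF assms] real_sqrt_mult .
qed

lemma nrm_le_bound:
  assumes f: "f \<in> X" and B: "B \<ge> 0" and le: "AE \<xi> in M. norm (f \<xi>) \<le> B"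
  shows "nrm f \<le> sqrt (C0 / 2 * (b - a)) * B"
proof -
  interpret finite_measure M by (rule finite_measure_lebesgue_on) auto
  have "(LINT \<xi>|M. (norm (f \<xi>))\<^sup>2) \<le> (LINT \<xi>|M. B\<^sup>2)"
    by (rule integral_mono_AE) (use f le in \<open>auto simp: L2_UNIV_iff intro!: power_mono elim!: eventually_mono\<close>)
  also have "\<dots> = (b - a) * B\<^sup>2" using ab by (simp add: measure_restrict_space)
  finally have "C0 / 2 * (LINT \<xi>|M. (norm (f \<xi>))\<^sup>2) \<le> C0 / 2 * ((b - a) * B\<^sup>2)"
    using C0 by (intro mult_left_mono) auto
  then have "energy f f \<le> C0 / 2 * (b - a) * B\<^sup>2" using energy_upper[OF f] by simp
  then have "nrm f \<le> sqrt (C0 / 2 * (b - a) * B\<^sup>2)" unfolding nrm_eq[OF f] by (rule real_sqrt_le_mono)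
  also have "sqrt (C0 / 2 * (b - a) * B\<^sup>2) = sqrt (C0 / 2 * (b - a)) * B"
    unfolding real_sqrt_mult[of _ "B\<^sup>2"] using B by simp
  finally show ?thesis .
qed

end

section \<open>The resolvent equation\<close>

lemma norm_vec_le_sum: "norm x \<le> (\<Sum>i\<in>UNIV. norm (x $ i))"
  unfolding norm_vec_def by (rule L2_set_le_sum) simp

text \<open>Carries a bound on vectors over to matrices columnwise. One factor
  \<open>CARD('n)\<close> bounds a column by the whole matrix, the other two come from summing over
  columns and rows.\<close>

lemma norm_mm_le_of_mv:
  fixes B :: "complex^'n^'n" and Y :: "complex^'n^'n"
  assumes "\<And>x. norm (B *v x) \<le> L * norm x"
  shows "norm (B ** Y) \<le> real CARD('n) ^ 3 * L * norm Y"
proof -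
  have "0 \<le> L * norm (axis undefined 1 :: complex^'n)" by (rule order_trans[OF norm_ge_zero assms])
  then have L: "L \<ge> 0" by (simp add: norm_eq_sqrt_inner inner_axis_axis)
  have col: "norm (column j Y) \<le> real CARD('n) * norm Y" for j
  proof -
    have "norm (column j Y) \<le> (\<Sum>i\<in>UNIV. norm (column j Y $ i))" by (rule norm_vec_le_sum)
    also have "\<dots> \<le> (\<Sum>i\<in>(UNIV::'n set). norm Y)"
      by (intro sum_mono) (auto simp: column_def intro: order_trans[OF Finite_Cartesian_Product.norm_nth_le Finite_Cartesian_Product.norm_nth_le])
    finally show ?thesis by simp
  qed
  have "norm ((B ** Y) $ i $ j) \<le> L * (real CARD('n) * norm Y)" for i j
  proof -
    have "(B ** Y) $ i $ j = (B *v column j Y) $ i"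
      by (simp add: matrix_matrix_mult_def matrix_vector_mult_def column_def)
    also have "norm \<dots> \<le> norm (B *v column j Y)" by (rule Finite_Cartesian_Product.norm_nth_le)
    also have "\<dots> \<le> L * norm (column j Y)" by (rule assms)
    also have "\<dots> \<le> L * (real CARD('n) * norm Y)" using col L by (intro mult_left_mono) auto
    finally show ?thesis .
  qed
  then have "norm ((B ** Y) $ i) \<le> real CARD('n) * (L * (real CARD('n) * norm Y))" for i
    using sum_mono[of UNIV "\<lambda>j. norm ((B ** Y) $ i $ j)" "\<lambda>_. L * (real CARD('n) * norm Y)"]
      norm_vec_le_sum[of "(B ** Y) $ i"] by simp
  then have "norm (B ** Y) \<le> real CARD('n) * (real CARD('n) * (L * (real CARD('n) * norm Y)))"
    using sum_mono[of UNIV "\<lambda>i. norm ((B ** Y) $ i)" "\<lambda>_. real CARD('n) * (L * (real CARD('n) * norm Y))"]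
      norm_vec_le_sum[of "B ** Y"] by simp
  then show ?thesis by (simp add: power3_eq_cube mult_ac)
qed

lemma mat_mult_vec: "(mat s :: complex^'n^'n) *v x = s *s x"
  by (simp add: vec_eq_iff matrix_vector_mult_def mat_def if_distrib if_distribR cong: if_cong)

context hyperbolic_coefficients
begin

text \<open>The coefficient of the equation for \<open>w = H x\<close>, obtained from
  \<open>s x = P1 w' + P0 w\<close> by solving for \<open>w'\<close>.\<close>

definition ode_mat :: "complex \<Rightarrow> real \<Rightarrow> complex^'n^'n" where
  "ode_mat s \<tau> = - (matrix_inv P1 ** (P0 \<tau> - mat s ** matrix_inv (H \<tau>)))"

lemma ode_mat_mv: "ode_mat s \<tau> *v x = matrix_inv P1 *v (s *s (matrix_inv (H \<tau>) *v x) - P0 \<tau> *v x)"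
  by (simp add: ode_mat_def bounded_bilinear.minus_left[OF bounded_bilinear_mv] matrix_vector_mult_diff_rdistrib
      matrix_vector_mult_diff_distrib mat_mult_vec flip: matrix_vector_mul_assoc)

lemma ode_mat_measurable: "ode_mat s \<in> borel_measurable M"
  unfolding ode_mat_def
  by (intro borel_measurable_uminus borel_measurable_mm borel_measurable_diff borel_measurable_const
      P0m borel_measurable_matrix_inv Hm)

lemma ode_mat_bounded: obtains L where "L > 0" "AE \<tau> in M. \<forall>x. norm (ode_mat s \<tau> *v x) \<le> L * norm x"
proof -
  obtain K where K: "K \<ge> 0" "\<And>(A::complex^'n^'n) (x::complex^'n). norm (A *v x) \<le> norm A * norm x * K"
    using bounded_bilinear.nonneg_bounded[OF bounded_bilinear_mv] by blast
  define k where "k = norm (matrix_inv P1) * K"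
  have k0: "k \<ge> 0" using K by (simp add: k_def)
  have k: "norm (matrix_inv P1 *v x) \<le> k * norm x" for x using K(2)[of "matrix_inv P1" x] by (simp add: k_def mult_ac)
  \<comment> \<open>The summand 1 makes the constant strictly positive, as
    \<open>caratheodory\<close> demands.\<close>
  let ?L = "k * (cmod s / m0 + C0) + 1"
  have "AE \<tau> in M. \<forall>x. norm (ode_mat s \<tau> *v x) \<le> ?L * norm x"
    using coeff_bounds Hinv
  proof eventually_elim
    case (elim \<tau>)
    show ?case
    proof
      fix x
      have "norm (s *s (matrix_inv (H \<tau>) *v x) - P0 \<tau> *v x) \<le> cmod s * (norm x / m0) + C0 * norm x"
      proof (rule order_trans[OF norm_triangle_ineq4], rule add_mono)
        show "norm (s *s (matrix_inv (H \<tau>) *v x)) \<le> cmod s * (norm x / m0)"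
          unfolding norm_smult using elim by (intro mult_left_mono) auto
      qed (use elim in auto)
      then have "norm (ode_mat s \<tau> *v x) \<le> k * (cmod s * (norm x / m0) + C0 * norm x)"
        unfolding ode_mat_mv using k k0 by (meson mult_left_mono order_trans)
      also have "\<dots> = (k * (cmod s / m0 + C0)) * norm x" by (simp add: algebra_simps)
      also have "\<dots> \<le> ?L * norm x" by (intro mult_right_mono) auto
      finally show "norm (ode_mat s \<tau> *v x) \<le> ?L * norm x" .
    qed
  qed
  moreover have "?L > 0" using k0 m0 C0 by (intro add_nonneg_pos mult_nonneg_nonneg add_nonneg_nonneg) auto
  ultimately show thesis using that by blast
qed

lemma vec_caratheodory: obtains L where "caratheodory a b L (\<lambda>\<tau> x. ode_mat s \<tau> *v x)"
proof -
  obtain L where L: "L > 0" "AE \<tau> in M. \<forall>x. norm (ode_mat s \<tau> *v x) \<le> L * norm x" using ode_mat_bounded by blast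
  have "caratheodory a b L (\<lambda>\<tau> x. ode_mat s \<tau> *v x)"
  proof
    show "(\<lambda>\<tau>. ode_mat s \<tau> *v w \<tau>) \<in> borel_measurable M" if "continuous_on {a..b} w" for w
      by (intro borel_measurable_mv ode_mat_measurable continuous_measurable_Icc that)
    show "AE \<tau> in M. \<forall>x y. norm (ode_mat s \<tau> *v x - ode_mat s \<tau> *v y) \<le> L * norm (x - y)"
      using L(2) by eventually_elim (simp flip: matrix_vector_mult_diff_distrib)
  qed (use ab L in auto)
  then show thesis by (rule that)
qed

lemma mat_caratheodory: obtains L where "caratheodory a b L (\<lambda>\<tau> (Y::complex^'n^'n). ode_mat s \<tau> ** Y)"
proof -
  obtain L where L: "L > 0" "AE \<tau> in M. \<forall>x. norm (ode_mat s \<tau> *v x) \<le> L * norm x" using ode_mat_bounded by blast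
  let ?L = "real CARD('n) ^ 3 * L"
  have "caratheodory a b ?L (\<lambda>\<tau> (Y::complex^'n^'n). ode_mat s \<tau> ** Y)"
  proof
    show "(\<lambda>\<tau>. ode_mat s \<tau> ** w \<tau>) \<in> borel_measurable M" if "continuous_on {a..b} w" for w :: "real \<Rightarrow> complex^'n^'n"
      by (intro borel_measurable_mm ode_mat_measurable continuous_measurable_Icc that)
    show "AE \<tau> in M. \<forall>x y::complex^'n^'n. norm (ode_mat s \<tau> ** x - ode_mat s \<tau> ** y) \<le> ?L * norm (x - y)"
      using L(2)
    proof eventually_elim
      case (elim \<tau>)
      then have "norm (ode_mat s \<tau> ** Y) \<le> ?L * norm Y" for Y :: "complex^'n^'n"
        by (intro norm_mm_le_of_mv) blast
      then show ?case
        unfolding bounded_bilinear.diff_right[OF bounded_bilinear_mm, symmetric] by blast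
    qed
    show "AE \<tau> in M. ode_mat s \<tau> ** (0::complex^'n^'n) = 0"
      by (simp add: bounded_bilinear.zero_right[OF bounded_bilinear_mm])
  qed (use ab L in auto)
  then show thesis by (rule that)
qed

abbreviation \<Psi> :: "complex \<Rightarrow> real \<Rightarrow> complex^'n^'n" where
  "\<Psi> s \<equiv> fundamental_solution a b P1 P0 H s"

lemma is_fundamental_iff:
  "is_fundamental_solution a b P1 P0 H s \<Phi> \<longleftrightarrow> continuous_on {a..b} \<Phi> \<and>
     (\<forall>\<zeta>\<in>{a..b}. \<Phi> \<zeta> = mat 1 + (LINT \<tau>|lebesgue_on {a..\<zeta>}. ode_mat s \<tau> ** \<Phi> \<tau>))"
  unfolding is_fundamental_solution_def ode_mat_def
  by (simp add: bounded_bilinear.minus_left[OF bounded_bilinear_mm])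

text \<open>\<open>fundamental_solution\<close> is a choice, so its defining equation becomes
  available only through an existence proof.\<close>

lemma \<Psi>: "continuous_on {a..b} (\<Psi> s)"
  "\<zeta> \<in> {a..b} \<Longrightarrow> \<Psi> s \<zeta> = mat 1 + (LINT \<tau>|lebesgue_on {a..\<zeta>}. ode_mat s \<tau> ** \<Psi> s \<tau>)"
proof -
  obtain L where "caratheodory a b L (\<lambda>\<tau> (Y::complex^'n^'n). ode_mat s \<tau> ** Y)" using mat_caratheodory .
  then interpret caratheodory a b L "\<lambda>\<tau> (Y::complex^'n^'n). ode_mat s \<tau> ** Y" .
  obtain \<Phi> where "continuous_on {a..b} \<Phi>"
    "\<And>\<zeta>. \<zeta> \<in> {a..b} \<Longrightarrow> \<Phi> \<zeta> = mat 1 + (LINT \<tau>|lebesgue_on {a..\<zeta>}. ode_mat s \<tau> ** \<Phi> \<tau>)"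
    using solution_exists[OF continuous_on_const] by blast
  then have "is_fundamental_solution a b P1 P0 H s \<Phi>"
    unfolding is_fundamental_iff by blast
  then have "is_fundamental_solution a b P1 P0 H s (\<Psi> s)"
    unfolding fundamental_solution_def by (rule someI[of "is_fundamental_solution a b P1 P0 H s"])
  then show "continuous_on {a..b} (\<Psi> s)"
    "\<zeta> \<in> {a..b} \<Longrightarrow> \<Psi> s \<zeta> = mat 1 + (LINT \<tau>|lebesgue_on {a..\<zeta>}. ode_mat s \<tau> ** \<Psi> s \<tau>)"
    unfolding is_fundamental_iff by auto
qed

lemma \<Psi>_a: "\<Psi> s a = mat 1"
proof -
  have "{a} \<in> null_sets lebesgue" by simp
  then have "(LINT \<tau>|lebesgue_on {a..a}. ode_mat s \<tau> ** \<Psi> s \<tau>) = 0"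
    using integral_eq_zero_null_sets[of "{a}"] by simp
  then show ?thesis using \<Psi>(2)[of a s] ab by simp
qed

text \<open>The integrated equation \<open>w' = ode_mat s w - P1\<^sup>-\<^sup>1 g\<close>, that is
  \<open>(s - A) f = g\<close> in terms of \<open>w = H f\<close> and without boundary condition.
  The forcing term stands first to match \<open>p \<zeta> + I w \<zeta>\<close> in
  \<open>caratheodory\<close>.\<close>

definition resolvent_ode :: "complex \<Rightarrow> 'n state \<Rightarrow> 'n state \<Rightarrow> bool" where
  "resolvent_ode s g w \<longleftrightarrow> continuous_on {a..b} w \<and> (\<forall>\<zeta>\<in>{a..b}. w \<zeta> =
     (w a - (LINT \<tau>|lebesgue_on {a..\<zeta>}. matrix_inv P1 *v g \<tau>)) + (LINT \<tau>|lebesgue_on {a..\<zeta>}. ode_mat s \<tau> *v w \<tau>))"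

lemma \<Psi>_mv:
  "continuous_on {a..b} (\<lambda>\<zeta>. \<Psi> s \<zeta> *v v)"
  "\<zeta> \<in> {a..b} \<Longrightarrow> \<Psi> s \<zeta> *v v = v + (LINT \<tau>|lebesgue_on {a..\<zeta>}. ode_mat s \<tau> *v (\<Psi> s \<tau> *v v))"
proof -
  obtain L where "caratheodory a b L (\<lambda>\<tau> (Y::complex^'n^'n). ode_mat s \<tau> ** Y)" using mat_caratheodory .
  then interpret caratheodory a b L "\<lambda>\<tau> (Y::complex^'n^'n). ode_mat s \<tau> ** Y" .
  show "continuous_on {a..b} (\<lambda>\<zeta>. \<Psi> s \<zeta> *v v)"
    by (intro bounded_bilinear.continuous_on[OF bounded_bilinear_mv] \<Psi> continuous_intros)
  assume z: "\<zeta> \<in> {a..b}"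
  have "(LINT \<tau>|lebesgue_on {a..\<zeta>}. (ode_mat s \<tau> ** \<Psi> s \<tau>) *v v) = (LINT \<tau>|lebesgue_on {a..\<zeta>}. ode_mat s \<tau> ** \<Psi> s \<tau>) *v v"
    by (rule integral_bounded_linear[OF bounded_bilinear.bounded_linear_left[OF bounded_bilinear_mv] int_G_sub[OF \<Psi>(1) z]])
  then show "\<Psi> s \<zeta> *v v = v + (LINT \<tau>|lebesgue_on {a..\<zeta>}. ode_mat s \<tau> *v (\<Psi> s \<tau> *v v))"
    using arg_cong[OF \<Psi>(2)[OF z, of s], of "\<lambda>A. A *v v"]
    by (simp add: matrix_vector_mult_add_rdistrib matrix_vector_mul_assoc)
qed

lemma P1inv_g_integrable:
  assumes "g \<in> X"
  shows "integrable M (\<lambda>\<tau>. matrix_inv P1 *v g \<tau>)"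
    and "\<zeta> \<in> {a..b} \<Longrightarrow> integrable (lebesgue_on {a..\<zeta>}) (\<lambda>\<tau>. matrix_inv P1 *v g \<tau>)"
proof -
  show i: "integrable M (\<lambda>\<tau>. matrix_inv P1 *v g \<tau>)" by (rule L2_integrable[OF X_mv[OF assms]])
  show "\<zeta> \<in> {a..b} \<Longrightarrow> integrable (lebesgue_on {a..\<zeta>}) (\<lambda>\<tau>. matrix_inv P1 *v g \<tau>)"
    using integrable_subinterval[OF i, of a \<zeta>] by auto
qed

lemma ode_mat_w:
  assumes w: "continuous_on {a..b} w"
  shows "(\<lambda>\<tau>. ode_mat s \<tau> *v w \<tau>) \<in> X"
    and "\<zeta> \<in> {a..b} \<Longrightarrow> integrable (lebesgue_on {a..\<zeta>}) (\<lambda>\<tau>. ode_mat s \<tau> *v w \<tau>)"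
proof -
  have "w \<in> X" by (rule L2_continuous[OF w])
  then show 1: "(\<lambda>\<tau>. ode_mat s \<tau> *v w \<tau>) \<in> X"
    unfolding ode_mat_mv by (intro X_mv L2_diff L2_smult X_Hinv X_P0)
  show "\<zeta> \<in> {a..b} \<Longrightarrow> integrable (lebesgue_on {a..\<zeta>}) (\<lambda>\<tau>. ode_mat s \<tau> *v w \<tau>)"
    using integrable_subinterval[OF L2_integrable[OF 1], of a \<zeta>] by auto
qed

lemma P1_cancel: "P1 *v (matrix_inv P1 *v x) = x" "matrix_inv P1 *v (P1 *v x) = x"
  by (rule matrix_inv_mv_cancel[OF P1inv])+

lemma H1_continuous: "H1 UNIV a b w w' \<Longrightarrow> continuous_on {a..b} w"
proof -
  assume w: "H1 UNIV a b w w'"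
  have "continuous_on {a..b} (\<lambda>\<xi>. w a + (LINT \<tau>|lebesgue_on {a..\<xi>}. w' \<tau>))"
    using w by (intro continuous_on_add continuous_on_const LINT_Icc_continuous L2_integrable) (auto simp: H1_def)
  moreover have "w \<xi> = w a + (LINT \<tau>|lebesgue_on {a..\<xi>}. w' \<tau>)" if "\<xi> \<in> {a..b}" for \<xi>
    using w that unfolding H1_def by blast
  ultimately show ?thesis by (rule iffD2[OF continuous_on_cong[OF refl], rotated])
qed

text \<open>Together with \<open>resolvent_odeD\<close> this trades a state \<open>f\<close>, known
  almost everywhere, for the continuous \<open>w\<close>, from which \<open>f\<close> is recovered
  by inverting \<open>H\<close>.\<close>

lemma resolvent_odeI:
  assumes f: "f \<in> X" and g: "g \<in> X" and w: "H1 UNIV a b w w'" and Hf: "AE \<xi> in M. H \<xi> *v f \<xi> = w \<xi>"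
    and eq: "AE \<xi> in M. s *s f \<xi> - g \<xi> = P1 *v w' \<xi> + P0 \<xi> *v (H \<xi> *v f \<xi>)"
  shows "resolvent_ode s g w" "AE \<xi> in M. f \<xi> = matrix_inv (H \<xi>) *v w \<xi>"
proof -
  show f': "AE \<xi> in M. f \<xi> = matrix_inv (H \<xi>) *v w \<xi>" using Hf Hinv
  proof eventually_elim
    case (elim \<xi>)
    then have "matrix_inv (H \<xi>) *v (H \<xi> *v f \<xi>) = f \<xi>" by blast
    then show ?case using elim by simp
  qed
  have c: "continuous_on {a..b} w" by (rule H1_continuous[OF w])
  have w'eq: "AE \<xi> in M. w' \<xi> = ode_mat s \<xi> *v w \<xi> - matrix_inv P1 *v g \<xi>"
    using f' Hf eq
  proof eventually_elim
    case (elim \<xi>)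
    have "w' \<xi> = matrix_inv P1 *v (s *s f \<xi> - g \<xi> - P0 \<xi> *v (H \<xi> *v f \<xi>))"
      using P1_cancel(2)[of "w' \<xi>"] elim(3) by (simp add: algebra_simps)
    then show ?case using elim by (simp add: ode_mat_mv matrix_vector_mult_diff_distrib)
  qed
  show "resolvent_ode s g w"
    unfolding resolvent_ode_def
  proof (intro conjI ballI c)
    fix \<zeta> assume z: "\<zeta> \<in> {a..b}"
    have "w \<zeta> = w a + (LINT \<tau>|lebesgue_on {a..\<zeta>}. w' \<tau>)" using w z unfolding H1_def by blast
    also have "(LINT \<tau>|lebesgue_on {a..\<zeta>}. w' \<tau>) = (LINT \<tau>|lebesgue_on {a..\<zeta>}. ode_mat s \<tau> *v w \<tau> - matrix_inv P1 *v g \<tau>)"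
    proof (rule integral_cong_AE)
      have "integrable M w'" using w by (intro L2_integrable) (auto simp: H1_def)
      then show "w' \<in> borel_measurable (lebesgue_on {a..\<zeta>})"
        using integrable_subinterval[of a b w' a \<zeta>] z by auto
      show "(\<lambda>\<tau>. ode_mat s \<tau> *v w \<tau> - matrix_inv P1 *v g \<tau>) \<in> borel_measurable (lebesgue_on {a..\<zeta>})"
        using ode_mat_w(2)[OF c z] P1inv_g_integrable(2)[OF g z] by auto
      show "AE \<xi> in lebesgue_on {a..\<zeta>}. w' \<xi> = ode_mat s \<xi> *v w \<xi> - matrix_inv P1 *v g \<xi>"
        by (rule AE_lebesgue_on_subset[OF w'eq]) (use z in auto)
    qed
    also have "\<dots> = (LINT \<tau>|lebesgue_on {a..\<zeta>}. ode_mat s \<tau> *v w \<tau>) - (LINT \<tau>|lebesgue_on {a..\<zeta>}. matrix_inv P1 *v g \<tau>)"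
      by (rule Bochner_Integration.integral_diff[OF ode_mat_w(2)[OF c z] P1inv_g_integrable(2)[OF g z]])
    finally show "w \<zeta> = w a - (LINT \<tau>|lebesgue_on {a..\<zeta>}. matrix_inv P1 *v g \<tau>) + (LINT \<tau>|lebesgue_on {a..\<zeta>}. ode_mat s \<tau> *v w \<tau>)"
      by simp
  qed
qed

lemma resolvent_odeD:
  assumes g: "g \<in> X" and w: "resolvent_ode s g w"
  defines "f \<equiv> \<lambda>\<xi>. matrix_inv (H \<xi>) *v w \<xi>"
  obtains w' where "f \<in> X" "H1 UNIV a b w w'" "AE \<xi> in M. H \<xi> *v f \<xi> = w \<xi>"
    "AE \<xi> in M. s *s f \<xi> - g \<xi> = P1 *v w' \<xi> + P0 \<xi> *v (H \<xi> *v f \<xi>)"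
proof -
  have c: "continuous_on {a..b} w" using w by (simp add: resolvent_ode_def)
  define w' where "w' = (\<lambda>\<tau>. ode_mat s \<tau> *v w \<tau> - matrix_inv P1 *v g \<tau>)"
  have "f \<in> X" unfolding f_def by (intro X_Hinv L2_continuous c)
  moreover have "H1 UNIV a b w w'"
    unfolding H1_def
  proof (intro conjI ballI)
    show "w' \<in> X" unfolding w'_def by (intro L2_diff ode_mat_w(1) c X_mv g)
    fix \<zeta> assume z: "\<zeta> \<in> {a..b}"
    have "(LINT \<tau>|lebesgue_on {a..\<zeta>}. w' \<tau>) = (LINT \<tau>|lebesgue_on {a..\<zeta>}. ode_mat s \<tau> *v w \<tau>) - (LINT \<tau>|lebesgue_on {a..\<zeta>}. matrix_inv P1 *v g \<tau>)"
      unfolding w'_def by (rule Bochner_Integration.integral_diff[OF ode_mat_w(2)[OF c z] P1inv_g_integrable(2)[OF g z]])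
    moreover have "w \<zeta> = (w a - (LINT \<tau>|lebesgue_on {a..\<zeta>}. matrix_inv P1 *v g \<tau>)) + (LINT \<tau>|lebesgue_on {a..\<zeta>}. ode_mat s \<tau> *v w \<tau>)"
      using w z unfolding resolvent_ode_def by blast
    ultimately show "w \<zeta> = w a + (LINT \<tau>|lebesgue_on {a..\<zeta>}. w' \<tau>)" by simp
  qed simp
  moreover have Hf: "AE \<xi> in M. H \<xi> *v f \<xi> = w \<xi>" using Hinv unfolding f_def by eventually_elim simp
  moreover have "AE \<xi> in M. s *s f \<xi> - g \<xi> = P1 *v w' \<xi> + P0 \<xi> *v (H \<xi> *v f \<xi>)"
    using Hf
  proof eventually_elim
    case (elim \<xi>)
    have "P1 *v w' \<xi> = s *s f \<xi> - P0 \<xi> *v w \<xi> - g \<xi>"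
      by (simp add: w'_def ode_mat_mv f_def matrix_vector_mult_diff_distrib P1_cancel)
    then show ?case using elim by simp
  qed
  ultimately show thesis using that by blast
qed

lemma resolvent_ode_homogeneous: "resolvent_ode s (\<lambda>_. 0::complex^'n) (\<lambda>\<zeta>. \<Psi> s \<zeta> *v v)"
  unfolding resolvent_ode_def using \<Psi>_mv[where s=s and v=v] by (auto simp: \<Psi>_a)

lemma resolvent_ode_add:
  assumes "resolvent_ode s g w" "resolvent_ode s g' w'" "g \<in> X" "g' \<in> X"
  shows "resolvent_ode s (\<lambda>\<xi>. g \<xi> + g' \<xi>) (\<lambda>\<xi>. w \<xi> + w' \<xi>)"
  unfolding resolvent_ode_def
proof (intro conjI ballI)
  have c: "continuous_on {a..b} w" "continuous_on {a..b} w'" using assms by (simp_all add: resolvent_ode_def)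
  show "continuous_on {a..b} (\<lambda>\<xi>. w \<xi> + w' \<xi>)" by (intro continuous_on_add c)
  fix \<zeta> assume z: "\<zeta> \<in> {a..b}"
  have "w \<zeta> = (w a - (LINT \<tau>|lebesgue_on {a..\<zeta>}. matrix_inv P1 *v g \<tau>)) + (LINT \<tau>|lebesgue_on {a..\<zeta>}. ode_mat s \<tau> *v w \<tau>)"
   "w' \<zeta> = (w' a - (LINT \<tau>|lebesgue_on {a..\<zeta>}. matrix_inv P1 *v g' \<tau>)) + (LINT \<tau>|lebesgue_on {a..\<zeta>}. ode_mat s \<tau> *v w' \<tau>)"
      using assms z unfolding resolvent_ode_def by blast+
  then show "w \<zeta> + w' \<zeta> = ((w a + w' a) - (LINT \<tau>|lebesgue_on {a..\<zeta>}. matrix_inv P1 *v (g \<tau> + g' \<tau>))) + (LINT \<tau>|lebesgue_on {a..\<zeta>}. ode_mat s \<tau> *v (w \<tau> + w' \<tau>))"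
    unfolding matrix_vector_right_distrib
    using ode_mat_w(2)[OF c(1) z] ode_mat_w(2)[OF c(2) z] P1inv_g_integrable(2)[OF assms(3) z] P1inv_g_integrable(2)[OF assms(4) z]
    by simp
qed

lemma resolvent_ode_unique:
  assumes "resolvent_ode s g w" "resolvent_ode s g w'" "w a = w' a" "\<zeta> \<in> {a..b}"
  shows "w \<zeta> = w' \<zeta>"
proof -
  obtain L where "caratheodory a b L (\<lambda>\<tau> x. ode_mat s \<tau> *v x)" using vec_caratheodory .
  then interpret caratheodory a b L "\<lambda>\<tau> x. ode_mat s \<tau> *v x" .
  let ?p = "\<lambda>\<zeta>. w a - (LINT \<tau>|lebesgue_on {a..\<zeta>}. matrix_inv P1 *v g \<tau>)"
  show ?thesis
  proof (rule solution_unique[of w ?p])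
    show "w \<zeta> = ?p \<zeta> + I w \<zeta>" if "\<zeta> \<in> {a..b}" for \<zeta>
      using assms(1) that unfolding resolvent_ode_def by blast
    show "w' \<zeta> = ?p \<zeta> + I w' \<zeta>" if "\<zeta> \<in> {a..b}" for \<zeta>
      using assms(2) that unfolding resolvent_ode_def assms(3) by blast
    show "continuous_on {a..b} w" "continuous_on {a..b} w'" using assms unfolding resolvent_ode_def by blast+
  qed (rule assms)
qed

text \<open>Stability against the zero solution bounds \<open>w\<close> by the supremum of the
  forcing term, which \<open>L2_L1_bound\<close> and coercivity estimate by the energy norm of
  \<open>g\<close>. That \<open>C\<close> is independent of \<open>g\<close> will make the resolvent
  bounded.\<close>

lemma particular_solution_bound:
  obtains C where "C \<ge> 0" "\<And>g. g \<in> X \<Longrightarrow> \<exists>w. resolvent_ode s g w \<and> w a = 0 \<and> (\<forall>\<zeta>\<in>{a..b}. norm (w \<zeta>) \<le> C * nrm g)"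
proof -
  obtain L where "caratheodory a b L (\<lambda>\<tau> x. ode_mat s \<tau> *v x)" using vec_caratheodory .
  then interpret caratheodory a b L "\<lambda>\<tau> x. ode_mat s \<tau> *v x" .
  obtain K where K: "K \<ge> 0" "\<And>(A::complex^'n^'n) (x::complex^'n). norm (A *v x) \<le> norm A * norm x * K"
    using bounded_bilinear.nonneg_bounded[OF bounded_bilinear_mv] by blast
  define k where "k = norm (matrix_inv P1) * K"
  have k0: "k \<ge> 0" using K by (simp add: k_def)
  have k: "norm (matrix_inv P1 *v x) \<le> k * norm x" for x using K(2)[of "matrix_inv P1" x] by (simp add: k_def mult_ac)
  define c where "c = k * ((b - a + 1) * sqrt (2 / m0))"
  have c0: "c \<ge> 0" unfolding c_def using k0 ab m0 by simp
  define C where "C = 2 * c * exp (2 * L * (b - a))"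
  show thesis
  proof (rule that[of C])
    show "C \<ge> 0" using c0 by (simp add: C_def)
    fix g assume g: "g \<in> X"
    let ?p = "\<lambda>\<zeta>. - (LINT \<tau>|lebesgue_on {a..\<zeta>}. matrix_inv P1 *v g \<tau>)"
    have cp: "continuous_on {a..b} ?p"
      by (intro continuous_on_minus LINT_Icc_continuous P1inv_g_integrable g)
    obtain w where w: "continuous_on {a..b} w" "\<And>\<zeta>. \<zeta> \<in> {a..b} \<Longrightarrow> w \<zeta> = ?p \<zeta> + (LINT \<tau>|lebesgue_on {a..\<zeta>}. ode_mat s \<tau> *v w \<tau>)"
      using solution_exists[OF cp] by blast
    have wa: "w a = 0"
    proof -
      have "{a} \<in> null_sets lebesgue" by simp
      then have "(LINT \<tau>|lebesgue_on {a..a}. h \<tau>) = 0" for h :: "real \<Rightarrow> complex^'n"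
        using integral_eq_zero_null_sets[of "{a}"] by simp
      then show ?thesis using w(2)[of a] ab by simp
    qed
    have pb: "norm (?p \<zeta>) \<le> c * nrm g" if z: "\<zeta> \<in> {a..b}" for \<zeta>
    proof -
      have "norm (?p \<zeta>) \<le> (LINT \<tau>|lebesgue_on {a..\<zeta>}. norm (matrix_inv P1 *v g \<tau>))"
        by (simp add: integral_norm_bound)
      also have "\<dots> \<le> (LINT \<tau>|M. k * norm (g \<tau>))"
        by (rule integral_mono_lebesgue_on_AE)
          (use z k k0 L2_integrable[OF g] in \<open>auto intro!: integrable_mult_right\<close>)
      also have "\<dots> = k * (LINT \<tau>|M. norm (g \<tau>))" by simp
      also have "\<dots> \<le> k * ((b - a + 1) * (sqrt (2 / m0) * nrm g))"
      proof (rule mult_left_mono[OF _ k0])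
        have "(LINT \<tau>|M. norm (g \<tau>)) \<le> (b - a + 1) * sqrt (LINT \<xi>|M. (norm (g \<xi>))\<^sup>2)"
          by (rule L2_L1_bound) (use ab g in auto)
        also have "\<dots> \<le> (b - a + 1) * (sqrt (2 / m0) * nrm g)"
          using ab by (intro mult_left_mono nrm_ge_L2 g) auto
        finally show "(LINT \<tau>|M. norm (g \<tau>)) \<le> (b - a + 1) * (sqrt (2 / m0) * nrm g)" .
      qed
      finally show ?thesis by (simp add: c_def mult_ac)
    qed
    have "norm (w \<zeta> - 0) \<le> 2 * (c * nrm g) * exp (2 * L * (b - a))" if "\<zeta> \<in> {a..b}" for \<zeta>
      by (rule solution_stable[of w ?p "\<lambda>_. 0" "\<lambda>_. 0"]) (use w pb that in auto)
    then show "\<exists>w. resolvent_ode s g w \<and> w a = 0 \<and> (\<forall>\<zeta>\<in>{a..b}. norm (w \<zeta>) \<le> C * nrm g)"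
      using w wa by (intro exI[of _ w] conjI) (simp_all add: resolvent_ode_def C_def mult_ac)
  qed
qed

lemma variation_of_constants:
  assumes w: "resolvent_ode s g w" and p: "resolvent_ode s g p" "p a = 0" and g: "g \<in> X" and z: "\<zeta> \<in> {a..b}"
  shows "w \<zeta> = \<Psi> s \<zeta> *v w a + p \<zeta>"
proof -
  have "resolvent_ode s g (\<lambda>\<zeta>. \<Psi> s \<zeta> *v w a + p \<zeta>)"
    using resolvent_ode_add[OF resolvent_ode_homogeneous p(1) L2_zero g] by simp
  then show ?thesis by (rule resolvent_ode_unique[OF w]) (use z p in \<open>auto simp: \<Psi>_a\<close>)
qed

end

section \<open>Resolvent set and transfer function in terms of the boundary matrix\<close>

context hyperbolic_coefficients
begin

abbreviation Op :: "complex^('n + 'n)^'n \<Rightarrow> ('n state \<times> 'n state) set" where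
  "Op W \<equiv> hbcs_operator UNIV a b P1 P0 H W"

text \<open>The matrix \<open>N\<^sub>W s\<close> of the overview: it maps the initial value of a
  homogeneous solution to its boundary value.\<close>

definition bdry_mat :: "complex^('n + 'n)^'n \<Rightarrow> complex \<Rightarrow> complex^'n^'n" where
  "bdry_mat W s = W ** vblock (\<Psi> s b) (mat 1)"

lemma bdry_mat_mv: "bdry_mat W s *v v = W *v vstack (\<Psi> s b *v v) v"
  by (simp add: bdry_mat_def vblock_mult_vec flip: matrix_vector_mul_assoc)

text \<open>The number \<open>s\<close> is free: adding \<open>s f\<close> on both sides turns
  membership in the operator into the resolvent equation with right-hand side
  \<open>s f - h\<close>, for whichever \<open>s\<close> is under study.\<close>

lemma Op_iff_resolvent_ode:
  "(f, h) \<in> Op W \<longleftrightarrow> f \<in> X \<and> h \<in> X \<and> (\<exists>w. resolvent_ode s (\<lambda>\<xi>. s *s f \<xi> - h \<xi>) w \<and>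
     (AE \<xi> in M. f \<xi> = matrix_inv (H \<xi>) *v w \<xi>) \<and> W *v vstack (w b) (w a) = 0)" (is "?l \<longleftrightarrow> ?r")
proof
  assume ?l
  then obtain w w' where f: "f \<in> X" and h: "h \<in> X" and w: "H1 UNIV a b w w'" "AE \<xi> in M. H \<xi> *v f \<xi> = w \<xi>"
      "W *v vstack (w b) (w a) = 0" "AE \<xi> in M. h \<xi> = P1 *v w' \<xi> + P0 \<xi> *v (H \<xi> *v f \<xi>)"
    by (auto simp: hbcs_operator_def)
  have g: "(\<lambda>\<xi>. s *s f \<xi> - h \<xi>) \<in> X" by (intro L2_diff L2_smult f h)
  have eq: "AE \<xi> in M. s *s f \<xi> - (s *s f \<xi> - h \<xi>) = P1 *v w' \<xi> + P0 \<xi> *v (H \<xi> *v f \<xi>)"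
    using w(4) by simp
  show ?r using resolvent_odeI[OF f g w(1,2) eq] f h w(3) by blast
next
  assume ?r
  then obtain w where f: "f \<in> X" and h: "h \<in> X" and w: "resolvent_ode s (\<lambda>\<xi>. s *s f \<xi> - h \<xi>) w"
     "AE \<xi> in M. f \<xi> = matrix_inv (H \<xi>) *v w \<xi>" "W *v vstack (w b) (w a) = 0" by blast
  have g: "(\<lambda>\<xi>. s *s f \<xi> - h \<xi>) \<in> X" by (intro L2_diff L2_smult f h)
  obtain w' where w': "H1 UNIV a b w w'" "AE \<xi> in M. H \<xi> *v (matrix_inv (H \<xi>) *v w \<xi>) = w \<xi>"
    "AE \<xi> in M. s *s (matrix_inv (H \<xi>) *v w \<xi>) - (s *s f \<xi> - h \<xi>) = P1 *v w' \<xi> + P0 \<xi> *v (H \<xi> *v (matrix_inv (H \<xi>) *v w \<xi>))"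
    using resolvent_odeD[OF g w(1)] by blast
  have "AE \<xi> in M. H \<xi> *v f \<xi> = w \<xi>" using w(2) w'(2) by eventually_elim simp
  moreover have "AE \<xi> in M. h \<xi> = P1 *v w' \<xi> + P0 \<xi> *v (H \<xi> *v f \<xi>)"
    using w(2) w'(3) by eventually_elim simp
  ultimately show ?l using f h w'(1) w(3) unfolding hbcs_operator_def by blast
qed

text \<open>The homogeneous solution \<open>x\<close> with \<open>(H x) a = v\<close>; it is an
  eigenfunction when \<open>v\<close> lies in the kernel of the boundary matrix.\<close>

definition efun :: "complex \<Rightarrow> complex^'n \<Rightarrow> 'n state" where
  "efun s v = (\<lambda>\<xi>. matrix_inv (H \<xi>) *v (\<Psi> s \<xi> *v v))"

lemma efun_X: "efun s v \<in> X"
  unfolding efun_def by (intro X_Hinv L2_continuous \<Psi>_mv)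

lemma efun_add: "efun s (v + v') \<xi> = efun s v \<xi> + efun s v' \<xi>"
  by (simp add: efun_def matrix_vector_right_distrib)

lemma efun_scaleR: "efun s (r *\<^sub>R v) \<xi> = r *\<^sub>R efun s v \<xi>"
  by (simp add: efun_def mv_scaleR)

lemma efun_eigen: "bdry_mat W s *v v = 0 \<Longrightarrow> (efun s v, \<lambda>\<xi>. s *s efun s v \<xi>) \<in> Op W"
  unfolding Op_iff_resolvent_ode[of _ _ W s]
  using resolvent_ode_homogeneous[of s v] efun_X[of s v] L2_smult[OF efun_X[of s v]]
  by (auto simp: bdry_mat_mv efun_def \<Psi>_a intro!: exI[of _ "\<lambda>\<zeta>. \<Psi> s \<zeta> *v v"])

lemma homogeneous_solution:
  assumes "resolvent_ode s (\<lambda>_. 0) w" "\<zeta> \<in> {a..b}"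
  shows "w \<zeta> = \<Psi> s \<zeta> *v w a"
  by (rule resolvent_ode_unique[OF assms(1) resolvent_ode_homogeneous _ assms(2)]) (simp add: \<Psi>_a)

lemma AE_M_I: "(\<And>\<xi>. \<xi> \<in> {a..b} \<Longrightarrow> P \<xi>) \<Longrightarrow> AE \<xi> in M. P \<xi>"
  by (rule AE_I2) simp

lemma eigen_efun:
  assumes "(f, \<lambda>\<xi>. s *s f \<xi>) \<in> Op W"
  obtains v where "bdry_mat W s *v v = 0" "AE \<xi> in M. f \<xi> = efun s v \<xi>"
proof -
  obtain w where w: "resolvent_ode s (\<lambda>\<xi>. 0) w" "AE \<xi> in M. f \<xi> = matrix_inv (H \<xi>) *v w \<xi>"
    "W *v vstack (w b) (w a) = 0"
    using assms unfolding Op_iff_resolvent_ode[of _ _ W s] by auto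
  note eq = homogeneous_solution[OF w(1)]
  have "bdry_mat W s *v w a = 0" using w(3) eq[of b] ab by (simp add: bdry_mat_mv)
  moreover have "AE \<xi> in M. w \<xi> = \<Psi> s \<xi> *v w a" by (intro AE_M_I eq)
  with w(2) have "AE \<xi> in M. f \<xi> = efun s (w a) \<xi>" by eventually_elim (simp add: efun_def)
  ultimately show thesis using that by blast
qed

text \<open>Quantitative injectivity of \<open>v \<mapsto> efun s v\<close>. Near \<open>a\<close>
  the fundamental solution is close to the identity, so \<open>\<Psi> s x *v v\<close> keeps half
  the length of \<open>v\<close> on a short interval, whose energy alone suffices.\<close>

lemma efun_lower_bound: obtains c where "c > 0" "\<And>v. c * norm v \<le> nrm (efun s v)"
proof -
  obtain K where K: "K > 0" "\<And>(A::complex^'n^'n) (x::complex^'n). norm (A *v x) \<le> norm A * norm x * K"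
    using bounded_bilinear.pos_bounded[OF bounded_bilinear_mv] by blast
  have "continuous_on {a..b} (\<Psi> s)" by (rule \<Psi>)
  then obtain d where d: "d > 0" "\<And>x. x \<in> {a..b} \<Longrightarrow> dist x a < d \<Longrightarrow> dist (\<Psi> s x) (\<Psi> s a) < 1 / (2 * K)"
    unfolding continuous_on_iff using ab K(1) by (metis atLeastAtMost_iff less_eq_real_def zero_less_divide_1_iff zero_less_mult_iff zero_less_numeral)
  define \<delta> where "\<delta> = min (d / 2) (b - a)"
  have \<delta>: "\<delta> > 0" "\<delta> < d" "a + \<delta> \<le> b" using d(1) ab by (auto simp: \<delta>_def)
  have low: "norm v / 2 \<le> norm (\<Psi> s x *v v)" if "x \<in> {a..a+\<delta>}" for x v
  proof -
    have "norm (\<Psi> s x - mat 1) \<le> 1 / (2 * K)"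
      using d(2)[of x] that \<delta> by (auto simp: \<Psi>_a dist_norm)
    then have "norm (\<Psi> s x - mat 1) * norm v * K \<le> 1 / (2 * K) * norm v * K"
      using K(1) by (intro mult_right_mono) auto
    then have "norm ((\<Psi> s x - mat 1) *v v) \<le> norm v / 2"
      using K(2)[of "\<Psi> s x - mat 1" v] K(1) by simp
    then have "norm (\<Psi> s x *v v - v) \<le> norm v / 2" by (simp add: matrix_vector_mult_diff_rdistrib)
    then show ?thesis using norm_triangle_ineq2[of v "\<Psi> s x *v v"] by (simp add: norm_minus_commute)
  qed
  \<comment> \<open>On an interval of length \<open>\<delta>\<close> the function has norm at least
    \<open>norm v / (2 * C0)\<close>, and coercivity weights this with
    \<open>m0 / 2\<close>.\<close>
  define c where "c = sqrt (m0 / 2 * \<delta>) / (2 * C0)"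
  have "c > 0" using m0 \<delta> C0 by (simp add: c_def)
  moreover have "c * norm v \<le> nrm (efun s v)" for v
  proof (rule power2_le_imp_le)
    let ?B = "(norm v / (2 * C0))\<^sup>2"
    have "\<delta> * ?B = (LINT \<xi>|lebesgue_on {a..a+\<delta>}. ?B)"
      using \<delta> by (simp add: measure_restrict_space)
    also have "\<dots> \<le> (LINT \<xi>|M. (norm (efun s v \<xi>))\<^sup>2)"
    proof (rule integral_mono_lebesgue_on_AE)
      have "AE \<xi> in M. \<xi> \<in> {a..a+\<delta>} \<longrightarrow> ?B \<le> (norm (efun s v \<xi>))\<^sup>2"
        using coeff_bounds Hinv
      proof eventually_elim
        case (elim \<xi>)
        show ?case
        proof
          assume x: "\<xi> \<in> {a..a+\<delta>}"
          have "\<Psi> s \<xi> *v v = H \<xi> *v efun s v \<xi>" using elim by (simp add: efun_def)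
          then have "norm v / 2 \<le> C0 * norm (efun s v \<xi>)" using low[OF x, of v] elim by (metis order_trans)
          then have "norm v / (2 * C0) \<le> norm (efun s v \<xi>)" using C0 by (simp add: field_simps)
          then show "?B \<le> (norm (efun s v \<xi>))\<^sup>2" using C0 by (intro power_mono) auto
        qed
      qed
      then have "AE \<xi> in lebesgue_on {a..a+\<delta>}. \<xi> \<in> {a..a+\<delta>} \<longrightarrow> ?B \<le> (norm (efun s v \<xi>))\<^sup>2"
        by (rule AE_lebesgue_on_subset) (use \<delta> in auto)
      moreover have "AE \<xi> in lebesgue_on {a..a+\<delta>}. \<xi> \<in> {a..a+\<delta>}"
        using AE_space[of "lebesgue_on {a..a+\<delta>}"] by simp
      ultimately show "AE \<xi> in lebesgue_on {a..a+\<delta>}. ?B \<le> (norm (efun s v \<xi>))\<^sup>2"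
        by eventually_elim blast
    qed (use \<delta> efun_X[of s v] in \<open>auto simp: L2_UNIV_iff\<close>)
    finally have "m0 / 2 * (\<delta> * ?B) \<le> m0 / 2 * (LINT \<xi>|M. (norm (efun s v \<xi>))\<^sup>2)" using m0 by simp
    also have "\<dots> \<le> (nrm (efun s v))\<^sup>2" unfolding nrm_sq[OF efun_X] by (rule energy_lower[OF efun_X])
    also have "m0 / 2 * (\<delta> * ?B) = (c * norm v)\<^sup>2"
      using m0 \<delta> by (simp add: c_def power_mult_distrib power_divide)
    finally show "(c * norm v)\<^sup>2 \<le> (nrm (efun s v))\<^sup>2" .
  qed (rule nrm_nonneg[OF efun_X])
  ultimately show thesis using that by blast
qed

lemma invertible_iff_ker:
  fixes A :: "complex^'n^'n"
  shows "invertible A \<longleftrightarrow> (\<forall>v. A *v v = 0 \<longrightarrow> v = 0)"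
  using invertible_left_inverse[of A] matrix_left_invertible_ker[of A] by blast

text \<open>On the eigenfunction of a kernel vector the resolvent estimate has right-hand side
  0.\<close>

lemma resolvent_set_imp_invertible:
  assumes "s \<in> resolvent_set X nrm (Op W)"
  shows "invertible (bdry_mat W s)"
  unfolding invertible_iff_ker
proof (intro allI impI)
  fix v assume v: "bdry_mat W s *v v = 0"
  obtain C where C: "\<forall>(f, h)\<in>Op W. nrm f \<le> C * nrm (\<lambda>\<xi>. s *s f \<xi> - h \<xi>)"
    using assms unfolding resolvent_set_def by blast
  obtain c where c: "c > 0" "c * norm v \<le> nrm (efun s v)" using efun_lower_bound by metis
  have "nrm (efun s v) \<le> C * nrm (\<lambda>\<xi>. s *s efun s v \<xi> - s *s efun s v \<xi>)"
    using C efun_eigen[OF v] by fast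
  then have "c * norm v \<le> 0" using c by (simp add: nrm_zero)
  then show "v = 0" using c(1) by (simp add: mult_le_0_iff)
qed

text \<open>With \<open>w = \<Psi> v + p\<close> and \<open>p a = 0\<close>, the boundary condition
  becomes a linear system for \<open>v\<close> with matrix \<open>bdry_mat W s\<close>. Its unique
  solution gives surjectivity, and the estimates for \<open>v\<close> and \<open>p\<close> bound the
  inverse.\<close>

lemma invertible_imp_resolvent_set:
  assumes inv: "invertible (bdry_mat W s)"
  shows "s \<in> resolvent_set X nrm (Op W)"
proof -
  obtain Cp where Cp: "Cp \<ge> 0"
    "\<And>g. g \<in> X \<Longrightarrow> \<exists>w. resolvent_ode s g w \<and> w a = 0 \<and> (\<forall>\<zeta>\<in>{a..b}. norm (w \<zeta>) \<le> Cp * nrm g)"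
    using particular_solution_bound by metis
  obtain K where K: "K > 0" "\<And>(A::complex^'n^'n) (x::complex^'n). norm (A *v x) \<le> norm A * norm x * K"
    using bounded_bilinear.pos_bounded[OF bounded_bilinear_mv] by blast
  obtain K' where K': "K' > 0" "\<And>(A::complex^('n+'n)^'n) (x::complex^('n+'n)). norm (A *v x) \<le> norm A * norm x * K'"
    using bounded_bilinear.pos_bounded[OF bounded_bilinear_mv] by blast
  have vs: "norm (vstack x (0::complex^'n)) = norm x" for x :: "complex^'n"
    by (simp add: norm_vec_def L2_set_def sum_UNIV_Plus vstack_def)
  have key: "W *v vstack (w b) (w a) = 0 \<longleftrightarrow> w a = - (matrix_inv (bdry_mat W s) *v (W *v vstack (p b) 0))"
    if "\<And>\<zeta>. \<zeta> \<in> {a..b} \<Longrightarrow> w \<zeta> = \<Psi> s \<zeta> *v w a + p \<zeta>" "p a = 0" for w p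
  proof -
    have "w b = \<Psi> s b *v w a + p b" by (rule that(1)) (use ab in simp)
    then have "vstack (w b) (w a) = vstack (\<Psi> s b *v w a) (w a) + vstack (p b) 0"
      by (simp flip: vstack_add)
    then have "W *v vstack (w b) (w a) = bdry_mat W s *v w a + W *v vstack (p b) 0"
      by (simp add: bdry_mat_mv matrix_vector_right_distrib)
    moreover have "bdry_mat W s *v w a + y = 0 \<longleftrightarrow> w a = - (matrix_inv (bdry_mat W s) *v y)" for y
    proof
      assume "bdry_mat W s *v w a + y = 0"
      then have "y = - (bdry_mat W s *v w a)" by (simp add: add_eq_0_iff)
      then show "w a = - (matrix_inv (bdry_mat W s) *v y)"
        by (simp add: bounded_bilinear.minus_right[OF bounded_bilinear_mv] matrix_inv_mv_cancel[OF inv])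
    next
      assume "w a = - (matrix_inv (bdry_mat W s) *v y)"
      then show "bdry_mat W s *v w a + y = 0"
        by (simp add: bounded_bilinear.minus_right[OF bounded_bilinear_mv] matrix_inv_mv_cancel[OF inv])
    qed
    ultimately show ?thesis by metis
  qed
  have surj: "\<exists>(f, h)\<in>Op W. nrm (\<lambda>\<xi>. (s *s f \<xi> - h \<xi>) - g \<xi>) = 0" if g: "g \<in> X" for g
  proof -
    obtain p where p: "resolvent_ode s g p" "p a = 0" using Cp(2)[OF g] by blast
    define v where "v = - (matrix_inv (bdry_mat W s) *v (W *v vstack (p b) 0))"
    define w where "w = (\<lambda>\<zeta>. \<Psi> s \<zeta> *v v + p \<zeta>)"
    have wa: "w a = v" by (simp add: w_def \<Psi>_a p)
    have w: "resolvent_ode s g w"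
      using resolvent_ode_add[OF resolvent_ode_homogeneous p(1) L2_zero g] by (simp add: w_def)
    have eq: "w \<zeta> = \<Psi> s \<zeta> *v w a + p \<zeta>" for \<zeta> unfolding wa by (simp add: w_def)
    have "W *v vstack (w b) (w a) = 0"
      using key[of w p, OF eq p(2)] wa unfolding v_def by blast
    moreover define f where "f = (\<lambda>\<xi>. matrix_inv (H \<xi>) *v w \<xi>)"
    moreover have f: "f \<in> X" unfolding f_def using w by (intro X_Hinv L2_continuous) (simp add: resolvent_ode_def)
    moreover define h where "h = (\<lambda>\<xi>. s *s f \<xi> - g \<xi>)"
    moreover have "h \<in> X" unfolding h_def by (intro L2_diff L2_smult f g)
    moreover have "(\<lambda>\<xi>. s *s f \<xi> - h \<xi>) = g" by (simp add: h_def)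
    ultimately have "(f, h) \<in> Op W" using w unfolding Op_iff_resolvent_ode[of _ _ W s] by auto
    moreover have "nrm (\<lambda>\<xi>. (s *s f \<xi> - h \<xi>) - g \<xi>) = 0" by (simp add: h_def nrm_zero)
    ultimately show ?thesis by blast
  qed
  obtain Cw where Cw: "Cw \<ge> 0" "\<And>x. x \<in> {a..b} \<Longrightarrow> norm (\<Psi> s x) \<le> Cw"
    using continuous_bounded_Icc[OF \<Psi>(1)] by metis
  define Ca where "Ca = norm (matrix_inv (bdry_mat W s)) * (norm W * Cp * K') * K"
  have Ca: "Ca \<ge> 0" unfolding Ca_def using Cp K K' by simp
  \<comment> \<open>The supremum bound on \<open>w\<close>, divided by \<open>m0\<close> for the
    inverse of \<open>H\<close>, times the factor of \<open>nrm_le_bound\<close>.\<close>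
  define C where "C = sqrt (C0 / 2 * (b - a)) * ((Cw * Ca * K + Cp) / m0)"
  have bound: "nrm f \<le> C * nrm (\<lambda>\<xi>. s *s f \<xi> - h \<xi>)" if fh: "(f, h) \<in> Op W" for f h
  proof -
    let ?g = "\<lambda>\<xi>. s *s f \<xi> - h \<xi>"
    obtain w where f: "f \<in> X" and h: "h \<in> X" and w: "resolvent_ode s ?g w"
      "AE \<xi> in M. f \<xi> = matrix_inv (H \<xi>) *v w \<xi>" "W *v vstack (w b) (w a) = 0"
      using fh unfolding Op_iff_resolvent_ode[of _ _ W s] by blast
    have g: "?g \<in> X" by (intro L2_diff L2_smult f h)
    define G where "G = nrm ?g"
    have G0: "G \<ge> 0" unfolding G_def by (rule nrm_nonneg[OF g])
    obtain p where p: "resolvent_ode s ?g p" "p a = 0" "\<forall>\<zeta>\<in>{a..b}. norm (p \<zeta>) \<le> Cp * G"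
      using Cp(2)[OF g] unfolding G_def by blast
    have wp: "w \<zeta> = \<Psi> s \<zeta> *v w a + p \<zeta>" if "\<zeta> \<in> {a..b}" for \<zeta>
      by (rule variation_of_constants[OF w(1) p(1,2) g that])
    have wa: "norm (w a) \<le> Ca * G"
    proof -
      let ?y = "W *v vstack (p b) 0"
      have "norm ?y \<le> norm W * norm (p b) * K'" using K'(2)[of W "vstack (p b) 0"] by (simp add: vs)
      also have "\<dots> \<le> norm W * (Cp * G) * K'" using p(3) ab K' by (intro mult_right_mono mult_left_mono) auto
      finally have y: "norm ?y \<le> norm W * (Cp * G) * K'" .
      have "norm (w a) = norm (matrix_inv (bdry_mat W s) *v ?y)" using key[of w p] wp p(2) w(3) by (metis norm_minus_cancel)
      also have "\<dots> \<le> norm (matrix_inv (bdry_mat W s)) * norm ?y * K" by (rule K(2))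
      also have "\<dots> \<le> norm (matrix_inv (bdry_mat W s)) * (norm W * (Cp * G) * K') * K"
        using y K by (intro mult_right_mono mult_left_mono) auto
      finally show ?thesis by (simp add: Ca_def mult_ac)
    qed
    have wb: "norm (w \<zeta>) \<le> (Cw * Ca * K + Cp) * G" if z: "\<zeta> \<in> {a..b}" for \<zeta>
    proof -
      have "norm (w \<zeta>) \<le> norm (\<Psi> s \<zeta> *v w a) + norm (p \<zeta>)" unfolding wp[OF z] by (rule norm_triangle_ineq)
      also have "\<dots> \<le> Cw * (Ca * G) * K + Cp * G"
      proof (rule add_mono)
        have "norm (\<Psi> s \<zeta> *v w a) \<le> norm (\<Psi> s \<zeta>) * norm (w a) * K" by (rule K(2))
        also have "\<dots> \<le> Cw * (Ca * G) * K" using Cw(2)[OF z] wa K Cw(1) by (intro mult_right_mono mult_mono) auto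
        finally show "norm (\<Psi> s \<zeta> *v w a) \<le> Cw * (Ca * G) * K" .
      qed (use p z in auto)
      finally show ?thesis by (simp add: algebra_simps)
    qed
    have "AE \<xi> in M. norm (w \<xi>) \<le> (Cw * Ca * K + Cp) * G" by (intro AE_M_I wb)
    with w(2) Hinv have "AE \<xi> in M. norm (f \<xi>) \<le> (Cw * Ca * K + Cp) * G / m0"
    proof eventually_elim
      case (elim \<xi>)
      have "norm (f \<xi>) \<le> norm (w \<xi>) / m0" using elim by metis
      also have "\<dots> \<le> (Cw * Ca * K + Cp) * G / m0" using elim m0 by (intro divide_right_mono) auto
      finally show ?case .
    qed
    then have "nrm f \<le> sqrt (C0 / 2 * (b - a)) * ((Cw * Ca * K + Cp) * G / m0)"
      by (intro nrm_le_bound f) (use Cw Ca K Cp G0 m0 in auto)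
    then show ?thesis by (simp add: C_def G_def)
  qed
  show ?thesis unfolding resolvent_set_def using surj bound by blast
qed

lemma bvp_solution_iff:
  "bvp_solution a b P1 P0 H W s u f w \<longleftrightarrow> f \<in> X \<and> resolvent_ode s (\<lambda>_. 0) w \<and>
     (AE \<xi> in M. f \<xi> = matrix_inv (H \<xi>) *v w \<xi>) \<and> u = W *v vstack (w b) (w a)" (is "?l \<longleftrightarrow> ?r")
proof
  assume ?l
  then obtain w' where f: "f \<in> X" and w: "H1 UNIV a b w w'" "AE \<xi> in M. H \<xi> *v f \<xi> = w \<xi>"
    and eq: "AE \<xi> in M. s *s f \<xi> - 0 = P1 *v w' \<xi> + P0 \<xi> *v (H \<xi> *v f \<xi>)" and u: "u = W *v vstack (w b) (w a)"
    by (auto simp: bvp_solution_def)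
  show ?r using resolvent_odeI[OF f L2_zero w eq] f u by blast
next
  assume r: ?r
  then obtain w' where w': "H1 UNIV a b w w'" "AE \<xi> in M. H \<xi> *v (matrix_inv (H \<xi>) *v w \<xi>) = w \<xi>"
    "AE \<xi> in M. s *s (matrix_inv (H \<xi>) *v w \<xi>) - 0 = P1 *v w' \<xi> + P0 \<xi> *v (H \<xi> *v (matrix_inv (H \<xi>) *v w \<xi>))"
    using resolvent_odeD[OF L2_zero] by blast
  have r2: "AE \<xi> in M. f \<xi> = matrix_inv (H \<xi>) *v w \<xi>" using r by blast
  have "AE \<xi> in M. H \<xi> *v f \<xi> = w \<xi>" using r2 w'(2) by eventually_elim simp
  moreover have "AE \<xi> in M. s *s f \<xi> = P1 *v w' \<xi> + P0 \<xi> *v (H \<xi> *v f \<xi>)"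
    using r2 w'(3) by eventually_elim simp
  ultimately show ?l using r w'(1) unfolding bvp_solution_def by blast
qed

text \<open>The input determines the initial value by inverting the boundary matrix. To evaluate the
  \<open>THE\<close>, the representative \<open>w\<close> has to be unique as well as
  \<open>f\<close>, since a competing \<open>G'\<close> comes with its own witnesses and is read off
  from their boundary values.\<close>

lemma transfer_function_eq:
  assumes inv: "invertible (bdry_mat W s)"
  shows "transfer_function a b P1 P0 H W WC s = WC ** vblock (\<Psi> s b) (mat 1) ** matrix_inv (bdry_mat W s)"
proof -
  let ?G = "WC ** vblock (\<Psi> s b) (mat 1) ** matrix_inv (bdry_mat W s)"
  define e where "e u = matrix_inv (bdry_mat W s) *v u" for u
  have sol: "bvp_solution a b P1 P0 H W s u (efun s (e u)) (\<lambda>\<zeta>. \<Psi> s \<zeta> *v e u)" for u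
    unfolding bvp_solution_iff
    by (auto simp: efun_X resolvent_ode_homogeneous efun_def[of s "e u", symmetric] \<Psi>_a bdry_mat_mv[symmetric])
      (auto simp: efun_def e_def matrix_inv_mv_cancel[OF inv])
  have unique: "w a = e u \<and> (\<forall>\<zeta>\<in>{a..b}. w \<zeta> = \<Psi> s \<zeta> *v e u) \<and> (AE \<xi> in M. f \<xi> = efun s (e u) \<xi>)"
    if "bvp_solution a b P1 P0 H W s u f w" for u f w
  proof -
    have w: "resolvent_ode s (\<lambda>_. 0) w" "AE \<xi> in M. f \<xi> = matrix_inv (H \<xi>) *v w \<xi>" "u = W *v vstack (w b) (w a)"
      using that unfolding bvp_solution_iff by blast+
    note eq = homogeneous_solution[OF w(1)]
    have "u = bdry_mat W s *v w a" using w(3) eq[of b] ab by (simp add: bdry_mat_mv)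
    then have wa: "w a = e u" by (simp add: e_def matrix_inv_mv_cancel[OF inv])
    have "AE \<xi> in M. w \<xi> = \<Psi> s \<xi> *v e u" by (intro AE_M_I) (use eq wa in simp)
    with w(2) have "AE \<xi> in M. f \<xi> = efun s (e u) \<xi>" by eventually_elim (simp add: efun_def)
    then show ?thesis using wa eq by simp
  qed
  have G: "?G *v u = WC *v vstack (\<Psi> s b *v e u) (\<Psi> s a *v e u)" for u
    by (simp add: \<Psi>_a e_def vblock_mult_vec flip: matrix_vector_mul_assoc)
  show ?thesis unfolding transfer_function_def
  proof (rule the_equality)
    show "\<forall>u0. \<exists>f w. bvp_solution a b P1 P0 H W s u0 f w \<and>
      (\<forall>f' w'. bvp_solution a b P1 P0 H W s u0 f' w' \<longrightarrow> (AE \<xi> in M. f' \<xi> = f \<xi>)) \<and>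
      ?G *v u0 = WC *v vstack (w b) (w a)"
    proof
      fix u
      show "\<exists>f w. bvp_solution a b P1 P0 H W s u f w \<and>
      (\<forall>f' w'. bvp_solution a b P1 P0 H W s u f' w' \<longrightarrow> (AE \<xi> in M. f' \<xi> = f \<xi>)) \<and>
      ?G *v u = WC *v vstack (w b) (w a)"
        by (rule exI[of _ "efun s (e u)"], rule exI[of _ "\<lambda>\<zeta>. \<Psi> s \<zeta> *v e u"])
          (use sol unique G in blast)
    qed
    fix G' assume G': "\<forall>u0. \<exists>f w. bvp_solution a b P1 P0 H W s u0 f w \<and>
      (\<forall>f' w'. bvp_solution a b P1 P0 H W s u0 f' w' \<longrightarrow> (AE \<xi> in M. f' \<xi> = f \<xi>)) \<and>
      G' *v u0 = WC *v vstack (w b) (w a)"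
    have "G' *v u = ?G *v u" for u
    proof -
      obtain f w where fw: "bvp_solution a b P1 P0 H W s u f w" "G' *v u = WC *v vstack (w b) (w a)" using G' by blast
      have "w b = \<Psi> s b *v e u" "w a = \<Psi> s a *v e u" using unique[OF fw(1)] ab by auto
      then show ?thesis using fw(2) G by simp
    qed
    then show "G' = ?G" by (intro Fmat_Reals_eqI) blast
  qed
qed

end

section \<open>Eigenvalues of a generator\<close>

text \<open>A semigroup over the complex scalars; for the real field it will be the complexified
  one.\<close>

locale semigroup_hyperbolic = hyperbolic_coefficients +
  fixes T :: "real \<Rightarrow> 'a state \<Rightarrow> 'a state" and W :: "complex^('a + 'a)^'a"
  assumes T: "C0_semigroup UNIV X nrm T" and gen: "generator X nrm T = Op W"
begin

lemma TX: "t \<ge> 0 \<Longrightarrow> f \<in> X \<Longrightarrow> T t f \<in> X"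
  using T unfolding C0_semigroup_def by blast

lemma T_lin:
  assumes "t \<ge> 0" "f \<in> X" "g \<in> X"
  shows "AE \<xi> in M. T t (\<lambda>\<eta>. c *s f \<eta> + d *s g \<eta>) \<xi> = c *s T t f \<xi> + d *s T t g \<xi>"
proof -
  have "nrm (\<lambda>\<xi>. T t (\<lambda>\<eta>. c *s f \<eta> + d *s g \<eta>) \<xi> - (c *s T t f \<xi> + d *s T t g \<xi>)) = 0"
    using T assms unfolding C0_semigroup_def by blast
  then show ?thesis
    by (subst (asm) nrm_eq_0_iff) (use assms in \<open>auto intro!: L2_diff L2_add L2_smult TX\<close>)
qed

lemma T_bounded: "t \<ge> 0 \<Longrightarrow> \<exists>C\<ge>0. \<forall>f\<in>X. nrm (T t f) \<le> C * nrm f"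
proof -
  assume "t \<ge> 0"
  then obtain C where C: "\<forall>f\<in>X. nrm (T t f) \<le> C * nrm f"
    using T[unfolded C0_semigroup_def, THEN conjunct2, THEN conjunct2, THEN conjunct1] by blast
  have "nrm (T t f) \<le> max C 0 * nrm f" if "f \<in> X" for f
  proof -
    have "nrm (T t f) \<le> C * nrm f" using C that by blast
    also have "\<dots> \<le> max C 0 * nrm f" by (intro mult_right_mono nrm_nonneg that) auto
    finally show ?thesis .
  qed
  then show ?thesis by (intro exI[of _ "max C 0"]) auto
qed

text \<open>\<open>T t\<close> acts on functions, not on classes; linearity and boundedness make it
  respect equality almost everywhere.\<close>

lemma T_cong:
  assumes t: "t \<ge> 0" and f: "f \<in> X" and g: "g \<in> X" and ae: "AE \<xi> in M. f \<xi> = g \<xi>"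
  shows "AE \<xi> in M. T t f \<xi> = T t g \<xi>"
proof -
  let ?d = "\<lambda>\<eta>. 1 *s f \<eta> + (-1) *s g \<eta>"
  have d: "?d \<in> X" by (intro L2_add L2_smult f g)
  have "AE \<xi> in M. ?d \<xi> = 0" using ae by eventually_elim (simp add: vec_eq_iff)
  then have "nrm ?d = 0" using nrm_eq_0_iff[OF d] by blast
  then have "nrm (T t ?d) \<le> 0" using T_bounded[OF t] d by (metis mult_zero_right)
  then have "AE \<xi> in M. T t ?d \<xi> = 0" using nrm_nonneg[OF TX[OF t d]] nrm_eq_0_iff[OF TX[OF t d]] by simp
  with T_lin[OF t f g, of 1 "-1"] show ?thesis by eventually_elim (simp add: vec_eq_iff)
qed

lemma T_semi:
  assumes "t \<ge> 0" "r \<ge> 0" "f \<in> X"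
  shows "AE \<xi> in M. T (t + r) f \<xi> = T t (T r f) \<xi>"
proof -
  have "nrm (\<lambda>\<xi>. T (t + r) f \<xi> - T t (T r f) \<xi>) = 0"
    using T assms unfolding C0_semigroup_def by blast
  then show ?thesis
    by (subst (asm) nrm_eq_0_iff) (use assms in \<open>auto intro!: L2_diff TX\<close>)
qed

lemma T_0:
  assumes "f \<in> X" shows "AE \<xi> in M. T 0 f \<xi> = f \<xi>"
proof -
  have "nrm (\<lambda>\<xi>. T 0 f \<xi> - f \<xi>) = 0"
    using T assms unfolding C0_semigroup_def by blast
  then show ?thesis
    by (subst (asm) nrm_eq_0_iff) (use assms in \<open>auto intro!: L2_diff TX\<close>)
qed

text \<open>How far the difference quotient at step \<open>h\<close> is from \<open>s f\<close>;
  eigenvectors are the states for which it tends to 0.\<close>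

definition gen_defect :: "complex \<Rightarrow> real \<Rightarrow> 'a state \<Rightarrow> 'a state" where
  "gen_defect s h f = (\<lambda>\<xi>. (1/h) *\<^sub>R (T h f \<xi> - f \<xi>) - s *s f \<xi>)"

lemma gen_defect_X: "h \<ge> 0 \<Longrightarrow> f \<in> X \<Longrightarrow> gen_defect s h f \<in> X"
  unfolding gen_defect_def by (intro L2_diff L2_scaleR L2_smult TX)

definition eigen :: "complex \<Rightarrow> 'a state \<Rightarrow> bool" where
  "eigen s f \<longleftrightarrow> (f, \<lambda>\<xi>. s *s f \<xi>) \<in> Op W"

lemma eigen_iff: "eigen s f \<longleftrightarrow> f \<in> X \<and> ((\<lambda>h. nrm (gen_defect s h f)) \<longlongrightarrow> 0) (at_right 0)"
  unfolding eigen_def gen[symmetric] generator_def gen_defect_def using L2_smult[of f a b s] by auto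

text \<open>\<open>T t\<close> is linear and commutes with \<open>T h\<close>, so the defect of
  \<open>T t f\<close> is the image of the defect of \<open>f\<close>, and boundedness preserves the
  limit.\<close>

lemma eigen_invariant:
  assumes f: "eigen s f" and t: "t \<ge> 0"
  shows "eigen s (T t f)"
proof -
  have fX: "f \<in> X" and lim: "((\<lambda>h. nrm (gen_defect s h f)) \<longlongrightarrow> 0) (at_right 0)" using f by (auto simp: eigen_iff)
  note TfX = TX[OF t fX]
  obtain C where C: "\<forall>f\<in>X. nrm (T t f) \<le> C * nrm f" using T_bounded[OF t] by blast
  have le: "nrm (gen_defect s h (T t f)) \<le> C * nrm (gen_defect s h f)" if h: "h > 0" for h
  proof -
    have h0: "h \<ge> 0" using h by simp
    note ThX = TX[OF h0 fX]
    let ?k = "complex_of_real (1 / h)"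
    let ?q = "\<lambda>\<eta>. ?k *s T h f \<eta> + (- ?k) *s f \<eta>"
    have q: "?q \<in> X" by (intro L2_add L2_smult ThX fX)
    \<comment> \<open>\<open>T_lin\<close> speaks of combinations of two terms, so the defect is
      written as two nested ones.\<close>
    have D: "gen_defect s h f = (\<lambda>\<eta>. 1 *s ?q \<eta> + (- s) *s f \<eta>)"
      unfolding gen_defect_def complex_scaleR_eq[symmetric] by (rule ext) (simp add: vec_eq_iff algebra_simps)
    have "AE \<xi> in M. T h (T t f) \<xi> = T t (T h f) \<xi>"
      using T_semi[OF h0 t fX] T_semi[OF t h0 fX] by eventually_elim (metis add.commute)
    with T_lin[OF t q fX, of 1 "- s"] T_lin[OF t ThX fX, of ?k "- ?k"]
    have "AE \<xi> in M. T t (gen_defect s h f) \<xi> = gen_defect s h (T t f) \<xi>"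
    proof eventually_elim
      case (elim \<xi>)
      have "T t (gen_defect s h f) \<xi> = 1 *s (?k *s T t (T h f) \<xi> + (- ?k) *s T t f \<xi>) + (- s) *s T t f \<xi>"
        unfolding D using elim(1,2) by simp
      also have "\<dots> = gen_defect s h (T t f) \<xi>"
        unfolding gen_defect_def complex_scaleR_eq[symmetric] elim(3) by (simp add: vec_eq_iff algebra_simps)
      finally show ?case .
    qed
    then have "nrm (gen_defect s h (T t f)) = nrm (T t (gen_defect s h f))"
      using nrm_cong[OF TX[OF t gen_defect_X[OF h0 fX]]] by simp
    then show ?thesis using C gen_defect_X[OF h0 fX] by simp
  qed
  have "((\<lambda>h. nrm (gen_defect s h (T t f))) \<longlongrightarrow> 0) (at_right 0)"
  proof (rule tendsto_sandwich[of "\<lambda>_. 0" _ _ "\<lambda>h. C * nrm (gen_defect s h f)"])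
    show "\<forall>\<^sub>F h in at_right 0. 0 \<le> nrm (gen_defect s h (T t f))"
      using eventually_at_right_less[of "0::real"] by eventually_elim (simp add: nrm_nonneg gen_defect_X TfX)
    show "\<forall>\<^sub>F h in at_right 0. nrm (gen_defect s h (T t f)) \<le> C * nrm (gen_defect s h f)"
      using eventually_at_right_less[of "0::real"] by eventually_elim (simp add: le)
    show "((\<lambda>h. C * nrm (gen_defect s h f)) \<longlongrightarrow> 0) (at_right 0)" using tendsto_mult_right_zero[OF lim] .
  qed simp
  then show ?thesis using TfX by (simp add: eigen_iff)
qed

lemma gen_defect_cong:
  assumes h: "h \<ge> 0" and f: "f \<in> X" and g: "g \<in> X" and ae: "AE \<xi> in M. f \<xi> = g \<xi>"
  shows "nrm (gen_defect s h f) = nrm (gen_defect s h g)"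
proof (rule nrm_cong[OF gen_defect_X[OF h f]])
  show "AE \<xi> in M. gen_defect s h f \<xi> = gen_defect s h g \<xi>"
    using T_cong[OF h f g ae] ae by eventually_elim (simp add: gen_defect_def)
qed

text \<open>Reduces the defect on the eigenspace to that of finitely many basis vectors. The empty
  sum needs an argument of its own: that \<open>T h\<close> kills the zero state follows from
  linearity with zero coefficients, and only almost everywhere.\<close>

lemma gen_defect_sum:
  assumes h: "h > 0" and "finite B"
  shows "nrm (gen_defect s h (efun s (\<Sum>v\<in>B. r v *\<^sub>R v))) \<le> (\<Sum>v\<in>B. \<bar>r v\<bar> * nrm (gen_defect s h (efun s v)))"
  using assms(2)
proof (induction B rule: finite_induct)
  case empty
  have h0: "h \<ge> 0" using h by simp
  have e0: "efun s 0 = (\<lambda>\<xi>. 0 *s efun s 0 \<xi> + 0 *s efun s 0 \<xi>)" by (rule ext) (simp add: efun_def vec_eq_iff)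
  have "AE \<xi> in M. T h (efun s 0) \<xi> = 0"
    using T_lin[OF h0 efun_X[of s 0] efun_X[of s 0], where c=0 and d=0] unfolding e0[symmetric] by simp
  then have "AE \<xi> in M. gen_defect s h (efun s 0) \<xi> = 0" by eventually_elim (simp add: gen_defect_def efun_def)
  then have "nrm (gen_defect s h (efun s 0)) = 0" using nrm_eq_0_iff[OF gen_defect_X[OF h0 efun_X]] by blast
  then show ?case by simp
next
  case (insert v B)
  have h0: "h \<ge> 0" using h by simp
  define u where "u = (\<Sum>v\<in>B. r v *\<^sub>R v)"
  let ?k = "complex_of_real (r v)"
  have e: "efun s (r v *\<^sub>R v + u) = (\<lambda>\<xi>. ?k *s efun s v \<xi> + 1 *s efun s u \<xi>)"
    by (rule ext) (simp add: efun_add efun_scaleR complex_scaleR_eq)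
  have "AE \<xi> in M. gen_defect s h (efun s (r v *\<^sub>R v + u)) \<xi> = r v *\<^sub>R gen_defect s h (efun s v) \<xi> + gen_defect s h (efun s u) \<xi>"
    using T_lin[OF h0 efun_X[of s v] efun_X[of s u], where c="?k" and d=1]
  proof eventually_elim
    case (elim \<xi>)
    show ?case unfolding gen_defect_def e unfolding elim complex_scaleR_eq[symmetric] by (simp add: vec_eq_iff algebra_simps)
  qed
  then have "nrm (gen_defect s h (efun s (r v *\<^sub>R v + u))) = nrm (\<lambda>\<xi>. r v *\<^sub>R gen_defect s h (efun s v) \<xi> + gen_defect s h (efun s u) \<xi>)"
    by (rule nrm_cong[OF gen_defect_X[OF h0 efun_X]])
  also have "\<dots> \<le> nrm (\<lambda>\<xi>. r v *\<^sub>R gen_defect s h (efun s v) \<xi>) + nrm (gen_defect s h (efun s u))"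
    by (intro nrm_triangle L2_scaleR gen_defect_X efun_X h0)
  also have "\<dots> = \<bar>r v\<bar> * nrm (gen_defect s h (efun s v)) + nrm (gen_defect s h (efun s u))"
    by (simp add: nrm_scaleR gen_defect_X efun_X h0)
  finally show ?case using insert by (simp flip: u_def)
qed

text \<open>The eigenspace is finite-dimensional, so the convergence defining the generator is uniform on it.\<close>

lemma gen_defect_uniform:
  obtains \<delta> where "\<delta> > 0" "\<And>h f. 0 < h \<Longrightarrow> h < \<delta> \<Longrightarrow> eigen s f \<Longrightarrow> nrm (gen_defect s h f) \<le> nrm f"
proof -
  obtain c where c: "c > 0" "\<And>v. c * norm v \<le> nrm (efun s v)" using efun_lower_bound by blast
  define E where "E = {v. bdry_mat W s *v v = 0}"
  have "subspace E"
    by (auto simp: E_def subspace_def matrix_vector_right_distrib mv_scaleR)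
  \<comment> \<open>Orthonormal over the reals, in accordance with the real coefficients of
    \<open>gen_defect_sum\<close>.\<close>
  then obtain B where B: "B \<subseteq> E" "pairwise orthogonal B" "\<And>x. x \<in> B \<Longrightarrow> norm x = 1"
    "independent B" "span B = E" using orthonormal_basis_subspace by metis
  have finB: "finite B" using B(4) independent_imp_finite by blast
  \<comment> \<open>\<open>card B\<close> terms of size at most \<open>norm v * q\<close> then stay
    below \<open>c * norm v\<close>, hence below the norm of the eigenfunction. The added 1 covers a
    trivial eigenspace.\<close>
  define q where "q = c / (real (card B) + 1)"
  have q: "q > 0" using c by (simp add: q_def)
  have "\<forall>\<^sub>F h in at_right 0. \<forall>v\<in>B. nrm (gen_defect s h (efun s v)) < q"
  proof (rule eventually_ball_finite[OF finB], rule ballI)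
    fix v assume "v \<in> B"
    then have "eigen s (efun s v)" using B(1) efun_eigen by (auto simp: E_def eigen_def)
    then have "((\<lambda>h. nrm (gen_defect s h (efun s v))) \<longlongrightarrow> 0) (at_right 0)" by (simp add: eigen_iff)
    then show "\<forall>\<^sub>F h in at_right 0. nrm (gen_defect s h (efun s v)) < q" using q by (rule order_tendstoD)
  qed
  then obtain \<delta> where \<delta>: "\<delta> > 0" "\<And>h v. 0 < h \<Longrightarrow> h < \<delta> \<Longrightarrow> v \<in> B \<Longrightarrow> nrm (gen_defect s h (efun s v)) < q"
    unfolding eventually_at_right_field by blast
  show thesis
  proof (rule that[OF \<delta>(1)])
    fix h f assume h: "0 < h" "h < \<delta>" and f: "eigen s f"
    obtain v where v: "v \<in> E" "AE \<xi> in M. f \<xi> = efun s v \<xi>"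
      using f eigen_efun[of f s W] by (auto simp: eigen_def E_def)
    have fX: "f \<in> X" using f by (simp add: eigen_iff)
    have expand: "(\<Sum>u\<in>B. (v \<bullet> u) *\<^sub>R u) = v"
      by (rule orthonormal_basis_expand[OF B(2,3)]) (use v(1) B(5) finB in auto)
    have "nrm (gen_defect s h f) = nrm (gen_defect s h (efun s v))" by (rule gen_defect_cong) (use h fX v efun_X in auto)
    also have "\<dots> \<le> (\<Sum>u\<in>B. \<bar>v \<bullet> u\<bar> * nrm (gen_defect s h (efun s u)))"
      using gen_defect_sum[OF h(1) finB, of s "\<lambda>u. v \<bullet> u"] unfolding expand .
    also have "\<dots> \<le> (\<Sum>u\<in>B. norm v * q)"
    proof (rule sum_mono)
      fix u assume u: "u \<in> B"
      have "\<bar>v \<bullet> u\<bar> \<le> norm v" using Cauchy_Schwarz_ineq2[of v u] B(3)[OF u] by simp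
      then show "\<bar>v \<bullet> u\<bar> * nrm (gen_defect s h (efun s u)) \<le> norm v * q"
        using \<delta>(2)[OF h u] nrm_nonneg[OF gen_defect_X[OF _ efun_X]] h by (intro mult_mono) (auto simp: less_imp_le)
    qed
    also have "\<dots> = (real (card B) / (real (card B) + 1)) * (c * norm v)" by (simp add: q_def)
    also have "\<dots> \<le> 1 * (c * norm v)" using c by (intro mult_right_mono) auto
    also have "\<dots> \<le> nrm (efun s v)" using c by simp
    also have "\<dots> = nrm f" using nrm_cong[OF fX v(2)] by simp
    finally show "nrm (gen_defect s h f) \<le> nrm f" .
  qed
qed

text \<open>\<open>(1 + h s) f\<close> differs from \<open>T h f\<close> by \<open>h\<close> times
  the defect. The modulus of \<open>1 + h s\<close> is at least \<open>1 + h * Re s\<close>, and the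
  defect costs at most \<open>h * nrm f\<close>.\<close>

lemma eigen_growth_step:
  assumes h: "h > 0" and f: "eigen s f" and le: "nrm (gen_defect s h f) \<le> nrm f"
  shows "(1 + h * (Re s - 1)) * nrm f \<le> nrm (T h f)"
proof -
  have h0: "h \<ge> 0" using h by simp
  have fX: "f \<in> X" using f by (simp add: eigen_iff)
  note TfX = TX[OF h0 fX] and DX = gen_defect_X[OF h0 fX, of s]
  let ?k = "1 + complex_of_real h * s"
  have "(\<lambda>\<xi>. ?k *s f \<xi>) = (\<lambda>\<xi>. T h f \<xi> + (- h) *\<^sub>R gen_defect s h f \<xi>)"
    using h by (intro ext) (simp add: gen_defect_def vec_eq_iff algebra_simps scaleR_conv_of_real[where 'a=complex])
  then have "cmod ?k * nrm f = nrm (\<lambda>\<xi>. T h f \<xi> + (- h) *\<^sub>R gen_defect s h f \<xi>)"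
    using nrm_smult[OF fX, of ?k] by simp
  also have "\<dots> \<le> nrm (T h f) + h * nrm (gen_defect s h f)"
    using nrm_triangle[OF TfX L2_scaleR[OF DX, of "- h"]] nrm_scaleR[OF DX, of "- h"] h by simp
  also have "\<dots> \<le> nrm (T h f) + h * nrm f" using le h by simp
  finally have "cmod ?k * nrm f \<le> nrm (T h f) + h * nrm f" .
  moreover have "(1 + h * Re s) * nrm f \<le> cmod ?k * nrm f"
    using complex_Re_le_cmod[of ?k] nrm_nonneg[OF fX] by (intro mult_right_mono) auto
  ultimately show ?thesis by (simp add: algebra_simps)
qed

lemma large_not_eigenvalue:
  obtains \<omega> where "\<And>s. Re s > \<omega> \<Longrightarrow> invertible (bdry_mat W s)"
proof -
  obtain C where C: "C \<ge> 0" "\<forall>f\<in>X. nrm (T 1 f) \<le> C * nrm f" using T_bounded[of 1] by auto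
  \<comment> \<open>Exceeding \<open>C\<close> produces the final contradiction; exceeding 1 keeps
    the growth factor positive and Bernoulli's inequality applicable.\<close>
  show thesis
  proof (rule that[of "max C 1"])
    fix s assume s: "Re s > max C 1"
    show "invertible (bdry_mat W s)" unfolding invertible_iff_ker
    proof (intro allI impI)
      fix v assume v: "bdry_mat W s *v v = 0"
      let ?f = "efun s v"
      have ef: "eigen s ?f" using efun_eigen[OF v] by (simp add: eigen_def)
      obtain \<delta> where \<delta>: "\<delta> > 0" "\<And>h f. 0 < h \<Longrightarrow> h < \<delta> \<Longrightarrow> eigen s f \<Longrightarrow> nrm (gen_defect s h f) \<le> nrm f"
        using gen_defect_uniform by blast
      obtain n where n: "inverse (real (Suc n)) < \<delta>" using reals_Archimedean[OF \<delta>(1)] by blast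
      define h where "h = inverse (real (Suc n))"
      have h: "0 < h" "h < \<delta>" using n by (simp_all add: h_def)
      \<comment> \<open>\<open>\<delta>\<close> depends only on \<open>s\<close>, so the same
        \<open>h\<close> is admissible for every iterate, all of which are eigenvectors.\<close>
      have pow: "(1 + h * (Re s - 1)) ^ k * nrm ?f \<le> nrm (T (real k * h) ?f)" for k
      proof (induction k)
        case 0
        show ?case using nrm_cong[OF TX[OF order_refl efun_X] T_0[OF efun_X], of s v] by simp
      next
        case (Suc k)
        have kh: "real k * h \<ge> 0" using h by simp
        have "(1 + h * (Re s - 1)) ^ Suc k * nrm ?f \<le> (1 + h * (Re s - 1)) * nrm (T (real k * h) ?f)"
          using mult_left_mono[OF Suc, of "1 + h * (Re s - 1)"] h s by (simp add: mult.assoc)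
        also have "\<dots> \<le> nrm (T h (T (real k * h) ?f))"
          using eigen_invariant[OF ef kh] by (intro eigen_growth_step \<delta> h)
        also have "\<dots> = nrm (T (h + real k * h) ?f)"
          using nrm_cong[OF _ T_semi[OF _ kh efun_X, of h s v]] h kh by (simp add: TX efun_X)
        also have "h + real k * h = real (Suc k) * h" by (simp add: algebra_simps)
        finally show ?case .
      qed
      have nh: "real (Suc n) * h = 1" by (simp add: h_def)
      \<comment> \<open>As \<open>Suc n\<close> steps of length \<open>h\<close> make up time 1, the
        left side of Bernoulli's inequality is exactly \<open>Re s\<close>.\<close>
      have "1 + real (Suc n) * (h * (Re s - 1)) \<le> (1 + h * (Re s - 1)) ^ Suc n"
        by (rule Bernoulli_inequality) (use h s in \<open>smt (verit) mult_pos_pos\<close>)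
      then have "Re s \<le> (1 + h * (Re s - 1)) ^ Suc n" using nh by (simp flip: mult.assoc)
      then have "Re s * nrm ?f \<le> (1 + h * (Re s - 1)) ^ Suc n * nrm ?f"
        by (rule mult_right_mono[OF _ nrm_nonneg[OF efun_X]])
      also have "\<dots> \<le> nrm (T 1 ?f)" using pow[of "Suc n"] unfolding nh .
      also have "\<dots> \<le> C * nrm ?f" using C efun_X by blast
      finally have "(Re s - C) * nrm ?f \<le> 0" by (simp add: algebra_simps)
      then have "nrm ?f \<le> 0" using s by (simp add: mult_le_0_iff)
      moreover obtain c where "c > 0" "c * norm v \<le> nrm ?f" using efun_lower_bound by metis
      ultimately have "c * norm v \<le> 0" by linarith
      then show "v = 0" using \<open>c > 0\<close> by (simp add: mult_le_0_iff)
    qed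
  qed
qed

end

section \<open>Complexification\<close>

text \<open>Real and imaginary parts stay complex vectors with real entries, the form in which real
  states are encoded.\<close>

definition re_vec :: "complex^'n \<Rightarrow> complex^'n" where "re_vec v = (\<chi> i. complex_of_real (Re (v $ i)))"
definition im_vec :: "complex^'n \<Rightarrow> complex^'n" where "im_vec v = (\<chi> i. complex_of_real (Im (v $ i)))"

lemma re_vec_im_vec: "re_vec v + \<i> *s im_vec v = v"
  by (simp add: re_vec_def im_vec_def vec_eq_iff complex_eq_iff)

lemma re_vec_Fvec [simp]: "re_vec v \<in> Fvec \<real>" and im_vec_Fvec [simp]: "im_vec v \<in> Fvec \<real>"
  by (simp_all add: re_vec_def im_vec_def Fvec_def)

lemma norm_re_vec: "norm (re_vec v) \<le> norm v" and norm_im_vec: "norm (im_vec v) \<le> norm v"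
  by (auto simp: re_vec_def im_vec_def norm_vec_def abs_Re_le_cmod abs_Im_le_cmod intro!: L2_set_mono)

lemma bounded_linear_re_vec: "bounded_linear re_vec"
  by (rule bounded_linear_intro[where K=1]) (simp_all add: norm_re_vec, simp_all add: re_vec_def vec_eq_iff complex_eq_iff)

lemma bounded_linear_im_vec: "bounded_linear im_vec"
  by (rule bounded_linear_intro[where K=1]) (simp_all add: norm_im_vec, simp_all add: im_vec_def vec_eq_iff complex_eq_iff)

lemma re_vec_mv: "A \<in> Fmat \<real> \<Longrightarrow> re_vec (A *v v) = A *v re_vec v"
  and im_vec_mv: "A \<in> Fmat \<real> \<Longrightarrow> im_vec (A *v v) = A *v im_vec v"
proof -
  assume "A \<in> Fmat \<real>"
  then have "Im (A $ i $ j) = 0" for i j by (simp add: Fmat_def complex_is_Real_iff)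
  then show "re_vec (A *v v) = A *v re_vec v" "im_vec (A *v v) = A *v im_vec v"
    by (simp_all add: re_vec_def im_vec_def matrix_vector_mult_def vec_eq_iff complex_eq_iff)
qed

lemma re_vec_real_pair:
  assumes "x \<in> Fvec \<real>" "y \<in> Fvec \<real>"
  shows "re_vec (x + \<i> *s y) = x" "im_vec (x + \<i> *s y) = y"
  using assms by (auto simp: re_vec_def im_vec_def vec_eq_iff complex_eq_iff Fvec_def complex_is_Real_iff)

text \<open>A real semigroup is linear over the reals only, so complex combinations must be split
  into four real terms before it is applied.\<close>

lemma re_vec_lin: "re_vec (c *s x + d *s y) = (Re c *\<^sub>R re_vec x + (- Im c) *\<^sub>R im_vec x) + (Re d *\<^sub>R re_vec y + (- Im d) *\<^sub>R im_vec y)"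
  and im_vec_lin: "im_vec (c *s x + d *s y) = (Im c *\<^sub>R re_vec x + Re c *\<^sub>R im_vec x) + (Im d *\<^sub>R re_vec y + Re d *\<^sub>R im_vec y)"
  by (simp_all add: re_vec_def im_vec_def vec_eq_iff complex_eq_iff)

lemma vstack_re_vec: "vstack (re_vec x) (re_vec y) = re_vec (vstack x y)" and vstack_im_vec: "vstack (im_vec x) (im_vec y) = im_vec (vstack x y)"
  by (auto simp: re_vec_def im_vec_def vstack_def vec_eq_iff split: sum.split)

lemma inner_real_imag: "x \<in> Fvec \<real> \<Longrightarrow> y \<in> Fvec \<real> \<Longrightarrow> x \<bullet> (\<i> *s y) = 0"
  by (simp add: inner_vec_def inner_complex_def Fvec_def complex_is_Real_iff)

lemma inner_ii: "(\<i> *s x) \<bullet> (\<i> *s y) = x \<bullet> y"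
  by (simp add: inner_vec_def inner_complex_def add.commute)

text \<open>The mixed terms are purely imaginary and disappear in the real inner product.\<close>

lemma inner_real_pair:
  assumes "A \<in> Fmat \<real>" "x \<in> Fvec \<real>" "y \<in> Fvec \<real>"
  shows "(A *v (x + \<i> *s y)) \<bullet> (x + \<i> *s y) = (A *v x) \<bullet> x + (A *v y) \<bullet> y"
  using assms inner_real_imag[of "A *v x" y] inner_real_imag[of x "A *v y"]
  by (simp add: matrix_vector_right_distrib vector_scalar_commute inner_add_left inner_add_right inner_ii mv_Fvec_Reals inner_commute)

lemma L2_Reals_iff: "f \<in> L2 \<real> a b \<longleftrightarrow> f \<in> L2 UNIV a b \<and> (AE \<xi> in lebesgue_on {a..b}. f \<xi> \<in> Fvec \<real>)"
  by (auto simp: L2_def)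

lemma L2_re_vec: "f \<in> L2 UNIV a b \<Longrightarrow> (\<lambda>\<xi>. re_vec (f \<xi>)) \<in> L2 \<real> a b"
  and L2_im_vec: "f \<in> L2 UNIV a b \<Longrightarrow> (\<lambda>\<xi>. im_vec (f \<xi>)) \<in> L2 \<real> a b"
proof -
  assume f: "f \<in> L2 UNIV a b"
  have m: "f \<in> borel_measurable (lebesgue_on {a..b})" using f by (simp add: L2_UNIV_iff)
  show "(\<lambda>\<xi>. re_vec (f \<xi>)) \<in> L2 \<real> a b" unfolding L2_Reals_iff
    by (intro conjI L2_dominated[OF f, where C=1] borel_measurable_continuous_on[OF _ m]
        linear_continuous_on bounded_linear_re_vec) (auto simp: norm_re_vec)
  show "(\<lambda>\<xi>. im_vec (f \<xi>)) \<in> L2 \<real> a b" unfolding L2_Reals_iff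
    by (intro conjI L2_dominated[OF f, where C=1] borel_measurable_continuous_on[OF _ m]
        linear_continuous_on bounded_linear_im_vec) (auto simp: norm_im_vec)
qed

lemma L2_Reals_lin:
  assumes f: "f \<in> L2 \<real> a b" and g: "g \<in> L2 \<real> a b"
  shows "(\<lambda>\<xi>. r *\<^sub>R f \<xi> + q *\<^sub>R g \<xi>) \<in> L2 \<real> a b"
proof -
  have "AE \<xi> in lebesgue_on {a..b}. f \<xi> \<in> Fvec \<real>" "AE \<xi> in lebesgue_on {a..b}. g \<xi> \<in> Fvec \<real>"
    using f g by (auto simp: L2_Reals_iff)
  then have "AE \<xi> in lebesgue_on {a..b}. r *\<^sub>R f \<xi> + q *\<^sub>R g \<xi> \<in> Fvec \<real>"
    by eventually_elim (intro subspace_add subspace_scale subspace_Fvec_Reals)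
  then show ?thesis using f g by (auto simp: L2_Reals_iff intro!: L2_add L2_scaleR)
qed

lemma L2_Reals_diff:
  assumes f: "f \<in> L2 \<real> a b" and g: "g \<in> L2 \<real> a b"
  shows "(\<lambda>\<xi>. f \<xi> - g \<xi>) \<in> L2 \<real> a b"
  using L2_Reals_lin[OF f g, of 1 "-1"] by simp

lemma L2_Reals_scaleR: "f \<in> L2 \<real> a b \<Longrightarrow> (\<lambda>\<xi>. r *\<^sub>R f \<xi>) \<in> L2 \<real> a b"
  using L2_Reals_lin[of f a b f r 0] by simp

lemma L2_sub_integrable:
  assumes "f \<in> L2 UNIV a b" "\<zeta> \<in> {a..b}" shows "integrable (lebesgue_on {a..\<zeta>}) f"
  using integrable_subinterval[OF L2_integrable[OF assms(1)], of a \<zeta>] assms(2) by auto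

lemma H1_bounded_linear:
  assumes w: "H1 UNIV a b w w'" and T: "bounded_linear T"
    and L2: "(\<lambda>\<xi>. T (w' \<xi>)) \<in> L2 F a b" and F: "T (w a) \<in> Fvec F"
  shows "H1 F a b (\<lambda>\<xi>. T (w \<xi>)) (\<lambda>\<xi>. T (w' \<xi>))"
  unfolding H1_def
proof (intro conjI L2 F ballI)
  fix \<xi> assume x: "\<xi> \<in> {a..b}"
  have w': "w' \<in> L2 UNIV a b" using w by (simp add: H1_def)
  have "w \<xi> = w a + (LINT \<tau>|lebesgue_on {a..\<xi>}. w' \<tau>)" using w x unfolding H1_def by blast
  then have "T (w \<xi>) = T (w a) + T (LINT \<tau>|lebesgue_on {a..\<xi>}. w' \<tau>)"
    using linear_add[OF bounded_linear.linear[OF T]] by metis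
  also have "T (LINT \<tau>|lebesgue_on {a..\<xi>}. w' \<tau>) = (LINT \<tau>|lebesgue_on {a..\<xi>}. T (w' \<tau>))"
    by (rule integral_bounded_linear[symmetric, OF T L2_sub_integrable[OF w' x]])
  finally show "T (w \<xi>) = T (w a) + (LINT \<tau>|lebesgue_on {a..\<xi>}. T (w' \<tau>))" .
qed

lemma H1_add_ii:
  assumes w: "H1 \<real> a b w w'" and v: "H1 \<real> a b v v'"
  shows "H1 UNIV a b (\<lambda>\<xi>. w \<xi> + \<i> *s v \<xi>) (\<lambda>\<xi>. w' \<xi> + \<i> *s v' \<xi>)"
  unfolding H1_def
proof (intro conjI ballI)
  have L: "w' \<in> L2 UNIV a b" "v' \<in> L2 UNIV a b" using w v by (auto simp: H1_def L2_Reals_iff)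
  show "(\<lambda>\<xi>. w' \<xi> + \<i> *s v' \<xi>) \<in> L2 UNIV a b" by (intro L2_add L2_smult L)
  fix \<xi> assume x: "\<xi> \<in> {a..b}"
  have eq: "w \<xi> = w a + (LINT \<tau>|lebesgue_on {a..\<xi>}. w' \<tau>)" "v \<xi> = v a + (LINT \<tau>|lebesgue_on {a..\<xi>}. v' \<tau>)"
    using w v x unfolding H1_def by blast+
  have i: "(LINT \<tau>|lebesgue_on {a..\<xi>}. \<i> *s v' \<tau>) = \<i> *s (LINT \<tau>|lebesgue_on {a..\<xi>}. v' \<tau>)"
    by (rule integral_bounded_linear[OF bounded_linear_smult L2_sub_integrable[OF L(2) x]])
  have "(LINT \<tau>|lebesgue_on {a..\<xi>}. w' \<tau> + \<i> *s v' \<tau>) = (LINT \<tau>|lebesgue_on {a..\<xi>}. w' \<tau>) + (LINT \<tau>|lebesgue_on {a..\<xi>}. \<i> *s v' \<tau>)"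
    by (rule Bochner_Integration.integral_add[OF L2_sub_integrable[OF L(1) x] L2_sub_integrable[OF L2_smult[OF L(2)] x]])
  then show "w \<xi> + \<i> *s v \<xi> = w a + \<i> *s v a + (LINT \<tau>|lebesgue_on {a..\<xi>}. w' \<tau> + \<i> *s v' \<tau>)"
    unfolding i eq(1)[symmetric] by (subst eq(1), subst eq(2)) (simp add: vector_add_ldistrib)
qed simp

locale real_hyperbolic_coefficients = hyperbolic_coefficients +
  assumes P1_real: "P1 \<in> Fmat \<real>" and P0_real: "AE \<xi> in M. P0 \<xi> \<in> Fmat \<real>" and H_real: "AE \<xi> in M. H \<xi> \<in> Fmat \<real>"
begin

abbreviation XR where "XR \<equiv> L2 \<real> a b"
abbreviation OpR where "OpR W \<equiv> hbcs_operator \<real> a b P1 P0 H W"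
abbreviation re :: "'a state \<Rightarrow> 'a state" where "re f \<equiv> (\<lambda>\<xi>. re_vec (f \<xi>))"
abbreviation im :: "'a state \<Rightarrow> 'a state" where "im f \<equiv> (\<lambda>\<xi>. im_vec (f \<xi>))"
abbreviation pair :: "'a state \<Rightarrow> 'a state \<Rightarrow> 'a state" where "pair f g \<equiv> (\<lambda>\<xi>. f \<xi> + \<i> *s g \<xi>)"

lemma XR_X: "f \<in> XR \<Longrightarrow> f \<in> X" by (simp add: L2_Reals_iff)

lemma pair_X: "f \<in> XR \<Longrightarrow> g \<in> XR \<Longrightarrow> pair f g \<in> X"
  by (intro L2_add L2_smult XR_X)

lemma pair_re_im: "pair (re f) (im f) = f" by (simp add: re_vec_im_vec)

lemma OpR_pair:
  assumes "(f1, g1) \<in> OpR W" "(f2, g2) \<in> OpR W"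
  shows "(pair f1 f2, pair g1 g2) \<in> Op W"
proof -
  obtain w1 w1' where 1: "f1 \<in> XR" "g1 \<in> XR" "H1 \<real> a b w1 w1'" "AE \<xi> in M. H \<xi> *v f1 \<xi> = w1 \<xi>"
     "W *v vstack (w1 b) (w1 a) = 0" "AE \<xi> in M. g1 \<xi> = P1 *v w1' \<xi> + P0 \<xi> *v (H \<xi> *v f1 \<xi>)"
    using assms(1) by (auto simp: hbcs_operator_def)
  obtain w2 w2' where 2: "f2 \<in> XR" "g2 \<in> XR" "H1 \<real> a b w2 w2'" "AE \<xi> in M. H \<xi> *v f2 \<xi> = w2 \<xi>"
     "W *v vstack (w2 b) (w2 a) = 0" "AE \<xi> in M. g2 \<xi> = P1 *v w2' \<xi> + P0 \<xi> *v (H \<xi> *v f2 \<xi>)"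
    using assms(2) by (auto simp: hbcs_operator_def)
  have "AE \<xi> in M. H \<xi> *v pair f1 f2 \<xi> = pair w1 w2 \<xi>"
    using 1(4) 2(4) by eventually_elim (simp add: matrix_vector_right_distrib vector_scalar_commute)
  moreover have "AE \<xi> in M. pair g1 g2 \<xi> = P1 *v pair w1' w2' \<xi> + P0 \<xi> *v (H \<xi> *v pair f1 f2 \<xi>)"
    using 1(6) 2(6) by eventually_elim
      (simp add: matrix_vector_right_distrib vector_scalar_commute vector_add_ldistrib)
  moreover have "W *v vstack (pair w1 w2 b) (pair w1 w2 a) = 0"
  proof -
    have "vstack (pair w1 w2 b) (pair w1 w2 a) = vstack (w1 b) (w1 a) + \<i> *s vstack (w2 b) (w2 a)"
      by (auto simp: vstack_def vec_eq_iff split: sum.split)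
    then show ?thesis using 1(5) 2(5) by (simp add: matrix_vector_right_distrib vector_scalar_commute)
  qed
  ultimately show ?thesis
    unfolding hbcs_operator_def using H1_add_ii[OF 1(3) 2(3)] pair_X 1 2 by blast
qed

text \<open>Real matrices commute with taking real and imaginary parts; for the boundary condition
  this uses that \<open>W\<close> is real.\<close>

lemma Op_re_im:
  assumes W: "W \<in> Fmat \<real>" and fg: "(f, g) \<in> Op W"
  shows "(re f, re g) \<in> OpR W" "(im f, im g) \<in> OpR W"
proof -
  obtain w w' where 1: "f \<in> X" "g \<in> X" "H1 UNIV a b w w'" "AE \<xi> in M. H \<xi> *v f \<xi> = w \<xi>"
     "W *v vstack (w b) (w a) = 0" "AE \<xi> in M. g \<xi> = P1 *v w' \<xi> + P0 \<xi> *v (H \<xi> *v f \<xi>)"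
    using fg by (auto simp: hbcs_operator_def)
  have w': "w' \<in> X" using 1(3) by (simp add: H1_def)
  have "H1 \<real> a b (re w) (re w')" by (rule H1_bounded_linear[OF 1(3) bounded_linear_re_vec L2_re_vec[OF w']]) simp
  moreover have "AE \<xi> in M. H \<xi> *v re f \<xi> = re w \<xi>"
    using 1(4) H_real by eventually_elim (metis re_vec_mv)
  moreover have "W *v vstack (re w b) (re w a) = 0"
    unfolding vstack_re_vec re_vec_mv[OF W, symmetric] 1(5) by (simp add: re_vec_def vec_eq_iff)
  moreover have "AE \<xi> in M. re g \<xi> = P1 *v re w' \<xi> + P0 \<xi> *v (H \<xi> *v re f \<xi>)"
    using 1(6) H_real P0_real
    by eventually_elim (simp add: linear_add[OF bounded_linear.linear[OF bounded_linear_re_vec]] re_vec_mv P1_real)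
  ultimately show "(re f, re g) \<in> OpR W" unfolding hbcs_operator_def using L2_re_vec 1 by blast
  have "H1 \<real> a b (im w) (im w')" by (rule H1_bounded_linear[OF 1(3) bounded_linear_im_vec L2_im_vec[OF w']]) simp
  moreover have "AE \<xi> in M. H \<xi> *v im f \<xi> = im w \<xi>"
    using 1(4) H_real by eventually_elim (metis im_vec_mv)
  moreover have "W *v vstack (im w b) (im w a) = 0"
    unfolding vstack_im_vec im_vec_mv[OF W, symmetric] 1(5) by (simp add: im_vec_def vec_eq_iff)
  moreover have "AE \<xi> in M. im g \<xi> = P1 *v im w' \<xi> + P0 \<xi> *v (H \<xi> *v im f \<xi>)"
    using 1(6) H_real P0_real
    by eventually_elim (simp add: linear_add[OF bounded_linear.linear[OF bounded_linear_im_vec]] im_vec_mv P1_real)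
  ultimately show "(im f, im g) \<in> OpR W" unfolding hbcs_operator_def using L2_im_vec 1 by blast
qed

text \<open>Moves the resolvent sets of the real case into the complex setting. For the boundary
  matrix built from \<open>Q_mat\<close> the assumption on \<open>W\<close> rests on
  \<open>Q_mat_Reals\<close>.\<close>

lemma complexification_OpR:
  assumes W: "W \<in> Fmat \<real>" shows "complexification \<real> (OpR W) = Op W"
proof (intro subset_antisym subsetI)
  fix p assume "p \<in> complexification \<real> (OpR W)"
  then show "p \<in> Op W" by (auto simp: complexification_def intro: OpR_pair)
next
  fix p assume p: "p \<in> Op W"
  obtain f g where fg: "p = (f, g)" by (cases p)
  have "p = (pair (re f) (im f), pair (re g) (im g))" unfolding fg pair_re_im ..
  moreover have "(re f, re g) \<in> OpR W" "(im f, im g) \<in> OpR W" using Op_re_im[OF W] p fg by blast+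
  ultimately show "p \<in> complexification \<real> (OpR W)"
    unfolding complexification_def if_P[OF refl] mem_Collect_eq
    by (intro exI[of _ "re f"] exI[of _ "im f"] exI[of _ "re g"] exI[of _ "im g"] conjI)
qed

text \<open>Pythagoras, because \<open>H\<close> is real almost everywhere.\<close>

lemma nrm_pair_sq:
  assumes f: "f \<in> XR" and g: "g \<in> XR"
  shows "(nrm (pair f g))\<^sup>2 = (nrm f)\<^sup>2 + (nrm g)\<^sup>2"
proof -
  note fX = XR_X[OF f] and gX = XR_X[OF g] and pX = pair_X[OF f g]
  have r: "AE \<xi> in M. f \<xi> \<in> Fvec \<real>" "AE \<xi> in M. g \<xi> \<in> Fvec \<real>" using f g by (auto simp: L2_Reals_iff)
  have "(LINT \<xi>|M. (H \<xi> *v pair f g \<xi>) \<bullet> pair f g \<xi>) = (LINT \<xi>|M. (H \<xi> *v f \<xi>) \<bullet> f \<xi> + (H \<xi> *v g \<xi>) \<bullet> g \<xi>)"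
  proof (rule integral_cong_AE)
    show "AE \<xi> in M. (H \<xi> *v pair f g \<xi>) \<bullet> pair f g \<xi> = (H \<xi> *v f \<xi>) \<bullet> f \<xi> + (H \<xi> *v g \<xi>) \<bullet> g \<xi>"
      using r H_real by eventually_elim (simp add: inner_real_pair)
  qed (use energy_integrable fX gX pX in \<open>auto intro!: borel_measurable_integrable\<close>)
  then show ?thesis using fX gX pX by (simp add: nrm_sq energy_def energy_integrable)
qed

lemma nrm_le_pair:
  assumes f: "f \<in> XR" and g: "g \<in> XR"
  shows "nrm f \<le> nrm (pair f g)" "nrm g \<le> nrm (pair f g)" "nrm (pair f g) \<le> nrm f + nrm g"
proof -
  note n = nrm_nonneg[OF XR_X[OF f]] nrm_nonneg[OF XR_X[OF g]] nrm_nonneg[OF pair_X[OF f g]]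
  show "nrm f \<le> nrm (pair f g)" "nrm g \<le> nrm (pair f g)"
    by (rule power2_le_imp_le; use n nrm_pair_sq[OF f g] in simp)+
  show "nrm (pair f g) \<le> nrm f + nrm g"
    by (rule power2_le_imp_le) (use n nrm_pair_sq[OF f g] in \<open>auto simp: power2_sum\<close>)
qed

end

section \<open>The complexified semigroup and its generator\<close>

locale real_semigroup_hyperbolic = real_hyperbolic_coefficients +
  fixes T :: "real \<Rightarrow> 'a state \<Rightarrow> 'a state" and W :: "complex^('a + 'a)^'a"
  assumes T: "C0_semigroup \<real> XR nrm T" and gen: "generator XR nrm T = OpR W" and W: "W \<in> Fmat \<real>"
begin

lemma T_XR: "t \<ge> 0 \<Longrightarrow> f \<in> XR \<Longrightarrow> T t f \<in> XR"
  using T[unfolded C0_semigroup_def, THEN conjunct1] by blast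

lemma T_lin:
  assumes t: "t \<ge> 0" and f: "f \<in> XR" and g: "g \<in> XR"
  shows "AE \<xi> in M. T t (\<lambda>\<eta>. r *\<^sub>R f \<eta> + q *\<^sub>R g \<eta>) \<xi> = r *\<^sub>R T t f \<xi> + q *\<^sub>R T t g \<xi>"
proof -
  have "\<forall>c\<in>\<real>. \<forall>d\<in>\<real>. nrm (\<lambda>\<xi>. T t (\<lambda>\<eta>. c *s f \<eta> + d *s g \<eta>) \<xi> - (c *s T t f \<xi> + d *s T t g \<xi>)) = 0"
    using T[unfolded C0_semigroup_def, THEN conjunct2, THEN conjunct1] assms by blast
  then have "nrm (\<lambda>\<xi>. T t (\<lambda>\<eta>. complex_of_real r *s f \<eta> + complex_of_real q *s g \<eta>) \<xi> -
      (complex_of_real r *s T t f \<xi> + complex_of_real q *s T t g \<xi>)) = 0" by (meson Reals_of_real)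
  then have "nrm (\<lambda>\<xi>. T t (\<lambda>\<eta>. r *\<^sub>R f \<eta> + q *\<^sub>R g \<eta>) \<xi> - (r *\<^sub>R T t f \<xi> + q *\<^sub>R T t g \<xi>)) = 0"
    by (simp add: complex_scaleR_eq)
  moreover have "(\<lambda>\<xi>. T t (\<lambda>\<eta>. r *\<^sub>R f \<eta> + q *\<^sub>R g \<eta>) \<xi> - (r *\<^sub>R T t f \<xi> + q *\<^sub>R T t g \<xi>)) \<in> X"
    by (intro XR_X L2_Reals_diff T_XR L2_Reals_lin t f g)
  ultimately show ?thesis using nrm_eq_0_iff by force
qed

lemma T_bounded:
  assumes "t \<ge> 0" obtains C where "C \<ge> 0" "\<And>f. f \<in> XR \<Longrightarrow> nrm (T t f) \<le> C * nrm f"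
proof -
  obtain C where C: "\<forall>f\<in>XR. nrm (T t f) \<le> C * nrm f"
    using assms T[unfolded C0_semigroup_def, THEN conjunct2, THEN conjunct2, THEN conjunct1] by blast
  have "nrm (T t f) \<le> max C 0 * nrm f" if "f \<in> XR" for f
  proof -
    have "nrm (T t f) \<le> C * nrm f" using C that by blast
    also have "\<dots> \<le> max C 0 * nrm f" by (intro mult_right_mono nrm_nonneg XR_X that) auto
    finally show ?thesis .
  qed
  then show thesis using that[of "max C 0"] by auto
qed

lemma T_0: assumes f: "f \<in> XR" shows "AE \<xi> in M. T 0 f \<xi> = f \<xi>"
proof -
  have "nrm (\<lambda>\<xi>. T 0 f \<xi> - f \<xi>) = 0"
    using T[unfolded C0_semigroup_def, THEN conjunct2, THEN conjunct2, THEN conjunct2, THEN conjunct1] assms by blast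
  moreover have "(\<lambda>\<xi>. T 0 f \<xi> - f \<xi>) \<in> X" by (intro XR_X L2_Reals_diff T_XR f) simp
  ultimately show ?thesis using nrm_eq_0_iff by force
qed

lemma T_semi:
  assumes t: "t \<ge> 0" and r: "r \<ge> 0" and f: "f \<in> XR"
  shows "AE \<xi> in M. T (t + r) f \<xi> = T t (T r f) \<xi>"
proof -
  have "nrm (\<lambda>\<xi>. T (t + r) f \<xi> - T t (T r f) \<xi>) = 0"
    using T[unfolded C0_semigroup_def, THEN conjunct2, THEN conjunct2, THEN conjunct2, THEN conjunct2, THEN conjunct1] assms by blast
  moreover have "(\<lambda>\<xi>. T (t + r) f \<xi> - T t (T r f) \<xi>) \<in> X"
    by (intro XR_X L2_Reals_diff T_XR f) (use t r in auto)
  ultimately show ?thesis using nrm_eq_0_iff by force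
qed

lemma T_cont: "f \<in> XR \<Longrightarrow> ((\<lambda>t. nrm (\<lambda>\<xi>. T t f \<xi> - f \<xi>)) \<longlongrightarrow> 0) (at_right 0)"
  using T[unfolded C0_semigroup_def, THEN conjunct2, THEN conjunct2, THEN conjunct2, THEN conjunct2, THEN conjunct2] by blast

lemma T_cong:
  assumes t: "t \<ge> 0" and f: "f \<in> XR" and g: "g \<in> XR" and ae: "AE \<xi> in M. f \<xi> = g \<xi>"
  shows "AE \<xi> in M. T t f \<xi> = T t g \<xi>"
proof -
  let ?d = "\<lambda>\<eta>. 1 *\<^sub>R f \<eta> + (-1) *\<^sub>R g \<eta>"
  have d: "?d \<in> XR" by (intro L2_Reals_lin f g)
  have "AE \<xi> in M. ?d \<xi> = 0" using ae by eventually_elim simp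
  then have "nrm ?d = 0" using nrm_eq_0_iff[OF XR_X[OF d]] by blast
  then have "nrm (T t ?d) \<le> 0" using T_bounded[OF t] d by (metis mult_zero_right)
  then have "AE \<xi> in M. T t ?d \<xi> = 0"
    using nrm_nonneg[OF XR_X[OF T_XR[OF t d]]] nrm_eq_0_iff[OF XR_X[OF T_XR[OF t d]]] by simp
  with T_lin[OF t f g, of 1 "-1"] show ?thesis by eventually_elim simp
qed

lemma T_lin4:
  assumes t: "t \<ge> 0" and f: "f1 \<in> XR" "f2 \<in> XR" "f3 \<in> XR" "f4 \<in> XR"
  shows "AE \<xi> in M. T t (\<lambda>\<eta>. (p *\<^sub>R f1 \<eta> + q *\<^sub>R f2 \<eta>) + (r *\<^sub>R f3 \<eta> + u *\<^sub>R f4 \<eta>)) \<xi> =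
    (p *\<^sub>R T t f1 \<xi> + q *\<^sub>R T t f2 \<xi>) + (r *\<^sub>R T t f3 \<xi> + u *\<^sub>R T t f4 \<xi>)"
  using T_lin[OF t L2_Reals_lin[OF f(1,2), of p q] L2_Reals_lin[OF f(3,4), of r u], of 1 1]
    T_lin[OF t f(1,2), of p q] T_lin[OF t f(3,4), of r u]
  by eventually_elim simp

definition Tc :: "real \<Rightarrow> 'a state \<Rightarrow> 'a state" where
  "Tc t f = pair (T t (re f)) (T t (im f))"

lemma Tc_X: "t \<ge> 0 \<Longrightarrow> f \<in> X \<Longrightarrow> Tc t f \<in> X"
  unfolding Tc_def by (intro pair_X T_XR L2_re_vec L2_im_vec)

lemma Tc_lin:
  assumes t: "t \<ge> 0" and f: "f \<in> X" and g: "g \<in> X"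
  shows "AE \<xi> in M. Tc t (\<lambda>\<eta>. c *s f \<eta> + d *s g \<eta>) \<xi> = c *s Tc t f \<xi> + d *s Tc t g \<xi>"
proof -
  note L = L2_re_vec[OF f] L2_im_vec[OF f] L2_re_vec[OF g] L2_im_vec[OF g]
  show ?thesis
    using T_lin4[OF t L, of "Re c" "- Im c" "Re d" "- Im d"] T_lin4[OF t L, of "Im c" "Re c" "Im d" "Re d"]
  proof eventually_elim
    case (elim \<xi>)
    have "Tc t (\<lambda>\<eta>. c *s f \<eta> + d *s g \<eta>) \<xi> =
      (Re c *\<^sub>R T t (re f) \<xi> + (- Im c) *\<^sub>R T t (im f) \<xi> + (Re d *\<^sub>R T t (re g) \<xi> + (- Im d) *\<^sub>R T t (im g) \<xi>)) +
      \<i> *s (Im c *\<^sub>R T t (re f) \<xi> + Re c *\<^sub>R T t (im f) \<xi> + (Im d *\<^sub>R T t (re g) \<xi> + Re d *\<^sub>R T t (im g) \<xi>))"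
      unfolding Tc_def re_vec_lin im_vec_lin elim ..
    then show ?case
      unfolding Tc_def by (simp add: vec_eq_iff complex_eq_iff algebra_simps)
  qed
qed

text \<open>One identity for two limits: \<open>r = 1\<close>, \<open>q = 0\<close> gives strong
  continuity, \<open>r = 1/t\<close>, \<open>q = 1\<close> the generator.\<close>

lemma Tc_diff_quotient:
  "(\<lambda>\<xi>. r *\<^sub>R (Tc t f \<xi> - f \<xi>) - q *\<^sub>R g \<xi>) =
    pair (\<lambda>\<xi>. r *\<^sub>R (T t (re f) \<xi> - re f \<xi>) - q *\<^sub>R re g \<xi>) (\<lambda>\<xi>. r *\<^sub>R (T t (im f) \<xi> - im f \<xi>) - q *\<^sub>R im g \<xi>)"
proof
  fix \<xi>
  have "r *\<^sub>R (Tc t f \<xi> - f \<xi>) - q *\<^sub>R g \<xi> = r *\<^sub>R (Tc t f \<xi> - (re f \<xi> + \<i> *s im f \<xi>)) - q *\<^sub>R (re g \<xi> + \<i> *s im g \<xi>)"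
    unfolding re_vec_im_vec ..
  then show "r *\<^sub>R (Tc t f \<xi> - f \<xi>) - q *\<^sub>R g \<xi> = r *\<^sub>R (T t (re f) \<xi> - re f \<xi>) - q *\<^sub>R re g \<xi> + \<i> *s (r *\<^sub>R (T t (im f) \<xi> - im f \<xi>) - q *\<^sub>R im g \<xi>)"
    by (simp add: Tc_def vec_eq_iff complex_eq_iff algebra_simps)
qed

text \<open>Each component is dominated by the pair, and the pair by the sum of its
  components.\<close>

lemma tendsto_pair_iff:
  assumes "\<And>t. t > 0 \<Longrightarrow> f t \<in> XR" "\<And>t. t > 0 \<Longrightarrow> g t \<in> XR"
  shows "((\<lambda>t. nrm (pair (f t) (g t))) \<longlongrightarrow> 0) (at_right (0::real)) \<longleftrightarrow>
    ((\<lambda>t. nrm (f t)) \<longlongrightarrow> 0) (at_right 0) \<and> ((\<lambda>t. nrm (g t)) \<longlongrightarrow> 0) (at_right 0)"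
proof -
  note pos = eventually_at_right_less[of "0::real"]
  have ev: "\<forall>\<^sub>F t in at_right 0. 0 \<le> nrm (f t)" "\<forall>\<^sub>F t in at_right 0. 0 \<le> nrm (g t)"
    "\<forall>\<^sub>F t in at_right 0. 0 \<le> nrm (pair (f t) (g t))"
    "\<forall>\<^sub>F t in at_right 0. nrm (f t) \<le> nrm (pair (f t) (g t))"
    "\<forall>\<^sub>F t in at_right 0. nrm (g t) \<le> nrm (pair (f t) (g t))"
    "\<forall>\<^sub>F t in at_right 0. nrm (pair (f t) (g t)) \<le> nrm (f t) + nrm (g t)"
    by (rule eventually_mono[OF pos], intro nrm_nonneg nrm_le_pair pair_X XR_X assms, assumption+)+
  have "((\<lambda>t. nrm (pair (f t) (g t))) \<longlongrightarrow> 0) (at_right 0)"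
    if "((\<lambda>t. nrm (f t)) \<longlongrightarrow> 0) (at_right 0)" "((\<lambda>t. nrm (g t)) \<longlongrightarrow> 0) (at_right 0)"
    by (rule tendsto_sandwich[OF ev(3,6) tendsto_const]) (use tendsto_add[OF that] in simp)
  moreover have "((\<lambda>t. nrm (f t)) \<longlongrightarrow> 0) (at_right 0) \<and> ((\<lambda>t. nrm (g t)) \<longlongrightarrow> 0) (at_right 0)"
    if "((\<lambda>t. nrm (pair (f t) (g t))) \<longlongrightarrow> 0) (at_right 0)"
    using tendsto_sandwich[OF ev(1,4) tendsto_const that] tendsto_sandwich[OF ev(2,5) tendsto_const that] by simp
  ultimately show ?thesis by blast
qed

lemma Tc_semigroup: "C0_semigroup UNIV X nrm Tc"
  unfolding C0_semigroup_def
proof (intro conjI allI impI ballI)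
  fix t :: real and f assume t: "t \<ge> 0" and f: "f \<in> X"
  show "Tc t f \<in> X" by (rule Tc_X[OF t f])
next
  fix t :: real and f g c d assume t: "t \<ge> 0" and f: "f \<in> X" and g: "g \<in> X"
  have "AE \<xi> in M. Tc t (\<lambda>\<eta>. c *s f \<eta> + d *s g \<eta>) \<xi> - (c *s Tc t f \<xi> + d *s Tc t g \<xi>) = 0"
    using Tc_lin[OF t f g, of c d] by eventually_elim simp
  then show "nrm (\<lambda>\<xi>. Tc t (\<lambda>\<eta>. c *s f \<eta> + d *s g \<eta>) \<xi> - (c *s Tc t f \<xi> + d *s Tc t g \<xi>)) = 0"
    by (subst nrm_eq_0_iff) (auto intro!: L2_diff L2_add L2_smult Tc_X t f g)
next
  fix t :: real assume t: "t \<ge> 0"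
  obtain C where C: "C \<ge> 0" "\<And>f. f \<in> XR \<Longrightarrow> nrm (T t f) \<le> C * nrm f" using T_bounded[OF t] by blast
  have "nrm (Tc t f) \<le> (2 * C) * nrm f" if f: "f \<in> X" for f
  proof -
    note L = L2_re_vec[OF f] L2_im_vec[OF f]
    have n: "nrm (re f) \<le> nrm f" "nrm (im f) \<le> nrm f" using nrm_le_pair(1,2)[OF L] unfolding pair_re_im by auto
    have "nrm (Tc t f) \<le> nrm (T t (re f)) + nrm (T t (im f))"
      unfolding Tc_def by (intro nrm_le_pair T_XR t L)
    also have "\<dots> \<le> C * nrm (re f) + C * nrm (im f)" by (intro add_mono C L)
    also have "\<dots> \<le> C * nrm f + C * nrm f" by (intro add_mono mult_left_mono n C)
    finally show ?thesis by simp
  qed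
  then show "\<exists>C. \<forall>f\<in>X. nrm (Tc t f) \<le> C * nrm f" by blast
next
  fix f assume f: "f \<in> X"
  have "AE \<xi> in M. Tc 0 f \<xi> = f \<xi>"
    using T_0[OF L2_re_vec[OF f]] T_0[OF L2_im_vec[OF f]] by eventually_elim (simp add: Tc_def re_vec_im_vec)
  then have "AE \<xi> in M. Tc 0 f \<xi> - f \<xi> = 0" by eventually_elim simp
  then show "nrm (\<lambda>\<xi>. Tc 0 f \<xi> - f \<xi>) = 0" by (subst nrm_eq_0_iff) (auto intro!: L2_diff Tc_X f)
next
  fix t r :: real and f assume t: "t \<ge> 0" and r: "r \<ge> 0" and f: "f \<in> X"
  note L = L2_re_vec[OF f] L2_im_vec[OF f]
  note TL = T_XR[OF r L(1)] T_XR[OF r L(2)]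
  have real: "AE \<xi> in M. T r (re f) \<xi> \<in> Fvec \<real>" "AE \<xi> in M. T r (im f) \<xi> \<in> Fvec \<real>"
    using TL by (auto simp: L2_Reals_iff)
  \<comment> \<open>\<open>T r\<close> returns states that are real only almost everywhere, so the
    components of \<open>Tc r f\<close> are recovered only up to a null set, and
    \<open>T_cong\<close> is needed before \<open>T t\<close> is applied to them.\<close>
  have 1: "AE \<xi> in M. re (Tc r f) \<xi> = T r (re f) \<xi>" and 2: "AE \<xi> in M. im (Tc r f) \<xi> = T r (im f) \<xi>"
    using real unfolding Tc_def by (eventually_elim, simp add: re_vec_real_pair)+
  note TcX = Tc_X[OF r f]
  have "AE \<xi> in M. Tc (t + r) f \<xi> = Tc t (Tc r f) \<xi>"
    using T_semi[OF t r L(1)] T_semi[OF t r L(2)]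
      T_cong[OF t L2_re_vec[OF TcX] TL(1) 1] T_cong[OF t L2_im_vec[OF TcX] TL(2) 2]
    by eventually_elim (simp add: Tc_def)
  then have "AE \<xi> in M. Tc (t + r) f \<xi> - Tc t (Tc r f) \<xi> = 0" by eventually_elim simp
  then show "nrm (\<lambda>\<xi>. Tc (t + r) f \<xi> - Tc t (Tc r f) \<xi>) = 0"
    by (subst nrm_eq_0_iff) (use t r in \<open>auto intro!: L2_diff Tc_X f\<close>)
next
  fix f assume f: "f \<in> X"
  note L = L2_re_vec[OF f] L2_im_vec[OF f]
  have eq: "(\<lambda>\<xi>. Tc t f \<xi> - f \<xi>) = pair (\<lambda>\<xi>. T t (re f) \<xi> - re f \<xi>) (\<lambda>\<xi>. T t (im f) \<xi> - im f \<xi>)" for t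
    using Tc_diff_quotient[of 1 t f 0] by simp
  show "((\<lambda>t. nrm (\<lambda>\<xi>. Tc t f \<xi> - f \<xi>)) \<longlongrightarrow> 0) (at_right 0)"
    unfolding eq by (subst tendsto_pair_iff) (auto intro!: L2_Reals_diff T_XR L T_cont)
qed

text \<open>Convergence of pairs is componentwise, so membership splits into two memberships in the
  real generator, which \<open>OpR_pair\<close> and \<open>Op_re_im\<close> identify with one in the
  complex operator.\<close>

lemma Tc_generator: "generator X nrm Tc = Op W"
proof -
  have iff: "(f, g) \<in> generator X nrm Tc \<longleftrightarrow> (re f, re g) \<in> OpR W \<and> (im f, im g) \<in> OpR W"
    if f: "f \<in> X" and g: "g \<in> X" for f g
  proof -
    note L = L2_re_vec[OF f] L2_im_vec[OF f] L2_re_vec[OF g] L2_im_vec[OF g]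
    have eq: "(\<lambda>\<xi>. (1/t) *\<^sub>R (Tc t f \<xi> - f \<xi>) - g \<xi>) =
      pair (\<lambda>\<xi>. (1/t) *\<^sub>R (T t (re f) \<xi> - re f \<xi>) - re g \<xi>) (\<lambda>\<xi>. (1/t) *\<^sub>R (T t (im f) \<xi> - im f \<xi>) - im g \<xi>)" for t
      using Tc_diff_quotient[of "1/t" t f 1 g] by simp
    show ?thesis
      unfolding gen[symmetric] generator_def mem_Collect_eq case_prod_conv eq
      by (subst tendsto_pair_iff) (auto intro!: L2_Reals_diff L2_Reals_scaleR T_XR L f g)
  qed
  show ?thesis
  proof (intro subset_antisym subsetI)
    fix p assume p: "p \<in> generator X nrm Tc"
    obtain f g where fg: "p = (f, g)" by (cases p)
    have X: "f \<in> X" "g \<in> X" using p by (auto simp: fg generator_def)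
    have "(pair (re f) (im f), pair (re g) (im g)) \<in> Op W"
      using iff[OF X] p OpR_pair unfolding fg by blast
    then show "p \<in> Op W" unfolding pair_re_im fg .
  next
    fix p assume p: "p \<in> Op W"
    obtain f g where fg: "p = (f, g)" by (cases p)
    have X: "f \<in> X" "g \<in> X" using p by (auto simp: fg hbcs_operator_def)
    show "p \<in> generator X nrm Tc" using iff[OF X] Op_re_im[OF W] p unfolding fg by blast
  qed
qed

end

section \<open>The transfer function\<close>

lemma matrix_inv_unique:
  fixes A B :: "complex^'n^'n"
  assumes "A ** B = mat 1" "B ** A = mat 1"
  shows "matrix_inv A = B"
proof -
  have "invertible A" using assms unfolding invertible_def by blast
  then have "matrix_inv A ** A = mat 1" by (rule matrix_inv_cancel)
  then show ?thesis using assms(1) by (metis matrix_mul_assoc matrix_mul_lid matrix_mul_rid)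
qed

lemma matrix_inv_mult:
  fixes A B :: "complex^'n^'n"
  assumes "invertible A" "invertible B"
  shows "matrix_inv (A ** B) = matrix_inv B ** matrix_inv A"
proof (rule matrix_inv_unique)
  note A = matrix_inv_cancel[OF assms(1)] and B = matrix_inv_cancel[OF assms(2)]
  show "A ** B ** (matrix_inv B ** matrix_inv A) = mat 1"
    by (metis A(1) B(1) matrix_mul_assoc matrix_mul_rid)
  show "matrix_inv B ** matrix_inv A ** (A ** B) = mat 1"
    by (metis A(2) B(2) matrix_mul_assoc matrix_mul_rid)
qed

lemma Reals_neq_UNIV: "(\<real>::complex set) \<noteq> UNIV"
proof
  assume "(\<real>::complex set) = UNIV"
  then have "\<i> \<in> \<real>" by simp
  then show False by (simp add: complex_is_Real_iff)
qed

lemma hblock_Fmat: "A \<in> Fmat F \<Longrightarrow> B \<in> Fmat F \<Longrightarrow> hblock A B \<in> Fmat F"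
  by (auto simp: Fmat_def hblock_def vstack_def split: sum.split)

text \<open>Over the reals the order tests real vectors only; for a real matrix the form splits
  along real and imaginary parts, which extends the bound to complex vectors.\<close>

lemma loewner_le_coercive:
  fixes A :: "complex^'n^'n"
  assumes F: "F = \<real> \<or> F = UNIV" and A: "A \<in> Fmat F" and le: "loewner_le F (mat (complex_of_real m)) A"
  shows "m * (norm x)\<^sup>2 \<le> (A *v x) \<bullet> x"
proof -
  have *: "m * (norm v)\<^sup>2 \<le> (A *v v) \<bullet> v" if "v \<in> Fvec F" for v
  proof -
    have "0 \<le> ((A - mat (complex_of_real m)) *v v) \<bullet> v"
      using le that by (simp add: loewner_le_def inner_eq_Re_cinner)
    then show ?thesis
      by (simp add: matrix_vector_mult_diff_rdistrib mat_mult_vec complex_scaleR_eq inner_diff_left dot_square_norm)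
  qed
  show ?thesis
  proof (cases "F = \<real>")
    case True
    have "(A *v (re_vec x + \<i> *s im_vec x)) \<bullet> (re_vec x + \<i> *s im_vec x) = (A *v re_vec x) \<bullet> re_vec x + (A *v im_vec x) \<bullet> im_vec x"
      by (rule inner_real_pair) (use A True in auto)
    \<comment> \<open>The same splitting for the identity matrix yields Pythagoras for the
      norm.\<close>
    moreover have "(mat 1 *v (re_vec x + \<i> *s im_vec x)) \<bullet> (re_vec x + \<i> *s im_vec x) = (mat 1 *v re_vec x) \<bullet> re_vec x + (mat 1 *v im_vec x) \<bullet> im_vec x"
      by (rule inner_real_pair) (auto simp: Fmat_def mat_def)
    ultimately have "(A *v x) \<bullet> x = (A *v re_vec x) \<bullet> re_vec x + (A *v im_vec x) \<bullet> im_vec x"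
      "(norm x)\<^sup>2 = (norm (re_vec x))\<^sup>2 + (norm (im_vec x))\<^sup>2"
      by (simp_all add: re_vec_im_vec dot_square_norm)
    then show ?thesis using *[of "re_vec x"] *[of "im_vec x"] True by (simp add: distrib_left)
  next
    case False
    then show ?thesis using * F by simp
  qed
qed

context hbcs
begin

lemma coefficients: obtains m0 C0 where "hyperbolic_coefficients a b m0 C0 P1 P0 H"
proof -
  obtain K where K: "K \<ge> 0" "\<And>(A::complex^'n^'n) (x::complex^'n). norm (A *v x) \<le> norm A * norm x * K"
    using bounded_bilinear.nonneg_bounded[OF bounded_bilinear_mv] by blast
  obtain CP where CP: "AE \<xi> in lebesgue_on {a..b}. norm (P0 \<xi>) \<le> CP" using P0_Linf by (auto simp: Linf_mat_def)
  obtain CH where CH: "AE \<xi> in lebesgue_on {a..b}. norm (H \<xi>) \<le> CH" using H_Linf by (auto simp: Linf_mat_def)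
  have HF: "AE \<xi> in lebesgue_on {a..b}. H \<xi> \<in> Fmat F" using H_Linf by (auto simp: Linf_mat_def)
  obtain m where m: "m > 0" "AE \<xi> in lebesgue_on {a..b}. loewner_le F (mat (complex_of_real m)) (H \<xi>)"
    using H_bounds by (auto elim!: eventually_mono)
  \<comment> \<open>One constant for both coefficients; the added 1 makes it positive.\<close>
  define C where "C = (\<bar>CP\<bar> + \<bar>CH\<bar>) * K + 1"
  have C: "C > 0" using K by (simp add: C_def add_nonneg_pos)
  have bd: "norm (A *v x) \<le> C * norm x" if "norm A \<le> CP \<or> norm A \<le> CH" for A :: "complex^'n^'n" and x
  proof -
    have "norm A * norm x * K \<le> (\<bar>CP\<bar> + \<bar>CH\<bar>) * norm x * K" using that K by (intro mult_right_mono) auto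
    also have "\<dots> \<le> C * norm x" by (simp add: C_def algebra_simps)
    finally show ?thesis using K(2)[of A x] by linarith
  qed
  have "hyperbolic_coefficients a b m C P1 P0 H"
  proof
    show "AE \<xi> in lebesgue_on {a..b}. (\<forall>x. norm (P0 \<xi> *v x) \<le> C * norm x) \<and>
      (\<forall>x. norm (H \<xi> *v x) \<le> C * norm x) \<and> (\<forall>x. m * (norm x)\<^sup>2 \<le> (H \<xi> *v x) \<bullet> x) \<and>
      (\<forall>x y. (H \<xi> *v x) \<bullet> y = x \<bullet> (H \<xi> *v y))"
      using CP CH HF m(2) H_self_adjoint
    proof eventually_elim
      case (elim \<xi>)
      then show ?case using bd loewner_le_coercive[OF field elim(3,4)] self_adjoint_inner[OF elim(5)] by blast
    qed
  qed (use interval P1_invertible m C P0_Linf H_Linf in \<open>auto simp: Linf_mat_def\<close>)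
  then show thesis by (rule that)
qed

lemma Q_mat_Fmat: "Q_mat F P1 \<sigma> \<in> Fmat F"
  using field P1_mat P1_self_adjoint Q_mat_Reals[of P1 \<sigma>] by auto

lemma real_coefficients:
  assumes "F = \<real>" "hyperbolic_coefficients a b m0 C0 P1 P0 H"
  shows "real_hyperbolic_coefficients a b m0 C0 P1 P0 H"
proof -
  interpret hyperbolic_coefficients a b m0 C0 P1 P0 H by fact
  show ?thesis by unfold_locales (use assms(1) P1_mat P0_Linf H_Linf in \<open>auto simp: Linf_mat_def\<close>)
qed

end

text \<open>The two invertibility claims belong to the conclusion because \<open>matrix_inv\<close>
  of a singular matrix is an arbitrary value; with them the formula speaks of true inverses.\<close>

theorem lemma16:
  fixes F :: "complex set" and a b \<alpha> :: real
    and P1 :: "complex^'n^('n::finite)"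
    and P0 H :: "real \<Rightarrow> complex^'n^'n"
    and WB WC :: "complex^('n + 'n)^'n"
    and K M :: "complex^'n^'n"
  assumes "hbcs F a b P1 P0 H WB WC"
    and "K \<in> Fmat F" and "M \<in> Fmat F" and "invertible K"
    and "WB = K ** hblock (Q_plus F P1 - M ** Q_minus F P1) (Q_minus F P1 - M ** Q_plus F P1)"
    and "right_half_plane \<alpha> \<subseteq> hbcs_resolvent_set F a b P1 P0 H (hblock (Q_plus F P1) (Q_minus F P1))"
  shows "(\<forall>s \<in> hbcs_resolvent_set F a b P1 P0 H WB \<inter> right_half_plane \<alpha>.
            invertible (V_fun F a b P1 P0 H s) \<and>
            invertible (mat 1 - M ** U_fun F a b P1 P0 H s) \<and>
            transfer_function a b P1 P0 H WB WC s =
              Z_fun F a b P1 P0 H WC s ** matrix_inv (mat 1 - M ** U_fun F a b P1 P0 H s) ** matrix_inv K) \<and>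
         (\<exists>\<alpha>'\<ge>\<alpha>. right_half_plane \<alpha>' \<subseteq> hbcs_resolvent_set F a b P1 P0 H WB \<inter> right_half_plane \<alpha> \<and>
            (\<forall>s \<in> right_half_plane \<alpha>'.
               transfer_function a b P1 P0 H WB WC s =
                 Z_fun F a b P1 P0 H WC s ** matrix_inv (mat 1 - M ** U_fun F a b P1 P0 H s) ** matrix_inv K))"
proof -
  interpret hbcs F a b P1 P0 H WB WC by (rule assms(1))
  obtain m0 C0 where coeff: "hyperbolic_coefficients a b m0 C0 P1 P0 H" using coefficients .
  interpret hc: hyperbolic_coefficients a b m0 C0 P1 P0 H by (rule coeff)
  have compl: "complexification F (hbcs_operator F a b P1 P0 H W) = hc.Op W" if "W \<in> Fmat F" for W
  proof (cases "F = \<real>")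
    case True
    interpret real_hyperbolic_coefficients a b m0 C0 P1 P0 H by (rule real_coefficients[OF True coeff])
    show ?thesis using complexification_OpR that True by simp
  next
    case False
    then show ?thesis using field by (simp add: complexification_def Reals_neq_UNIV[symmetric])
  qed
  \<comment> \<open>Used twice: for \<open>WB\<close>, and for the boundary matrix of the comparison
    operator, where it makes \<open>V\<close> invertible.\<close>
  have res: "s \<in> hbcs_resolvent_set F a b P1 P0 H W \<longleftrightarrow> invertible (hc.bdry_mat W s)" if "W \<in> Fmat F" for W s
    unfolding hbcs_resolvent_set_def compl[OF that]
    using hc.resolvent_set_imp_invertible hc.invertible_imp_resolvent_set by blast
  let ?Qp = "Q_plus F P1" and ?Qm = "Q_minus F P1"
  have formula: "invertible (V_fun F a b P1 P0 H s) \<and> invertible (mat 1 - M ** U_fun F a b P1 P0 H s) \<and>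
            transfer_function a b P1 P0 H WB WC s =
              Z_fun F a b P1 P0 H WC s ** matrix_inv (mat 1 - M ** U_fun F a b P1 P0 H s) ** matrix_inv K"
    if s: "s \<in> hbcs_resolvent_set F a b P1 P0 H WB \<inter> right_half_plane \<alpha>" for s
  proof -
    define V where "V = V_fun F a b P1 P0 H s"
    define U where "U = U_fun F a b P1 P0 H s"
    define D where "D = mat 1 - M ** U"
    have "V = hc.bdry_mat (hblock ?Qp ?Qm) s"
      by (rule Fmat_Reals_eqI)
        (simp add: V_def V_fun_def hc.bdry_mat_mv hblock_mult_vstack matrix_vector_mult_add_rdistrib matrix_vector_mul_assoc)
    then have V: "invertible V"
      using s assms(6) res[OF hblock_Fmat[OF Q_mat_Fmat Q_mat_Fmat], of s 1 "- 1"] by auto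
    have N: "invertible (hc.bdry_mat WB s)" using s res[OF WB_mat] by blast
    have UV: "U ** V = ?Qp + ?Qm ** hc.\<Psi> s b"
      unfolding U_def U_fun_def V_def[symmetric]
      by (simp add: matrix_inv_cancel[OF V] flip: matrix_mul_assoc)
    \<comment> \<open>Multiplying by \<open>V\<close> cancels the inverse inside \<open>U\<close>,
      so both sides are linear in the two boundary values and agree by the form of
      \<open>WB\<close>.\<close>
    have NK: "hc.bdry_mat WB s = K ** (D ** V)"
    proof (rule Fmat_Reals_eqI)
      fix v
      let ?p = "hc.\<Psi> s b *v v"
      have "(D ** V) *v v = V *v v - M *v ((U ** V) *v v)"
        by (simp add: D_def matrix_vector_mult_diff_rdistrib flip: matrix_vector_mul_assoc)
      also have "\<dots> = (?Qm *v v + ?Qp *v ?p) - M *v (?Qp *v v + ?Qm *v ?p)"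
        unfolding UV by (simp add: V_def V_fun_def matrix_vector_mult_add_rdistrib flip: matrix_vector_mul_assoc)
      also have "\<dots> = (?Qp - M ** ?Qm) *v ?p + (?Qm - M ** ?Qp) *v v"
        by (simp add: matrix_vector_mult_diff_rdistrib matrix_vector_right_distrib flip: matrix_vector_mul_assoc)
      finally show "hc.bdry_mat WB s *v v = (K ** (D ** V)) *v v"
        by (simp add: hc.bdry_mat_mv assms(5) hblock_mult_vstack flip: matrix_vector_mul_assoc)
    qed
    \<comment> \<open>A kernel vector \<open>x\<close> of \<open>D\<close> gives the kernel vector
      \<open>matrix_inv V *v x\<close> of the invertible boundary matrix
      \<open>K ** (D ** V)\<close>.\<close>
    have D: "invertible D" unfolding hc.invertible_iff_ker
    proof (intro allI impI)
      fix x assume x: "D *v x = 0"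
      have "hc.bdry_mat WB s *v (matrix_inv V *v x) = K *v (D *v (V *v (matrix_inv V *v x)))"
        by (simp add: NK matrix_vector_mul_assoc matrix_mul_assoc)
      then have "hc.bdry_mat WB s *v (matrix_inv V *v x) = 0" using x by (simp add: matrix_inv_mv_cancel[OF V])
      then have "matrix_inv V *v x = 0" using N hc.invertible_iff_ker by blast
      then show "x = 0" using matrix_inv_mv_cancel(1)[OF V, of x] by simp
    qed
    have "matrix_inv (hc.bdry_mat WB s) = matrix_inv V ** matrix_inv D ** matrix_inv K"
      unfolding NK matrix_inv_mult[OF assms(4) invertible_mult[OF D V]] matrix_inv_mult[OF D V] ..
    then have "transfer_function a b P1 P0 H WB WC s = Z_fun F a b P1 P0 H WC s ** matrix_inv D ** matrix_inv K"
      unfolding hc.transfer_function_eq[OF N] Z_fun_def V_def[symmetric] by (simp add: matrix_mul_assoc)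
    then show ?thesis using V D unfolding D_def U_def V_def by blast
  qed
  obtain T where T: "C0_semigroup F (L2 F a b) (X_norm a b H) T"
    "generator (L2 F a b) (X_norm a b H) T = hbcs_operator F a b P1 P0 H WB"
    using generates unfolding generates_C0_semigroup_def by blast
  obtain Tc where Tc: "C0_semigroup UNIV hc.X hc.nrm Tc" "generator hc.X hc.nrm Tc = hc.Op WB"
  proof (cases "F = \<real>")
    case True
    interpret real_hyperbolic_coefficients a b m0 C0 P1 P0 H by (rule real_coefficients[OF True coeff])
    interpret real_semigroup_hyperbolic a b m0 C0 P1 P0 H T WB
      by unfold_locales (use T WB_mat True in auto)
    show thesis using that Tc_semigroup Tc_generator by blast
  next
    case False
    then have "F = UNIV" using field by blast
    then show thesis using that T by simp
  qed
  interpret semigroup_hyperbolic a b m0 C0 P1 P0 H Tc WB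
    by unfold_locales (use Tc in auto)
  obtain \<omega> where \<omega>: "\<And>s. Re s > \<omega> \<Longrightarrow> invertible (hc.bdry_mat WB s)" using large_not_eigenvalue by blast
  have "right_half_plane (max \<alpha> \<omega>) \<subseteq> hbcs_resolvent_set F a b P1 P0 H WB \<inter> right_half_plane \<alpha>"
    using \<omega> res[OF WB_mat] by (auto simp: right_half_plane_def)
  then show ?thesis using formula by (intro conjI ballI exI[of _ "max \<alpha> \<omega>"]) auto
qed

end
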